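(* Let $n>m\ge 1$, let $g:\mathbb{R}^n\to\mathbb{R}^m$ be $C^\infty$, let $y\in\mathrm{range}(g)$ be a regular value of $g$, and let $\ell(x):=\frac12|y-g(x)|^2$. Let $\lambda_1(x)\ge\lambda_2(x)\ge\cdots$ be the eigenvalues of the Hessian $\nabla^2\ell(x)$. Let $$T:=\{(x,2/\lambda_1(x)):x\in g^{-1}\{y\}\}\subset\mathbb{R}^n\times\mathbb{R},$$ $$f:\mathbb{R}^n\times\mathbb{R}\to\mathbb{R}^n\times\mathbb{R},\qquad f(x,\eta):=(x-\eta\nabla\ell(x),\eta),$$ and let $\widetilde{T}\subset T$ be the closed subset of those points $(x,2/\lambda_1(x))\in T$ with $\lambda_1(x)=\lambda_2(x)$. Let $\nu T|_{T\setminus\widetilde T}=E_c\oplus E_s$ be the $Df$-invariant splitting of the normal bundle of $T\setminus\widetilde T$ for which $Df|_{E_c}$ has eigenvalues $\pm1$ and $Df|_{E_s}$ has eigenvalues in $(-1,1)$. Let $k\in\mathbb{N}$, $k\geq 2$. Then about any point $x\in T\setminus\widetilde{T}$, there is an open neighbourhood $U\subset T\setminus\widetilde{T}$ of $x$ and a $C^k$ centre manifold $W^{c}_U$ containing $U$, tangent at $U$ to $TU\oplus E_c|_U$ and $C^k$-foliated by leaves tangent at $U$ to $E_c|_U$.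
   Context: Along $g^{-1}\{y\}$ one has $\nabla^2\ell=Dg^TDg$, and $g^{-1}\{y\}$ is an $(n-m)$-dimensional smooth manifold. $T$ is a Lipschitz manifold of fixed points of $f$ which is smooth outside $\widetilde T$. Over $T\setminus\widetilde T$, the normal bundle $\nu T$ in $\mathbb{R}^n\times\mathbb{R}$ is preserved by $Df$, and $E_c$ has rank 2. A $C^k$ centre manifold containing $U$ means a $C^k$-embedded submanifold $W^c_U\supset U$ of $\mathbb{R}^n\times\mathbb{R}$ which is (locally) $f$-invariant, i.e. there is a neighbourhood $V$ of $U$ in $W^c_U$ with $f(V)\subset W^c_U$. "Tangent at $U$ to $E$" means that the tangent space at each point $p\in U$ (of $W^c_U$, respectively of the leaf through $p$) equals $E_p$. *)

theory Defs
  imports "HOL-Analysis.Analysis" "HOL-Library.Multiset"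
begin

(* C^k maps on an open set. In finite dimensions, k-fold continuous Frechet differentiability
   is the same as continuity of all iterated directional derivatives of a map which is
   differentiable at each stage. Only meant for open S. *)
primrec Ck_on :: "nat \<Rightarrow> ('a::euclidean_space \<Rightarrow> 'b::euclidean_space) \<Rightarrow> 'a set \<Rightarrow> bool" where
  "Ck_on 0 h S \<longleftrightarrow> continuous_on S h"
| "Ck_on (Suc k) h S \<longleftrightarrow>
     (\<forall>x\<in>S. h differentiable (at x)) \<and>
     (\<forall>v. Ck_on k (\<lambda>x. frechet_derivative h (at x) v) S)"

definition smooth_on :: "('a::euclidean_space \<Rightarrow> 'b::euclidean_space) \<Rightarrow> 'a set \<Rightarrow> bool" where
  "smooth_on h S \<longleftrightarrow> (\<forall>k. Ck_on k h S)"

definition Ck_diffeo ::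
  "nat \<Rightarrow> 'a::euclidean_space set \<Rightarrow> 'b::euclidean_space set \<Rightarrow> ('a \<Rightarrow> 'b) \<Rightarrow> ('b \<Rightarrow> 'a) \<Rightarrow> bool" where
  "Ck_diffeo k A B \<phi> \<psi> \<longleftrightarrow>
     open A \<and> open B \<and> homeomorphism A B \<phi> \<psi> \<and> Ck_on k \<phi> A \<and> Ck_on k \<psi> B"

definition regular_value :: "('a::euclidean_space \<Rightarrow> 'b::euclidean_space) \<Rightarrow> 'b \<Rightarrow> bool" where
  "regular_value g y \<longleftrightarrow> (\<forall>x. g x = y \<longrightarrow> surj (frechet_derivative g (at x)))"

definition gradient :: "('a::euclidean_space \<Rightarrow> real) \<Rightarrow> 'a \<Rightarrow> 'a" where
  "gradient h x = (THE D. GDERIV h x :> D)"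

definition hessian :: "('a::euclidean_space \<Rightarrow> real) \<Rightarrow> 'a \<Rightarrow> 'a \<Rightarrow> 'a" where
  "hessian h x = frechet_derivative (gradient h) (at x)"

definition eigenspace :: "('a::euclidean_space \<Rightarrow> 'a) \<Rightarrow> real \<Rightarrow> 'a set" where
  "eigenspace A r = {v. A v = r *\<^sub>R v}"

(* Each eigenvalue is counted with the dimension of its eigenspace; for self-adjoint operators
   such as the Hessian of a smooth function this is also its algebraic multiplicity. *)
definition eigenvalue_mset :: "('a::euclidean_space \<Rightarrow> 'a) \<Rightarrow> real multiset" where
  "eigenvalue_mset A =
     (\<Sum>r\<in>{r. eigenspace A r \<noteq> {0}}. replicate_mset (dim (eigenspace A r)) r)"

(* The i-th eigenvalue in decreasing order, i = 1, 2, ..., repeated according to multiplicity. *)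
definition eigenvalue_nr :: "('a::euclidean_space \<Rightarrow> 'a) \<Rightarrow> nat \<Rightarrow> real" where
  "eigenvalue_nr A i = rev (sorted_list_of_multiset (eigenvalue_mset A)) ! (i - 1)"

definition restricted_eigenvalues :: "('a::euclidean_space \<Rightarrow> 'a) \<Rightarrow> 'a set \<Rightarrow> real set" where
  "restricted_eigenvalues A E = {r. \<exists>v\<in>E. v \<noteq> 0 \<and> A v = r *\<^sub>R v}"

(* d-dimensional embedded C^k submanifolds, described by slice charts of the ambient space. *)
definition Ck_submanifold :: "nat \<Rightarrow> nat \<Rightarrow> 'a::euclidean_space set \<Rightarrow> bool" where
  "Ck_submanifold k d W \<longleftrightarrow>
     (\<forall>p\<in>W. \<exists>A B (\<phi>::'a \<Rightarrow> 'a) \<psi> L. p \<in> A \<and> Ck_diffeo k A B \<phi> \<psi> \<and>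
        subspace L \<and> dim L = d \<and> \<phi> ` (A \<inter> W) = B \<inter> L)"

(* Velocities at p of C^1 curves that stay inside S. The C^1 requirement on a whole interval (and
   not merely differentiability at 0) is what makes this the correct tangent space also for
   leaves of a foliation, which are only injectively immersed and may be dense. *)
definition tangent_space :: "'a::euclidean_space set \<Rightarrow> 'a \<Rightarrow> 'a set" where
  "tangent_space S p =
     {v. \<exists>\<gamma> e. e > 0 \<and> \<gamma> C1_differentiable_on {-e<..<e} \<and> \<gamma> ` {-e<..<e} \<subseteq> S \<and>
           \<gamma> 0 = p \<and> (\<gamma> has_vector_derivative v) (at 0)}"

definition normal_space :: "'a::euclidean_space set \<Rightarrow> 'a \<Rightarrow> 'a set" where
  "normal_space S p = (tangent_space S p)\<^sup>\<bottom>"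

definition is_direct_sum :: "'a::euclidean_space set \<Rightarrow> 'a set \<Rightarrow> 'a set \<Rightarrow> bool" where
  "is_direct_sum V A B \<longleftrightarrow>
     subspace A \<and> subspace B \<and> A \<inter> B = {0} \<and> V = {a + b | a b. a \<in> A \<and> b \<in> B}"

(* LL is the set of leaves of a C^k foliation of the d-dimensional submanifold W by q-dimensional
   leaves: W is partitioned into path-connected leaves, and near every point there is a slice chart
   in which the components of each leaf are the q-dimensional plaques parallel to a fixed P. *)
definition Ck_foliation ::
  "nat \<Rightarrow> nat \<Rightarrow> nat \<Rightarrow> 'a::euclidean_space set \<Rightarrow> 'a set set \<Rightarrow> bool" where
  "Ck_foliation k q d W LL \<longleftrightarrow>
     \<Union> LL = W \<and> pairwise disjnt LL \<and> (\<forall>F\<in>LL. F \<noteq> {} \<and> path_connected F) \<and>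
     (\<forall>p\<in>W. \<exists>A B (\<phi>::'a \<Rightarrow> 'a) \<psi> L P. p \<in> A \<and> Ck_diffeo k A B \<phi> \<psi> \<and>
        subspace L \<and> dim L = d \<and> \<phi> ` (A \<inter> W) = B \<inter> L \<and>
        subspace P \<and> dim P = q \<and> P \<subseteq> L \<and>
        (\<forall>F\<in>LL. \<forall>C\<in>components (A \<inter> F). \<exists>c\<in>L. \<phi> ` C = {z\<in>B. z - c \<in> P}))"

definition centre_manifold ::
  "nat \<Rightarrow> nat \<Rightarrow> ('a::euclidean_space \<Rightarrow> 'a) \<Rightarrow> 'a set \<Rightarrow> 'a set \<Rightarrow> bool" where
  "centre_manifold k d f U W \<longleftrightarrow>
     Ck_submanifold k d W \<and> U \<subseteq> W \<and>
     (\<exists>V. openin (top_of_set W) V \<and> U \<subseteq> V \<and> f ` V \<subseteq> W)"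

(* For gradient descent Df is self-adjoint at its fixed points on T, where the gradient vanishes.
   Hence real eigenvalues suffice here and the conditions determine Ec and Es uniquely on S. *)
definition centre_stable_splitting ::
  "('a::euclidean_space \<Rightarrow> 'a) \<Rightarrow> 'a set \<Rightarrow> ('a \<Rightarrow> 'a set) \<Rightarrow> ('a \<Rightarrow> 'a set) \<Rightarrow> bool" where
  "centre_stable_splitting f S Ec Es \<longleftrightarrow>
     (\<forall>p\<in>S. let Df = frechet_derivative f (at p) in
        is_direct_sum (normal_space S p) (Ec p) (Es p) \<and>
        Df ` Ec p \<subseteq> Ec p \<and> Df ` Es p \<subseteq> Es p \<and>
        restricted_eigenvalues Df (Ec p) = {1, -1} \<and>
        restricted_eigenvalues Df (Es p) \<subseteq> {-1<..<1})"

definition loss :: "(real^'n \<Rightarrow> real^'m) \<Rightarrow> real^'m \<Rightarrow> real^'n \<Rightarrow> real" where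
  "loss g y x = 1/2 * (norm (y - g x))\<^sup>2"

definition lam :: "(real^'n \<Rightarrow> real^'m) \<Rightarrow> real^'m \<Rightarrow> nat \<Rightarrow> real^'n \<Rightarrow> real" where
  "lam g y i x = eigenvalue_nr (hessian (loss g y) x) i"

definition gd_step ::
  "(real^'n \<Rightarrow> real^'m) \<Rightarrow> real^'m \<Rightarrow> (real^'n) \<times> real \<Rightarrow> (real^'n) \<times> real" where
  "gd_step g y = (\<lambda>(x, \<eta>). (x - \<eta> *\<^sub>R gradient (loss g y) x, \<eta>))"

definition T_set :: "(real^'n \<Rightarrow> real^'m) \<Rightarrow> real^'m \<Rightarrow> ((real^'n) \<times> real) set" where
  "T_set g y = {(x, 2 / lam g y 1 x) | x. g x = y}"

definition T_tilde :: "(real^'n \<Rightarrow> real^'m) \<Rightarrow> real^'m \<Rightarrow> ((real^'n) \<times> real) set" where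
  "T_tilde g y = {(x, 2 / lam g y 1 x) | x. g x = y \<and> lam g y 1 x = lam g y 2 x}"

end

theory Submission
  imports Defs
begin

text \<open>
  Let \<open>p \<in> T\<close> be a point where the top eigenvalue is simple. At its fixed points near \<open>p\<close> the gradient
  descent map \<open>f\<close> has a self-adjoint derivative, so after splitting off the eigenvalues \<open>1\<close> and \<open>-1\<close>
  at \<open>p\<close> one is left with a contraction.
  The local centre manifold is obtained by the Lyapunov--Perron method: after cutting off the
  nonlinearity, a point lies on the centre manifold iff it has a backward orbit of slow growth, and the
  backward orbit over a given centre component is the fixed point of a contraction in a weighted space
  of sequences. All derivatives of the Picard iterates are bounded, uniformly in the iteration, by slowly
  growing geometric sequences, so Landau's interpolation inequality upgrades uniform convergence of the
  iterates to convergence of their derivatives. This gives a \<open>C\<^sup>k\<close> map \<open>H\<close> whose fixed points form an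
  invariant manifold, which contains all fixed points of \<open>f\<close> near \<open>p\<close> and is tangent there to the
  eigenspaces of \<open>1\<close> and \<open>-1\<close>.
  At a point \<open>q = (x, 2 / \<lambda>)\<close> of \<open>T\<close>, \<open>E\<^sub>c\<close> is spanned by \<open>e1 = (v, 0)\<close>, where \<open>v\<close> is the top eigenvector
  of the Hessian, and \<open>e2 = (-w, 1)\<close>, where \<open>w\<close> is the gradient of \<open>2 / \<lambda>\<close> along the level set. The
  implicit function theorem makes these depend smoothly on \<open>q\<close>, and
  \<open>(q, a, b) \<mapsto> p + H (q - p + a e1 + b e2)\<close> is a foliated parametrisation of the centre manifold.
\<close>

section \<open>Calculus of \<open>C\<^sup>k\<close> maps\<close>

text \<open>Two obstacles shape the argument. The derivative of \<open>f\<close> need not be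
  invertible, since \<open>1 - \<eta> \<lambda>\<close> vanishes if \<open>\<lambda>\<close> is half
  the top eigenvalue; so backward orbits cannot come from inverting \<open>f\<close>, and only the
  centre part, where the linearisation is its own inverse, is ever run backwards. Moreover,
  substitution into a nonlinearity is in general not differentiable on a single weighted sequence
  space, because each derivative multiplies growth rates. The fixed point is therefore not
  differentiated in a Banach space: the iterates are differentiated one by one, in weights that
  worsen with the order, and the finitely many weights needed fit into the gap between the stable
  eigenvalues and 1. Landau's inequality costs one derivative, which smoothness of \<open>g\<close>
  provides. The foliation is not asked to be invariant, only tangent to the prescribed planes along
  \<open>U\<close>. Hence flat planes spanned by \<open>e1\<close> and \<open>e2\<close> can simply
  be bent into the manifold by \<open>H\<close>; this works because the derivative of
  \<open>H\<close> fixes these eigenvectors at every fixed point near \<open>p\<close>, not only at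
  \<open>p\<close>.\<close>

lemma frechet_derivative_eqI:
  assumes "(h has_derivative h') (at x)"
  shows "frechet_derivative h (at x) = h'"
  using frechet_derivative_at[OF assms] by simp

lemma differentiable_has_derivative:
  "h differentiable (at x) \<Longrightarrow> (h has_derivative frechet_derivative h (at x)) (at x)"
  by (simp add: frechet_derivative_works)

lemma linear_frechet_derivative:
  "h differentiable (at x) \<Longrightarrow> linear (frechet_derivative h (at x))"
  by (rule has_derivative_linear[OF differentiable_has_derivative])

lemma Ck_on_cong_imp:
  assumes "open S" "\<And>x. x \<in> S \<Longrightarrow> h x = h' x" "Ck_on k h S"
  shows "Ck_on k h' S"
  using assms(2,3)
proof (induction k arbitrary: h h')
  case 0
  then show ?case using continuous_on_cong by (metis Ck_on.simps(1))
next
  case (Suc k)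
  have der: "(h' has_derivative frechet_derivative h (at x)) (at x)" if "x \<in> S" for x
    using has_derivative_transform_within_open[OF differentiable_has_derivative assms(1) that]
      Suc.prems that by auto
  show ?case
    unfolding Ck_on.simps
  proof (intro conjI ballI allI)
    fix x assume "x \<in> S"
    then show "h' differentiable (at x)" using der differentiable_def by blast
  next
    fix v
    show "Ck_on k (\<lambda>x. frechet_derivative h' (at x) v) S"
    proof (rule Suc.IH[of "\<lambda>x. frechet_derivative h (at x) v"])
      show "frechet_derivative h (at x) v = frechet_derivative h' (at x) v" if "x \<in> S" for x
        using frechet_derivative_eqI[OF der[OF that]] by simp
      show "Ck_on k (\<lambda>x. frechet_derivative h (at x) v) S" using Suc.prems by simp
    qed
  qed
qed

lemma Ck_on_subset: "Ck_on k h S \<Longrightarrow> T \<subseteq> S \<Longrightarrow> Ck_on k h T"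
  by (induction k arbitrary: h) (auto intro: continuous_on_subset)

lemma Ck_on_SucD: "Ck_on (Suc k) h S \<Longrightarrow> Ck_on k h S"
proof (induction k arbitrary: h)
  case 0
  then show ?case
    by (auto intro!: continuous_at_imp_continuous_on differentiable_imp_continuous_within)
qed auto

lemma Ck_on_le: "Ck_on k h S \<Longrightarrow> j \<le> k \<Longrightarrow> Ck_on j h S"
  by (induction k) (auto simp: le_Suc_eq intro: Ck_on_SucD simp del: Ck_on.simps)

lemma Ck_on_continuous: "Ck_on k h S \<Longrightarrow> continuous_on S h"
  using Ck_on_le[of k h S 0] by simp

lemma Ck_on_differentiable: "Ck_on (Suc k) h S \<Longrightarrow> x \<in> S \<Longrightarrow> h differentiable (at x)"
  by simp

lemma Ck_on_has_derivative:
  "Ck_on (Suc k) h S \<Longrightarrow> x \<in> S \<Longrightarrow> (h has_derivative frechet_derivative h (at x)) (at x)"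
  by (simp add: differentiable_has_derivative)

lemma Ck_on_frechet: "Ck_on (Suc k) h S \<Longrightarrow> Ck_on k (\<lambda>x. frechet_derivative h (at x) v) S"
  by simp

text \<open>Lets an explicit formula replace \<open>frechet_derivative\<close> in inductive steps;
  as \<open>S\<close> is open, the two agree near each point, so all further derivatives agree
  too.\<close>

lemma Ck_on_SucI:
  assumes "open S" "\<And>x. x \<in> S \<Longrightarrow> (h has_derivative h' x) (at x)"
    and "\<And>v. Ck_on k (\<lambda>x. h' x v) S"
  shows "Ck_on (Suc k) h S"
  unfolding Ck_on.simps
proof (intro conjI ballI allI)
  fix v
  show "Ck_on k (\<lambda>x. frechet_derivative h (at x) v) S"
    by (rule Ck_on_cong_imp[OF assms(1) _ assms(3)[of v]])
      (simp add: frechet_derivative_eqI[OF assms(2)])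
qed (use assms(2) differentiable_def in blast)

lemma Ck_on_const: "Ck_on k (\<lambda>x. c) S"
  by (induction k arbitrary: c) auto

lemma Ck_on_linear:
  assumes "bounded_linear f" "open S"
  shows "Ck_on k f S"
proof (cases k)
  case 0
  then show ?thesis using assms linear_continuous_on by auto
next
  case (Suc j)
  then show ?thesis
    using Ck_on_SucI[OF assms(2) bounded_linear_imp_has_derivative[OF assms(1)]] Ck_on_const by blast
qed

lemma Ck_on_linear_compose:
  assumes "bounded_linear f" "open S" "Ck_on k h S"
  shows "Ck_on k (\<lambda>x. f (h x)) S"
  using assms(3)
proof (induction k arbitrary: h)
  case 0
  then show ?case
    using linear_continuous_on_compose[OF _ bounded_linear.linear[OF assms(1)]] by auto
next
  case (Suc k)
  show ?case
    by (rule Ck_on_SucI[OF assms(2) bounded_linear.has_derivative[OF assms(1) Ck_on_has_derivative[OF Suc.prems]]])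
      (use Suc in auto)
qed

lemma Ck_on_add:
  assumes "open S" "Ck_on k f S" "Ck_on k h S"
  shows "Ck_on k (\<lambda>x. f x + h x) S"
  using assms(2,3)
proof (induction k arbitrary: f h)
  case 0
  then show ?case by (auto intro: continuous_intros)
next
  case (Suc k)
  show ?case
    by (rule Ck_on_SucI[OF assms(1) has_derivative_add[OF Ck_on_has_derivative[OF Suc.prems(1)]
       Ck_on_has_derivative[OF Suc.prems(2)]]]) (use Suc in auto)
qed

lemma Ck_on_sum:
  assumes "open S" "\<And>i. i \<in> I \<Longrightarrow> Ck_on k (f i) S"
  shows "Ck_on k (\<lambda>x. \<Sum>i\<in>I. f i x) S"
  using assms(2)
  by (induction I rule: infinite_finite_induct) (auto intro: Ck_on_const Ck_on_add[OF assms(1)])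

lemma Ck_on_minus: "open S \<Longrightarrow> Ck_on k h S \<Longrightarrow> Ck_on k (\<lambda>x. - h x) S"
  using Ck_on_linear_compose[OF bounded_linear_minus[OF bounded_linear_ident]] by blast

lemma Ck_on_diff:
  "open S \<Longrightarrow> Ck_on k f S \<Longrightarrow> Ck_on k h S \<Longrightarrow> Ck_on k (\<lambda>x. f x - h x) S"
  using Ck_on_add[OF _ _ Ck_on_minus, of S k f h] by simp

lemma Ck_on_bilinear:
  fixes prod :: "'b::euclidean_space \<Rightarrow> 'c::euclidean_space \<Rightarrow> 'd::euclidean_space"
    and f :: "'a::euclidean_space \<Rightarrow> 'b"
  assumes "bounded_bilinear prod" "open S" "Ck_on k f S" "Ck_on k h S"
  shows "Ck_on k (\<lambda>x. prod (f x) (h x)) S"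
  using assms(3,4)
proof (induction k arbitrary: f h)
  case 0
  then show ?case using bounded_bilinear.continuous_on[OF assms(1)] by auto
next
  case (Suc k)
  show ?case
  proof (rule Ck_on_SucI[OF assms(2) bounded_bilinear.FDERIV[OF assms(1)
        Ck_on_has_derivative[OF Suc.prems(1)] Ck_on_has_derivative[OF Suc.prems(2)]]])
    fix v
    show "Ck_on k (\<lambda>x. prod (f x) (frechet_derivative h (at x) v) +
                prod (frechet_derivative f (at x) v) (h x)) S"
      by (intro Ck_on_add[OF assms(2)] Suc.IH Ck_on_frechet Suc.prems Ck_on_SucD[OF Suc.prems(1)]
          Ck_on_SucD[OF Suc.prems(2)])
  qed auto
qed

lemmas Ck_on_scaleR = Ck_on_bilinear[OF bounded_bilinear_scaleR]
lemmas Ck_on_inner = Ck_on_bilinear[OF bounded_bilinear_inner]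
lemmas Ck_on_mult = Ck_on_bilinear[OF bounded_bilinear_mult[where 'a=real]]
lemmas Ck_on_fst = Ck_on_linear_compose[OF bounded_linear_fst]
lemmas Ck_on_snd = Ck_on_linear_compose[OF bounded_linear_snd]
lemmas Ck_on_ident = Ck_on_linear[OF bounded_linear_ident]

lemma Ck_on_Pair:
  assumes "open S" "Ck_on k f S" "Ck_on k h S"
  shows "Ck_on k (\<lambda>x. (f x, h x)) S"
proof -
  have "Ck_on k (\<lambda>x. (f x, 0) + (0, h x)) S"
    by (intro Ck_on_add[OF assms(1)] Ck_on_linear_compose[OF _ assms(1,2), of "\<lambda>y. (y, 0)"]
       Ck_on_linear_compose[OF _ assms(1,3), of "\<lambda>y. (0, y)"] bounded_linear_Pair
       bounded_linear_ident bounded_linear_zero)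
  then show ?thesis by simp
qed

lemma linear_Basis_expansion:
  fixes f :: "'a::euclidean_space \<Rightarrow> 'b::real_vector"
  assumes "linear f"
  shows "f v = (\<Sum>b\<in>Basis. (v \<bullet> b) *\<^sub>R f b)"
proof -
  have "f v = f (\<Sum>b\<in>Basis. (v \<bullet> b) *\<^sub>R b)" by (simp add: euclidean_representation)
  also have "\<dots> = (\<Sum>b\<in>Basis. (v \<bullet> b) *\<^sub>R f b)"
    by (simp add: linear_sum[OF assms] linear_scale[OF assms])
  finally show ?thesis .
qed

text \<open>The induction varies \<open>h\<close> but keeps \<open>u\<close>: expanding the outer
  derivative in the basis turns the chain rule into sums of products, in which
  \<open>frechet_derivative h (at (u x)) b\<close> is again a composition with
  \<open>u\<close>.\<close>

lemma Ck_on_compose: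
  fixes h :: "'b::euclidean_space \<Rightarrow> 'c::euclidean_space" and u :: "'a::euclidean_space \<Rightarrow> 'b"
  assumes "open S" "open T" "u ` S \<subseteq> T" "Ck_on k h T" "Ck_on k u S"
  shows "Ck_on k (\<lambda>x. h (u x)) S"
  using assms(4,5)
proof (induction k arbitrary: h)
  case 0
  then show ?case using assms(3) continuous_on_compose2 by (metis Ck_on.simps(1))
next
  case (Suc k)
  have T: "u x \<in> T" if "x \<in> S" for x using that assms(3) by auto
  show ?case
  proof (rule Ck_on_SucI[OF assms(1)])
    fix x assume x: "x \<in> S"
    show "((\<lambda>x. h (u x)) has_derivative
        (\<lambda>v. \<Sum>b\<in>Basis. (frechet_derivative u (at x) v \<bullet> b) *\<^sub>R frechet_derivative h (at (u x)) b)) (at x)"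
      using has_derivative_compose[OF Ck_on_has_derivative[OF Suc.prems(2) x]
          Ck_on_has_derivative[OF Suc.prems(1) T[OF x]]]
      by (subst (asm) linear_Basis_expansion[OF linear_frechet_derivative[OF Ck_on_differentiable[OF Suc.prems(1) T[OF x]]]])
  next
    fix v
    show "Ck_on k (\<lambda>x. \<Sum>b\<in>Basis. (frechet_derivative u (at x) v \<bullet> b) *\<^sub>R frechet_derivative h (at (u x)) b) S"
      by (intro Ck_on_sum Ck_on_scaleR Ck_on_inner Ck_on_const assms Ck_on_frechet[OF Suc.prems(2)]
          Suc.IH[OF Ck_on_frechet[OF Suc.prems(1)] Ck_on_SucD[OF Suc.prems(2)]])
  qed
qed

lemma Ck_on_frechet_apply:
  assumes "open S" "open T" "u ` S \<subseteq> T" "Ck_on (Suc k) h T" "Ck_on k u S" "Ck_on k w S"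
  shows "Ck_on k (\<lambda>x. frechet_derivative h (at (u x)) (w x)) S"
proof (rule Ck_on_cong_imp[OF assms(1)])
  show "Ck_on k (\<lambda>x. \<Sum>b\<in>Basis. (w x \<bullet> b) *\<^sub>R frechet_derivative h (at (u x)) b) S"
    by (intro Ck_on_sum Ck_on_scaleR Ck_on_inner Ck_on_const assms(1,6)
        Ck_on_compose[OF assms(1-3) Ck_on_frechet[OF assms(4)] assms(5)])
  show "(\<Sum>b\<in>Basis. (w x \<bullet> b) *\<^sub>R frechet_derivative h (at (u x)) b) =
      frechet_derivative h (at (u x)) (w x)" if "x \<in> S" for x
    using that assms(3) linear_Basis_expansion[OF linear_frechet_derivative[OF Ck_on_differentiable[OF assms(4)]], of "u x" "w x"]
    by auto
qed

lemma Ck_on_inverse: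
  fixes u :: "'a::euclidean_space \<Rightarrow> real"
  assumes "open S" "\<And>x. x \<in> S \<Longrightarrow> u x \<noteq> 0" "Ck_on k u S"
  shows "Ck_on k (\<lambda>x. inverse (u x)) S"
  using assms(3)
proof (induction k)
  case 0
  then show ?case using assms(2) by (auto intro: continuous_on_inverse)
next
  case (Suc k)
  show ?case
    by (rule Ck_on_SucI[OF assms(1) Deriv.has_derivative_inverse[OF _ Ck_on_has_derivative[OF Suc.prems]]])
      (intro assms Ck_on_minus Ck_on_mult Suc.IH Ck_on_SucD[OF Suc.prems] Ck_on_frechet[OF Suc.prems]
        | simp)+
qed

lemma Ck_on_divide:
  fixes u w :: "'a::euclidean_space \<Rightarrow> real"
  assumes "open S" "\<And>x. x \<in> S \<Longrightarrow> w x \<noteq> 0" "Ck_on k u S" "Ck_on k w S"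
  shows "Ck_on k (\<lambda>x. u x / w x) S"
  using Ck_on_mult[OF assms(1,3) Ck_on_inverse[OF assms(1,2,4)]] by (simp add: divide_inverse)

lemma Ck_on_frechet_continuous:
  assumes "Ck_on (Suc k) h S"
  shows "continuous_on S (\<lambda>x. frechet_derivative h (at x) v)"
  by (rule Ck_on_continuous[OF Ck_on_frechet[OF assms]])

text \<open>\<open>Ck_on\<close> gives continuity of the derivative in each fixed direction only. In
  finite dimension the basis directions control all \<open>v\<close> at once, which yields
  continuity in operator norm.\<close>

lemma frechet_derivative_near:
  fixes h :: "'a::euclidean_space \<Rightarrow> 'b::euclidean_space"
  assumes "open S" "Ck_on (Suc k) h S" "a \<in> S" "e > 0"
  obtains d where "d > 0" "ball a d \<subseteq> S"
    "\<And>x v. x \<in> ball a d \<Longrightarrow>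
      norm (frechet_derivative h (at x) v - frechet_derivative h (at a) v) \<le> e * norm v"
proof -
  define D where "D = (\<lambda>x. frechet_derivative h (at x))"
  have lin: "linear (D x)" if "x \<in> S" for x
    unfolding D_def using linear_frechet_derivative assms(2) that by auto
  have "((\<lambda>x. \<Sum>b\<in>Basis. norm (D x b - D a b)) \<longlongrightarrow> (\<Sum>b\<in>(Basis::'a set). norm (D a b - D a b))) (at a)"
  proof (intro tendsto_intros)
    fix b :: 'a
    have "isCont (\<lambda>x. D x b) a"
      unfolding D_def using Ck_on_frechet_continuous[OF assms(2)] assms(1,3)
      by (simp add: continuous_on_eq_continuous_at)
    then show "((\<lambda>x. D x b) \<longlongrightarrow> D a b) (at a)" by (simp add: isCont_def)
  qed
  then have "\<forall>\<^sub>F x in at a. (\<Sum>b\<in>Basis. norm (D x b - D a b)) < e"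
    using assms(4) by (auto intro: order_tendstoD)
  then obtain d1 where d1: "d1 > 0" "\<And>x. x \<noteq> a \<Longrightarrow> dist x a < d1 \<Longrightarrow> (\<Sum>b\<in>Basis. norm (D x b - D a b)) < e"
    unfolding eventually_at by auto
  obtain d2 where d2: "d2 > 0" "ball a d2 \<subseteq> S" using assms(1,3) open_contains_ball by blast
  have "norm (D x v - D a v) \<le> e * norm v" if "x \<in> ball a (min d1 d2)" for x v
  proof -
    have xS: "x \<in> S" using that d2 by auto
    have "(\<Sum>b\<in>Basis. norm (D x b - D a b)) \<le> e"
      using d1(2)[of x] that assms(4) by (cases "x = a") (auto simp: dist_commute)
    moreover have "D x v - D a v = (\<Sum>b\<in>Basis. (v \<bullet> b) *\<^sub>R (D x b - D a b))"
      by (subst linear_Basis_expansion[OF lin[OF xS]], subst linear_Basis_expansion[OF lin[OF assms(3)]])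
        (simp add: sum_subtractf scaleR_diff_right)
    moreover have "norm (\<Sum>b\<in>Basis. (v \<bullet> b) *\<^sub>R (D x b - D a b)) \<le> (\<Sum>b\<in>Basis. norm v * norm (D x b - D a b))"
      by (rule sum_norm_le) (simp add: Basis_le_norm mult_right_mono)
    moreover have "(\<Sum>b\<in>Basis. norm v * norm (D x b - D a b)) = norm v * (\<Sum>b\<in>Basis. norm (D x b - D a b))"
      by (simp add: sum_distrib_left)
    ultimately show ?thesis
      using mult_left_mono[of "\<Sum>b\<in>Basis. norm (D x b - D a b)" e "norm v"] by (simp add: mult.commute)
  qed
  then show ?thesis
    using d1(1) d2 subset_ball[of "min d1 d2" d2 a] unfolding D_def by (intro that[of "min d1 d2"]) auto
qed

section \<open>The \<open>C\<^sup>k\<close> inverse function theorem\<close>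

text \<open>At a zero of \<open>u\<close> the product rule needs \<open>w\<close> to be continuous
  only. This extracts a derivative where \<open>w\<close> is not yet known to have one: for the
  inverse of a varying linear map, and for powers of the positive part at 0.\<close>

lemma has_derivative_scaleR_vanishing:
  fixes u :: "'a::real_normed_vector \<Rightarrow> real" and w :: "'a \<Rightarrow> 'b::real_normed_vector"
  assumes u: "(u has_derivative u') (at a)" "u a = 0" and w: "isCont w a"
  shows "((\<lambda>x. u x *\<^sub>R w x) has_derivative (\<lambda>v. u' v *\<^sub>R w a)) (at a)"
proof -
  have bl: "bounded_linear u'" using u has_derivative_bounded_linear by blast
  then obtain K where K: "\<And>v. norm (u' v) \<le> norm v * K" using bounded_linear.bounded by blast
  have rem: "((\<lambda>x. norm (u x - u a - u' (x - a)) / norm (x - a)) \<longlongrightarrow> 0) (at a)"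
    using u(1) unfolding has_derivative_iff_norm by auto
  have "((\<lambda>x. u x *\<^sub>R (w x - w a)) has_derivative (\<lambda>v. 0)) (at a)"
    unfolding has_derivative_iff_norm
  proof (intro conjI bounded_linear_zero)
    have "((\<lambda>x. (norm (u x - u a - u' (x - a)) / norm (x - a) + K) * norm (w x - w a)) \<longlongrightarrow> (0 + K) * norm (w a - w a)) (at a)"
      using w by (intro tendsto_intros rem) (simp add: isCont_def)
    then have lim: "((\<lambda>x. (norm (u x - u a - u' (x - a)) / norm (x - a) + K) * norm (w x - w a)) \<longlongrightarrow> 0) (at a)" by simp
    show "((\<lambda>x. norm (u x *\<^sub>R (w x - w a) - u a *\<^sub>R (w a - w a) - 0) / norm (x - a)) \<longlongrightarrow> 0) (at a)"
    proof (rule Lim_null_comparison[OF _ lim])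
      show "\<forall>\<^sub>F x in at a. norm (norm (u x *\<^sub>R (w x - w a) - u a *\<^sub>R (w a - w a) - 0) / norm (x - a))
         \<le> (norm (u x - u a - u' (x - a)) / norm (x - a) + K) * norm (w x - w a)"
        unfolding eventually_at_filter
      proof (rule always_eventually, intro allI impI)
        fix x assume "x \<noteq> a"
        then have n: "norm (x - a) > 0" by simp
        have "\<bar>u x\<bar> \<le> \<bar>u x - u' (x - a)\<bar> + \<bar>u' (x - a)\<bar>" by linarith
        also have "\<dots> \<le> \<bar>u x - u' (x - a)\<bar> + norm (x - a) * K" using K[of "x - a"] by simp
        finally have "\<bar>u x\<bar> / norm (x - a) \<le> \<bar>u x - u' (x - a)\<bar> / norm (x - a) + K"
          using n by (simp add: field_simps)
        then have "\<bar>u x\<bar> / norm (x - a) * norm (w x - w a) \<le> (\<bar>u x - u' (x - a)\<bar> / norm (x - a) + K) * norm (w x - w a)"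
          by (rule mult_right_mono) simp
        then show "norm (norm (u x *\<^sub>R (w x - w a) - u a *\<^sub>R (w a - w a) - 0) / norm (x - a))
         \<le> (norm (u x - u a - u' (x - a)) / norm (x - a) + K) * norm (w x - w a)"
          using u(2) by simp
      qed
    qed
  qed
  moreover have "((\<lambda>x. u x *\<^sub>R w a) has_derivative (\<lambda>v. u' v *\<^sub>R w a)) (at a)"
    by (intro has_derivative_scaleR_left u)
  ultimately have "((\<lambda>x. u x *\<^sub>R w a + u x *\<^sub>R (w x - w a)) has_derivative (\<lambda>v. u' v *\<^sub>R w a + 0)) (at a)"
    by (rule has_derivative_add[rotated])
  then show ?thesis by (simp add: scaleR_diff_right)
qed

text \<open>With \<open>L y\<close> the derivative of \<open>F\<close> at \<open>g y\<close>, its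
  inverse \<open>g' y\<close> satisfies
  \<open>g' y v = g' y0 v - g' y ((L y - L y0) (g' y0 v))\<close>. The argument of the last
  \<open>g' y\<close> vanishes at \<open>y0\<close>, so continuity of \<open>g'\<close> already
  makes it differentiable, with a derivative built from \<open>g'\<close> and the second derivatives
  of \<open>F\<close>; induction on the order bootstraps this.\<close>

lemma Ck_inverse_regularity:
  fixes F :: "'a::euclidean_space \<Rightarrow> 'a"
  assumes "open S" "open V" "Ck_on (Suc k) F S" "continuous_on V g" "g ` V \<subseteq> S"
    and dg: "\<And>y. y \<in> V \<Longrightarrow> (g has_derivative g' y) (at y)"
    and inv1: "\<And>y v. y \<in> V \<Longrightarrow> frechet_derivative F (at (g y)) (g' y v) = v"
    and inv2: "\<And>y v. y \<in> V \<Longrightarrow> g' y (frechet_derivative F (at (g y)) v) = v"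
  shows "Ck_on (Suc k) g V"
proof -
  define L where "L = (\<lambda>y. frechet_derivative F (at (g y)))"
  have gS: "g y \<in> S" if "y \<in> V" for y using that assms(5) by auto
  have linL: "linear (L y)" if "y \<in> V" for y
    unfolding L_def using linear_frechet_derivative[OF Ck_on_differentiable[OF assms(3) gS[OF that]]] .
  have ling: "linear (g' y)" if "y \<in> V" for y using has_derivative_linear[OF dg[OF that]] .
  have Lg: "L y (g' y v) = v" and gL: "g' y (L y v) = v" if "y \<in> V" for y v
    using that inv1 inv2 unfolding L_def by auto
  have cont: "isCont (\<lambda>y. g' y v) y0" if y0: "y0 \<in> V" for v y0
  proof -
    have "inj (L y0)" using gL[OF y0] by (metis injI)
    then obtain c where c: "c > 0" "\<And>w. c * norm w \<le> norm (L y0 w)"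
      using linear_inj_bounded_below_pos[OF linL[OF y0]] by (auto simp: mult.commute)
    show ?thesis
      unfolding isCont_def
    proof (rule tendstoI)
      fix r :: real assume r: "r > 0"
      \<comment> \<open>The first bound keeps \<open>L y\<close> bounded below by
        \<open>c / 2\<close> near \<open>y0\<close>; the second turns
        \<open>c * norm (w - g' y0 v) \<le> e * norm w\<close> into a distance of at most
        \<open>r / 2\<close>.\<close>
      define e where "e = min (c / 2) (r * c * c / (4 * (norm v + 1)))"
      have e: "e > 0" "e \<le> c / 2" "e \<le> r * c * c / (4 * (norm v + 1))" 
      proof -
        have "r * c * c / (4 * (norm v + 1)) > 0"
          using c(1) r by (intro divide_pos_pos mult_pos_pos add_nonneg_pos) auto
        then show "e > 0" unfolding e_def using c(1) by simp
        show "e \<le> c / 2" "e \<le> r * c * c / (4 * (norm v + 1))"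
          unfolding e_def by (rule min.cobounded1, rule min.cobounded2)
      qed
      obtain d where d: "d > 0" "ball (g y0) d \<subseteq> S"
        "\<And>x v. x \<in> ball (g y0) d \<Longrightarrow> norm (frechet_derivative F (at x) v - frechet_derivative F (at (g y0)) v) \<le> e * norm v"
        using frechet_derivative_near[OF assms(1,3) gS[OF y0] e(1)] by metis
      have "isCont g y0" using has_derivative_continuous[OF dg[OF y0]] by simp
      then have "(g \<longlongrightarrow> g y0) (at y0)" by (simp add: isCont_def)
      then have "\<forall>\<^sub>F y in at y0. dist (g y) (g y0) < d" using d(1) tendstoD by blast
      moreover have "\<forall>\<^sub>F y in at y0. y \<in> V" using assms(2) y0 by (rule eventually_at_in_open')
      ultimately show "\<forall>\<^sub>F y in at y0. dist (g' y v) (g' y0 v) < r"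
      proof eventually_elim
        fix y assume y: "dist (g y) (g y0) < d" "y \<in> V"
        have near: "norm (L y w - L y0 w) \<le> e * norm w" for w
          using d(3)[of "g y" w] y(1) unfolding L_def by (simp add: dist_commute)
        define w where "w = g' y v"
        have Lw: "L y w = v" using Lg[OF y(2)] w_def by simp
        have "c * norm w \<le> norm (L y0 w)" by (rule c)
        also have "\<dots> \<le> norm (L y w) + norm (L y w - L y0 w)" using norm_triangle_ineq4[of "L y w" "L y w - L y0 w"] by simp
        also have "\<dots> \<le> norm v + c / 2 * norm w" using near[of w] Lw mult_right_mono[OF e(2), of "norm w"] by simp
        finally have w: "norm w \<le> 2 * norm v / c" using c(1) by (simp add: field_simps)
        have "L y0 (w - g' y0 v) = L y0 w - L y w" using Lg[OF y0] Lw linear_diff[OF linL[OF y0]] by simp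
        then have "c * norm (w - g' y0 v) \<le> e * norm w"
          using c(2)[of "w - g' y0 v"] near[of w] by (simp add: norm_minus_commute)
        also have "\<dots> \<le> r * c * c / (4 * (norm v + 1)) * (2 * norm v / c)"
          using e w by (intro mult_mono) auto
        also have "\<dots> = (norm v / (norm v + 1)) * (r * c / 2)"
        proof -
          have "norm v + 1 \<noteq> 0" using norm_ge_zero[of v] by linarith
          then show ?thesis using c(1) by (simp add: divide_simps)
        qed
        also have "\<dots> \<le> 1 * (r * c / 2)"
          using c(1) r by (intro mult_right_mono) (auto simp: divide_le_eq_1 add_nonneg_pos)
        finally have "norm (w - g' y0 v) \<le> r / 2" using c(1) by (simp add: field_simps)
        then show "dist (g' y v) (g' y0 v) < r" using r unfolding w_def by (simp add: dist_norm)
      qed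
    qed
  qed
  have "Ck_on j (\<lambda>y. g' y v) V" if "j \<le> k" for j v
    using that
  proof (induction j arbitrary: v)
    case 0
    then show ?case using cont by (auto intro: continuous_at_imp_continuous_on)
  next
    case (Suc j)
    then have IH: "\<And>v. Ck_on j (\<lambda>y. g' y v) V" by simp
    have FS: "Ck_on (Suc (Suc j)) F S" by (rule Ck_on_le[OF assms(3)]) (use Suc.prems in simp)
    have F1: "Ck_on (Suc j) (\<lambda>x. frechet_derivative F (at x) b) S" for b
      using Ck_on_frechet[OF FS] .
    \<comment> \<open>\<open>M y u\<close> is the derivative of \<open>L\<close> in direction
      \<open>u\<close>, applied to the vector \<open>g' y v\<close> held fixed.\<close>
    define M where "M = (\<lambda>y u. \<Sum>b\<in>Basis. (g' y v \<bullet> b) *\<^sub>R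
      frechet_derivative (\<lambda>x. frechet_derivative F (at x) b) (at (g y)) (g' y u))"
    show ?case
    proof (rule Ck_on_SucI[OF assms(2)])
      fix y0 assume y0: "y0 \<in> V"
      define \<phi> where "\<phi> = (\<lambda>y. \<Sum>b\<in>Basis. (g' y0 v \<bullet> b) *\<^sub>R frechet_derivative F (at (g y)) b)"
      have \<phi>L: "\<phi> y = L y (g' y0 v)" if "y \<in> V" for y
        unfolding \<phi>_def L_def
        using linear_Basis_expansion[OF linL[OF that], of "g' y0 v"] unfolding L_def by simp
      have d\<phi>: "(\<phi> has_derivative M y0) (at y0)"
        unfolding \<phi>_def M_def
        by (intro has_derivative_sum has_derivative_scaleR_right has_derivative_compose[OF dg[OF y0]]
            Ck_on_has_derivative[OF F1 gS[OF y0]])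
      have eq: "g' y0 v - (\<Sum>b\<in>Basis. ((\<phi> y - \<phi> y0) \<bullet> b) *\<^sub>R g' y b) = g' y v" if y: "y \<in> V" for y
      proof -
        have "(\<Sum>b\<in>Basis. ((\<phi> y - \<phi> y0) \<bullet> b) *\<^sub>R g' y b) = g' y (\<phi> y - \<phi> y0)"
          using linear_Basis_expansion[OF ling[OF y]] by metis
        also have "\<dots> = g' y0 v - g' y v"
          using \<phi>L[OF y] \<phi>L[OF y0] Lg[OF y0] gL[OF y] linear_diff[OF ling[OF y]] by simp
        finally show ?thesis by simp
      qed
      have "((\<lambda>y. g' y0 v - (\<Sum>b\<in>Basis. ((\<phi> y - \<phi> y0) \<bullet> b) *\<^sub>R g' y b)) has_derivative
         (\<lambda>u. 0 - (\<Sum>b\<in>Basis. (M y0 u \<bullet> b) *\<^sub>R g' y0 b))) (at y0)"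
      proof (intro has_derivative_diff has_derivative_const has_derivative_sum has_derivative_scaleR_vanishing cont[OF y0])
        fix b :: 'a
        have "((\<lambda>x. (\<phi> x - \<phi> y0) \<bullet> b) has_derivative (\<lambda>u. (M y0 u - 0) \<bullet> b)) (at y0)"
          by (intro has_derivative_inner_left has_derivative_diff d\<phi> has_derivative_const)
        then show "((\<lambda>x. (\<phi> x - \<phi> y0) \<bullet> b) has_derivative (\<lambda>u. M y0 u \<bullet> b)) (at y0)" by simp
      qed simp
      from has_derivative_transform_within_open[OF this assms(2) y0 eq]
      show "((\<lambda>y. g' y v) has_derivative (\<lambda>u. 0 - (\<Sum>b\<in>Basis. (M y0 u \<bullet> b) *\<^sub>R g' y0 b))) (at y0)" .
    next
      fix u
      have g: "Ck_on j g V"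
        using Ck_on_SucD[OF Ck_on_SucI[OF assms(2) dg IH]] .
      show "Ck_on j (\<lambda>x. 0 - (\<Sum>b\<in>Basis. (M x u \<bullet> b) *\<^sub>R g' x b)) V"
        unfolding M_def
        by (intro Ck_on_diff Ck_on_const Ck_on_sum Ck_on_scaleR Ck_on_inner assms(2) IH
            Ck_on_frechet_apply[OF assms(2,1,5) F1 g])
    qed
  qed
  then show ?thesis using Ck_on_SucI[OF assms(2) dg] by blast
qed

theorem Ck_inverse_function:
  fixes F :: "'a::euclidean_space \<Rightarrow> 'a"
  assumes S: "open S" "a \<in> S" and F: "Ck_on (Suc k) F S"
    and inj: "\<And>v. frechet_derivative F (at a) v = 0 \<Longrightarrow> v = 0"
  obtains A B \<psi> where "a \<in> A" "A \<subseteq> S" "Ck_diffeo (Suc k) A B F \<psi>"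
proof -
  define f' where "f' = (\<lambda>x. Blinfun (frechet_derivative F (at x)))"
  have bl: "bounded_linear (frechet_derivative F (at x))" if "x \<in> S" for x
    using has_derivative_bounded_linear[OF Ck_on_has_derivative[OF F that]] .
  have f': "blinfun_apply (f' x) = frechet_derivative F (at x)" if "x \<in> S" for x
    unfolding f'_def by (rule bounded_linear_Blinfun_apply[OF bl[OF that]])
  have derf: "(F has_derivative (blinfun_apply (f' x))) (at x)" if "x \<in> S" for x
    using Ck_on_has_derivative[OF F that] f'[OF that] by simp
  have cf: "continuous_on S f'"
  proof (rule continuous_on_blinfun_componentwise)
    fix i :: 'a
    show "continuous_on S (\<lambda>x. blinfun_apply (f' x) i)"
      using Ck_on_frechet_continuous[OF F, of i] by (rule continuous_on_eq) (simp add: f')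
  qed
  have lin: "linear (frechet_derivative F (at a))" using bl[OF S(2)] bounded_linear.linear by blast
  then have "inj (frechet_derivative F (at a))"
    using inj by (simp add: linear_injective_0)
  then obtain G where G: "linear G" "G \<circ> frechet_derivative F (at a) = id"
    using linear_injective_left_inverse[OF lin] by blast
  have invB: "Blinfun G o\<^sub>L f' a = id_blinfun"
    using G(2) f'[OF S(2)] bounded_linear_Blinfun_apply[OF linear_conv_bounded_linear[THEN iffD1, OF G(1)]]
    by (intro blinfun_eqI) (simp add: fun_eq_iff)
  obtain A B g g' where *: "open A" "A \<subseteq> S" "a \<in> A" "open B" "F a \<in> B" "homeomorphism A B F g"
    "\<And>y. y \<in> B \<Longrightarrow> (g has_derivative (g' y)) (at y)"
    "\<And>y. y \<in> B \<Longrightarrow> g' y = inv (blinfun_apply (f'(g y)))"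
    "\<And>y. y \<in> B \<Longrightarrow> bij (blinfun_apply (f'(g y)))"
    by (rule inverse_function_theorem[where f = F, OF S(1) _ cf S(2) invB]) (rule derf, assumption, (rule that; assumption))
  have gA: "g y \<in> S" if "y \<in> B" for y using *(2) that homeomorphism_image2[OF *(6)] by auto
  have "Ck_on (Suc k) g B"
  proof (rule Ck_inverse_regularity[OF S(1) *(4) F])
    show "continuous_on B g" using *(6) homeomorphism_def by blast
    show "g ` B \<subseteq> S" using gA by blast
    fix y v assume y: "y \<in> B"
    show "(g has_derivative (g' y)) (at y)" by (rule *(7)[OF y])
    show "frechet_derivative F (at (g y)) (g' y v) = v"
      using *(8,9)[OF y] f'[OF gA[OF y]] by (metis bij_is_surj surj_f_inv_f)
    show "g' y (frechet_derivative F (at (g y)) v) = v"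
      using *(8,9)[OF y] f'[OF gA[OF y]] by (metis bij_is_inj inv_f_f)
  qed
  then have "Ck_diffeo (Suc k) A B F g"
    using *(1,4,6) Ck_on_subset[OF F *(2)] unfolding Ck_diffeo_def by simp
  with *(2,3) that show ?thesis by blast
qed

lemma Ck_diffeo_derivatives:
  fixes \<phi> :: "'a::euclidean_space \<Rightarrow> 'b::euclidean_space"
  assumes "Ck_diffeo (Suc k) A B \<phi> \<psi>" "x \<in> A"
  shows "frechet_derivative \<psi> (at (\<phi> x)) (frechet_derivative \<phi> (at x) v) = v"
    and "frechet_derivative \<phi> (at x) (frechet_derivative \<psi> (at (\<phi> x)) w) = w"
proof -
  have A: "open A" "open B" "homeomorphism A B \<phi> \<psi>" "Ck_on (Suc k) \<phi> A" "Ck_on (Suc k) \<psi> B"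
    using assms(1) unfolding Ck_diffeo_def by auto
  have y: "\<phi> x \<in> B" "\<psi> (\<phi> x) = x" using homeomorphism_image1[OF A(3)] homeomorphism_apply1[OF A(3)] assms(2) by auto
  have d1: "(\<phi> has_derivative frechet_derivative \<phi> (at x)) (at x)" using Ck_on_has_derivative[OF A(4) assms(2)] .
  have d2: "(\<psi> has_derivative frechet_derivative \<psi> (at (\<phi> x))) (at (\<phi> x))" using Ck_on_has_derivative[OF A(5) y(1)] .
  have "((\<lambda>x. \<psi> (\<phi> x)) has_derivative (\<lambda>v. frechet_derivative \<psi> (at (\<phi> x)) (frechet_derivative \<phi> (at x) v))) (at x)"
    by (rule has_derivative_compose[OF d1 d2])
  moreover have "((\<lambda>x. \<psi> (\<phi> x)) has_derivative (\<lambda>v. v)) (at x)"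
    by (rule has_derivative_transform_within_open[OF has_derivative_ident A(1) assms(2)])
      (simp add: homeomorphism_apply1[OF A(3)])
  ultimately show "frechet_derivative \<psi> (at (\<phi> x)) (frechet_derivative \<phi> (at x) v) = v"
    using has_derivative_unique by metis
  have "((\<lambda>z. \<phi> (\<psi> z)) has_derivative (\<lambda>v. frechet_derivative \<phi> (at x) (frechet_derivative \<psi> (at (\<phi> x)) v))) (at (\<phi> x))"
    using has_derivative_compose[OF d2] d1 y(2) by metis
  moreover have "((\<lambda>z. \<phi> (\<psi> z)) has_derivative (\<lambda>v. v)) (at (\<phi> x))"
    by (rule has_derivative_transform_within_open[OF has_derivative_ident A(2) y(1)])
      (simp add: homeomorphism_apply2[OF A(3)])
  ultimately show "frechet_derivative \<phi> (at x) (frechet_derivative \<psi> (at (\<phi> x)) w) = w"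
    using has_derivative_unique by metis
qed

text \<open>Inverts \<open>(x, z) \<mapsto> (x, F (x, z))\<close>; the solution is the second
  component of the inverse on the slice where the value of \<open>F\<close> is 0.\<close>

theorem Ck_implicit_function:
  fixes F :: "'a::euclidean_space \<times> 'b::euclidean_space \<Rightarrow> 'b"
  assumes S: "open S" "(a, b) \<in> S" and F: "Ck_on (Suc k) F S" "F (a, b) = 0"
    and inj: "\<And>v. frechet_derivative F (at (a, b)) (0, v) = 0 \<Longrightarrow> v = 0"
  obtains A s where "open A" "a \<in> A" "Ck_on (Suc k) s A" "s a = b"
    "\<And>x. x \<in> A \<Longrightarrow> (x, s x) \<in> S \<and> F (x, s x) = 0"
proof -
  define G where "G = (\<lambda>z. (fst z, F z))"
  have GS: "Ck_on (Suc k) G S"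
    unfolding G_def by (intro Ck_on_Pair Ck_on_linear[OF bounded_linear_fst] S F)
  have dG: "frechet_derivative G (at (a, b)) v = (fst v, frechet_derivative F (at (a, b)) v)" for v
    unfolding G_def
    by (subst frechet_derivative_eqI[OF has_derivative_Pair[OF
          bounded_linear_imp_has_derivative[OF bounded_linear_fst] Ck_on_has_derivative[OF F(1) S(2)]]]) simp
  have "v = 0" if "frechet_derivative G (at (a, b)) v = 0" for v
    using that inj[of "snd v"] unfolding dG by (cases v) (auto simp: zero_prod_def)
  then obtain A B \<psi> where AB: "(a, b) \<in> A" "A \<subseteq> S" "Ck_diffeo (Suc k) A B G \<psi>"
    using Ck_inverse_function[OF S GS] by blast
  have d: "open B" "homeomorphism A B G \<psi>" "Ck_on (Suc k) \<psi> B" using AB(3) unfolding Ck_diffeo_def by auto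
  define A' where "A' = (\<lambda>x. (x, 0::'b)) -` B"
  define s where "s = (\<lambda>x. snd (\<psi> (x, 0)))"
  have Gab: "G (a, b) = (a, 0)" unfolding G_def using F(2) by simp
  show ?thesis
  proof
    show oA: "open A'" unfolding A'_def by (intro open_vimage d continuous_intros)
    have "G (a, b) \<in> B" using AB(1) homeomorphism_image1[OF d(2)] by auto
    then show "a \<in> A'" unfolding A'_def Gab by simp
    show "Ck_on (Suc k) s A'" unfolding s_def
      by (intro Ck_on_snd oA Ck_on_compose[OF oA d(1) _ d(3)] Ck_on_Pair[OF oA] Ck_on_ident Ck_on_const) (simp add: A'_def image_subset_iff)
    have "\<psi> (G (a, b)) = (a, b)" by (rule homeomorphism_apply1[OF d(2) AB(1)])
    then show "s a = b" unfolding s_def Gab by simp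
    fix x assume "x \<in> A'"
    then have x: "(x, 0) \<in> B" unfolding A'_def by simp
    then have e: "G (\<psi> (x, 0)) = (x, 0)" "\<psi> (x, 0) \<in> A"
      using homeomorphism_apply2[OF d(2)] homeomorphism_image2[OF d(2)] by auto
    have "fst (\<psi> (x, 0)) = x" "F (\<psi> (x, 0)) = 0" using e(1) unfolding G_def by (simp_all only: prod.inject)
    moreover from this have "\<psi> (x, 0) = (x, s x)" unfolding s_def by (simp add: prod_eq_iff)
    ultimately show "(x, s x) \<in> S \<and> F (x, s x) = 0" using e(2) AB(2) by (metis subsetD)
  qed
qed

section \<open>Uniform limits of \<open>C\<^sup>k\<close> maps\<close>

text \<open>In \<open>geom_bounded \<sigma> e j u\<close>, \<open>N\<close> counts the Picard iterations, in which the bound has to be uniform, and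
  \<open>n\<close> the steps into the past along a backward orbit.\<close>

primrec geom_bounded :: "real \<Rightarrow> nat \<Rightarrow> nat \<Rightarrow> (nat \<Rightarrow> nat \<Rightarrow> 'a::euclidean_space \<Rightarrow> 'b::euclidean_space) \<Rightarrow> bool" where
  "geom_bounded \<sigma> e 0 u \<longleftrightarrow> (\<exists>C. \<forall>N n c. norm (u N n c) \<le> C * \<sigma> ^ (e * n))"
| "geom_bounded \<sigma> e (Suc j) u \<longleftrightarrow> (\<exists>C. \<forall>N n c. norm (u N n c) \<le> C * \<sigma> ^ (e * n)) \<and>
     (\<forall>N n c. u N n differentiable (at c)) \<and> (\<forall>v. geom_bounded \<sigma> e j (\<lambda>N n c. frechet_derivative (u N n) (at c) v))"

section \<open>Calculus of geometrically bounded families\<close>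

lemma geom_bounded_bound: "geom_bounded \<sigma> e j u \<Longrightarrow> \<exists>C. \<forall>N n c. norm (u N n c) \<le> C * \<sigma> ^ (e * n)"
  by (cases j) auto

lemma geom_bounded_bound_pos:
  assumes "geom_bounded \<sigma> e j u" "\<sigma> > 0"
  obtains C where "C \<ge> 0" "\<And>N n c. norm (u N n c) \<le> C * \<sigma> ^ (e * n)"
proof -
  obtain C where C: "norm (u N n c) \<le> C * \<sigma> ^ (e * n)" for N n c using geom_bounded_bound[OF assms(1)] by blast
  have "norm (u N n c) \<le> \<bar>C\<bar> * \<sigma> ^ (e * n)" for N n c
    by (rule order_trans[OF C mult_right_mono[OF abs_ge_self]]) (use assms(2) in simp)
  then show ?thesis using that[of "\<bar>C\<bar>"] by simp
qed

lemma geom_bounded_order_Suc: "geom_bounded \<sigma> e (Suc j) u \<Longrightarrow> geom_bounded \<sigma> e j u"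
  by (induction j arbitrary: u) auto

lemma geom_bounded_order_mono: "geom_bounded \<sigma> e k u \<Longrightarrow> j \<le> k \<Longrightarrow> geom_bounded \<sigma> e j u"
  by (induction k) (auto simp: le_Suc_eq intro: geom_bounded_order_Suc simp del: geom_bounded.simps)

lemma geom_bounded_SucI:
  assumes "\<exists>C. \<forall>N n c. norm (u N n c) \<le> C * \<sigma> ^ (e * n)"
    and "\<And>N n c. (u N n has_derivative u' N n c) (at c)"
    and "\<And>v. geom_bounded \<sigma> e j (\<lambda>N n c. u' N n c v)"
  shows "geom_bounded \<sigma> e (Suc j) u"
  using assms by (auto simp: differentiable_def frechet_derivative_eqI[OF assms(2)])

lemma geom_bounded_has_derivative:
  "geom_bounded \<sigma> e (Suc j) u \<Longrightarrow> (u N n has_derivative frechet_derivative (u N n) (at c)) (at c)"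
  by (simp add: differentiable_has_derivative)

lemma geom_bounded_frechet: "geom_bounded \<sigma> e (Suc j) u \<Longrightarrow> geom_bounded \<sigma> e j (\<lambda>N n c. frechet_derivative (u N n) (at c) v)"
  by simp

lemma geom_bounded_rate_mono:
  assumes "1 \<le> \<sigma>" "e \<le> e'" "geom_bounded \<sigma> e j u"
  shows "geom_bounded \<sigma> e' j u"
  using assms(3)
proof (induction j arbitrary: u)
  have *: "\<exists>C. \<forall>N n c. norm (u N n c) \<le> C * \<sigma> ^ (e' * n)" if gb: "geom_bounded \<sigma> e j u" for j u
  proof -
    have "\<sigma> > 0" using assms(1) by simp
    from geom_bounded_bound_pos[OF gb this] obtain C where C: "C \<ge> 0" "\<And>N n c. norm (u N n c) \<le> C * \<sigma> ^ (e * n)" by metis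
    have "norm (u N n c) \<le> C * \<sigma> ^ (e' * n)" for N n c
      using C(2)[of N n c] mult_left_mono[OF power_increasing[of "e * n" "e' * n" \<sigma>] C(1)] assms(1,2)
      by fastforce
    then show ?thesis by blast
  qed
  {
    case 0
    then show ?case using *[of 0 u] by simp
  next
    case (Suc j)
    then show ?case using *[of "Suc j" u] by simp
  }
qed

lemma geom_bounded_const_family:
  fixes f :: "nat \<Rightarrow> nat \<Rightarrow> 'b::euclidean_space"
  assumes "\<exists>C. \<forall>N n. norm (f N n) \<le> C * \<sigma> ^ (e * n)"
  shows "geom_bounded \<sigma> e j (\<lambda>N n (c::'a::euclidean_space). f N n)"
  using assms
proof (induction j arbitrary: f)
  case (Suc j)
  have "geom_bounded \<sigma> e j (\<lambda>N n (c::'a). 0::'b)" by (rule Suc.IH) (auto intro: exI[of _ 0])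
  with Suc.prems show ?case by simp
qed simp

lemma geom_bounded_zero: "geom_bounded \<sigma> e j (\<lambda>N n c. 0)"
  by (rule geom_bounded_const_family) (auto intro: exI[of _ 0])

lemma geom_bounded_linear:
  assumes f: "bounded_linear f" and u: "geom_bounded \<sigma> e j u" and "\<sigma> > 0"
  shows "geom_bounded \<sigma> e j (\<lambda>N n c. f (u N n c))"
  using u
proof (induction j arbitrary: u)
  obtain K where K: "K > 0" "\<And>v. norm (f v) \<le> norm v * K" using bounded_linear.pos_bounded[OF f] by blast
  have *: "\<exists>C. \<forall>N n c. norm (f (u N n c)) \<le> C * \<sigma> ^ (e * n)" if gb: "geom_bounded \<sigma> e j u" for j u
  proof -
    obtain C where C: "norm (u N n c) \<le> C * \<sigma> ^ (e * n)" for N n c using geom_bounded_bound[OF gb] by blast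
    have "norm (f (u N n c)) \<le> (C * K) * \<sigma> ^ (e * n)" for N n c
      by (rule order_trans[OF K(2)]) (use mult_right_mono[OF C, of K N n c] K(1) in \<open>simp add: mult_ac\<close>)
    then show ?thesis by blast
  qed
  {
    case 0
    then show ?case using *[of 0 u] by simp
  next
    case (Suc j)
    show ?case
      by (rule geom_bounded_SucI[OF *[OF Suc.prems] bounded_linear.has_derivative[OF f geom_bounded_has_derivative[OF Suc.prems]]])
        (rule Suc.IH[OF geom_bounded_frechet[OF Suc.prems]])
  }
qed

lemma geom_bounded_add:
  assumes "geom_bounded \<sigma> e j u" "geom_bounded \<sigma> e j w"
  shows "geom_bounded \<sigma> e j (\<lambda>N n c. u N n c + w N n c)"
  using assms
proof (induction j arbitrary: u w)
  have *: "\<exists>C. \<forall>N n c. norm (u N n c + w N n c) \<le> C * \<sigma> ^ (e * n)" if gb: "geom_bounded \<sigma> e j u" "geom_bounded \<sigma> e j w" for j u w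
  proof -
    obtain C where C: "norm (u N n c) \<le> C * \<sigma> ^ (e * n)" for N n c using geom_bounded_bound[OF gb(1)] by blast
    obtain C' where C': "norm (w N n c) \<le> C' * \<sigma> ^ (e * n)" for N n c using geom_bounded_bound[OF gb(2)] by blast
    have "norm (u N n c + w N n c) \<le> (C + C') * \<sigma> ^ (e * n)" for N n c
      using norm_triangle_le[OF add_mono[OF C C']] by (simp add: distrib_right)
    then show ?thesis by blast
  qed
  {
    case 0
    then show ?case using *[of 0 u w] by simp
  next
    case (Suc j)
    show ?case
      by (rule geom_bounded_SucI[OF *[OF Suc.prems] has_derivative_add[OF geom_bounded_has_derivative[OF Suc.prems(1)] geom_bounded_has_derivative[OF Suc.prems(2)]]])
        (rule Suc.IH[OF geom_bounded_frechet[OF Suc.prems(1)] geom_bounded_frechet[OF Suc.prems(2)]])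
  }
qed

lemma geom_bounded_sum:
  assumes "\<And>i. i \<in> I \<Longrightarrow> geom_bounded \<sigma> e j (u i)"
  shows "geom_bounded \<sigma> e j (\<lambda>N n c. \<Sum>i\<in>I. u i N n c)"
  using assms
  by (induction I rule: infinite_finite_induct) (auto intro: geom_bounded_zero geom_bounded_add)

lemma geom_bounded_bilinear:
  fixes prod :: "'b::euclidean_space \<Rightarrow> 'c::euclidean_space \<Rightarrow> 'd::euclidean_space"
    and u :: "nat \<Rightarrow> nat \<Rightarrow> 'a::euclidean_space \<Rightarrow> 'b"
  assumes "bounded_bilinear prod" "\<sigma> > 0" "geom_bounded \<sigma> e j u" "geom_bounded \<sigma> e' j w"
  shows "geom_bounded \<sigma> (e + e') j (\<lambda>N n c. prod (u N n c) (w N n c))"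
  using assms(3,4)
proof (induction j arbitrary: u w)
  obtain K where K: "K > 0" "\<And>v w. norm (prod v w) \<le> norm v * norm w * K"
    using bounded_bilinear.pos_bounded[OF assms(1)] by blast
  have *: "\<exists>C. \<forall>N n c. norm (prod (u N n c) (w N n c)) \<le> C * \<sigma> ^ ((e + e') * n)"
    if gb: "geom_bounded \<sigma> e j u" "geom_bounded \<sigma> e' j w" for j u w
  proof -
    obtain C where C: "C \<ge> 0" "\<And>N n c. norm (u N n c) \<le> C * \<sigma> ^ (e * n)"
      using geom_bounded_bound_pos[OF gb(1) assms(2)] by metis
    obtain C' where C': "C' \<ge> 0" "\<And>N n c. norm (w N n c) \<le> C' * \<sigma> ^ (e' * n)"
      using geom_bounded_bound_pos[OF gb(2) assms(2)] by metis
    have "norm (prod (u N n c) (w N n c)) \<le> (C * C' * K) * \<sigma> ^ ((e + e') * n)" for N n c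
    proof -
      have "norm (u N n c) * norm (w N n c) \<le> (C * \<sigma> ^ (e * n)) * (C' * \<sigma> ^ (e' * n))"
        using C C' assms(2) by (intro mult_mono) auto
      from mult_right_mono[OF this, of K] show ?thesis
        by (intro order_trans[OF K(2)]) (use K(1) in \<open>simp add: power_add algebra_simps\<close>)
    qed
    then show ?thesis by blast
  qed
  {
    case 0
    then show ?case using *[of 0 u w] by simp
  next
    case (Suc j)
    show ?case
      by (rule geom_bounded_SucI[OF *[OF Suc.prems] bounded_bilinear.FDERIV[OF assms(1) geom_bounded_has_derivative[OF Suc.prems(1)] geom_bounded_has_derivative[OF Suc.prems(2)]]])
        (intro geom_bounded_add Suc.IH geom_bounded_frechet Suc.prems geom_bounded_order_Suc[OF Suc.prems(1)] geom_bounded_order_Suc[OF Suc.prems(2)])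
  }
qed

lemma geom_bounded_shift:
  assumes "geom_bounded \<sigma> e j u"
  shows "geom_bounded \<sigma> e j (\<lambda>N n. u N (Suc n))"
  using assms
proof (induction j arbitrary: u)
  have *: "\<exists>C. \<forall>N n c. norm (u N (Suc n) c) \<le> C * \<sigma> ^ (e * n)" if gb: "geom_bounded \<sigma> e j u" for j u
  proof -
    obtain C where C: "norm (u N n c) \<le> C * \<sigma> ^ (e * n)" for N n c using geom_bounded_bound[OF gb] by blast
    have "norm (u N (Suc n) c) \<le> (C * \<sigma> ^ e) * \<sigma> ^ (e * n)" for N n c
      using C[of N "Suc n" c] by (simp add: power_add)
    then show ?thesis by blast
  qed
  {
    case 0
    then show ?case using *[of 0 u] by simp
  next
    case (Suc j)
    then show ?case using *[OF Suc.prems] Suc.IH[OF geom_bounded_frechet[OF Suc.prems]] by simp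
  }
qed

lemma geom_bounded_guard:
  assumes "geom_bounded \<sigma> e j u" "\<sigma> > 0"
  shows "geom_bounded \<sigma> e j (\<lambda>N n c. if n = 0 then 0 else u N n c)"
  using assms(1)
proof (induction j arbitrary: u)
  have *: "\<exists>C. \<forall>N n c. norm (if n = 0 then 0 else u N n c) \<le> C * \<sigma> ^ (e * n)" if gb: "geom_bounded \<sigma> e j u" for j u
  proof -
    obtain C where "C \<ge> 0" "\<And>N n c. norm (u N n c) \<le> C * \<sigma> ^ (e * n)" using geom_bounded_bound_pos[OF gb assms(2)] by metis
    then show ?thesis using assms(2) by (intro exI[of _ C]) auto
  qed
  {
    case 0
    then show ?case using *[of 0 u] by simp
  next
    case (Suc j)
    show ?case
    proof (rule geom_bounded_SucI[OF *[OF Suc.prems]])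
      show "((\<lambda>c. if n = 0 then 0 else u N n c) has_derivative
        (\<lambda>v. if n = 0 then 0 else frechet_derivative (u N n) (at c) v)) (at c)" for N n c
        using geom_bounded_has_derivative[OF Suc.prems] by (cases n) auto
      show "geom_bounded \<sigma> e j (\<lambda>N n c. if n = 0 then 0 else frechet_derivative (u N n) (at c) v)" for v
        by (rule Suc.IH[OF geom_bounded_frechet[OF Suc.prems]])
    qed
  }
qed

text \<open>Each differentiation of \<open>h (z N n c)\<close> produces at most one new factor that
  is a derivative of \<open>z\<close>, hence the rate \<open>j * e\<close>. The values of
  \<open>z\<close> may grow freely, because \<open>h\<close> and its derivatives are bounded; and
  the first derivative of \<open>z\<close> enters with orders below \<open>j\<close> only, which
  prevents circularity when \<open>z\<close> is itself being estimated.\<close>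

lemma geom_bounded_compose:
  fixes z :: "nat \<Rightarrow> nat \<Rightarrow> 'a::euclidean_space \<Rightarrow> 'b::euclidean_space" and h :: "'b \<Rightarrow> 'c::euclidean_space"
  assumes "\<sigma> \<ge> 1" "geom_bounded \<sigma> 0 j (\<lambda>N n. h)" "\<And>N n c. z N n differentiable (at c)"
    and "\<And>i v. i < j \<Longrightarrow> geom_bounded \<sigma> e i (\<lambda>N n c. frechet_derivative (z N n) (at c) v)"
  shows "geom_bounded \<sigma> (j * e) j (\<lambda>N n c. h (z N n c))"
  using assms(2,4)
proof (induction j arbitrary: h)
  case 0
  then show ?case by auto
next
  case (Suc j)
  have dh: "(h has_derivative frechet_derivative h (at c)) (at c)" for c
    using geom_bounded_has_derivative[OF Suc.prems(1)] .
  have pos: "\<sigma> > 0" using assms(1) by simp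
  obtain C where C: "C \<ge> 0" "\<And>c. norm (h c) \<le> C" using geom_bounded_bound_pos[OF Suc.prems(1) pos] by auto
  show ?case
  proof (rule geom_bounded_SucI)
    show "((\<lambda>c. h (z N n c)) has_derivative
        (\<lambda>v. \<Sum>b\<in>Basis. (frechet_derivative (z N n) (at c) v \<bullet> b) *\<^sub>R frechet_derivative h (at (z N n c)) b)) (at c)" for N n c
      using has_derivative_compose[OF differentiable_has_derivative[OF assms(3)] dh]
      by (subst (asm) linear_Basis_expansion[OF has_derivative_linear[OF dh]])
    show "geom_bounded \<sigma> (Suc j * e) j (\<lambda>N n c. \<Sum>b\<in>Basis. (frechet_derivative (z N n) (at c) v \<bullet> b) *\<^sub>R frechet_derivative h (at (z N n c)) b)" for v
      unfolding mult_Suc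
      by (intro geom_bounded_sum geom_bounded_bilinear[OF bounded_bilinear_scaleR pos] geom_bounded_linear[OF bounded_linear_inner_left _ pos]
          Suc.prems(2) Suc.IH geom_bounded_frechet[OF Suc.prems(1)]) (use Suc.prems(2) in auto)
    have "norm (h (z N n c)) \<le> C * \<sigma> ^ (Suc j * e * n)" for N n c
      using C(2)[of "z N n c"] mult_left_mono[OF one_le_power[OF assms(1), of "Suc j * e * n"] C(1)] by simp
    then show "\<exists>C. \<forall>N n c. norm (h (z N n c)) \<le> C * \<sigma> ^ (Suc j * e * n)" by blast
  qed
qed

text \<open>Only the end point \<open>n = 0\<close> of an orbit enters the centre manifold, and
  there every weight equals 1, however bad the rate.\<close>

lemma geom_bounded_slice: "geom_bounded \<sigma> e j u \<Longrightarrow> geom_bounded 1 0 j (\<lambda>N n. u N 0)"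
proof (induction j arbitrary: u)
  case 0
  then obtain C where C: "\<forall>N n c. norm (u N n c) \<le> C * \<sigma> ^ (e * n)" by auto
  have "norm (u N 0 c) \<le> C" for N c using C[rule_format, of N 0 c] by simp
  then show ?case by auto
next
  case (Suc j)
  have "geom_bounded 1 0 j (\<lambda>N n c. frechet_derivative (u N 0) (at c) v)" for v
    by (rule Suc.IH[OF geom_bounded_frechet[OF Suc.prems]])
  moreover have "\<exists>C. \<forall>N c. norm (u N 0 c) \<le> C"
  proof -
    obtain C where C: "\<forall>N n c. norm (u N n c) \<le> C * \<sigma> ^ (e * n)" using geom_bounded_bound[OF Suc.prems] by blast
    have "norm (u N 0 c) \<le> C" for N c using C[rule_format, of N 0 c] by simp
    then show ?thesis by blast
  qed
  ultimately show ?case using Suc.prems by simp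
qed

section \<open>Convergence of derivatives from convergence of values\<close>

text \<open>Over a step of length \<open>t\<close> along \<open>v\<close> the increment of
  \<open>d\<close> is \<open>t\<close> times the derivative, up to an error of
  \<open>K * t * t\<close>. Small values of \<open>d\<close> and a bounded second derivative thus
  make the first derivative small, once \<open>t\<close> balances the two terms.\<close>

lemma landau_inequality:
  fixes d :: "'a::euclidean_space \<Rightarrow> 'b::euclidean_space"
  assumes d: "\<And>x. d differentiable (at x)" "\<And>x. (\<lambda>x. frechet_derivative d (at x) v) differentiable (at x)"
    and K: "\<And>x. norm (frechet_derivative (\<lambda>x. frechet_derivative d (at x) v) (at x) v) \<le> K"
    and \<delta>: "\<And>x. norm (d x) \<le> \<delta>" and t: "t > 0"
  shows "norm (frechet_derivative d (at c) v) \<le> 2 * \<delta> / t + K * t"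
proof -
  define d1 where "d1 = (\<lambda>x. frechet_derivative d (at x) v)"
  have line: "((\<lambda>s. c + s *\<^sub>R v) has_derivative (\<lambda>s. s *\<^sub>R v)) (at s within S)" for s :: real and S
    by (auto intro!: derivative_eq_intros)
  have lin: "linear (frechet_derivative d (at x))" for x using linear_frechet_derivative[OF d(1)] .
  have lin1: "linear (frechet_derivative d1 (at x))" for x unfolding d1_def using linear_frechet_derivative[OF d(2)] .
  have der: "((\<lambda>s. d (c + s *\<^sub>R v)) has_derivative (\<lambda>s'. s' *\<^sub>R d1 (c + s *\<^sub>R v))) (at s within S)" for s S
    using has_derivative_compose[OF line differentiable_has_derivative[OF d(1)]]
    unfolding d1_def by (simp add: linear_scale[OF lin])
  have der1: "((\<lambda>s. d1 (c + s *\<^sub>R v)) has_derivative (\<lambda>s'. s' *\<^sub>R frechet_derivative d1 (at (c + s *\<^sub>R v)) v)) (at s within S)" for s S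
    using has_derivative_compose[OF line differentiable_has_derivative[OF d(2)]] lin1
    unfolding d1_def by (simp add: linear_scale)
  have K0: "K \<ge> 0" using K[of c] norm_ge_zero order_trans by blast
  have b1: "norm (d1 (c + s *\<^sub>R v) - d1 c) \<le> K * t" if "s \<in> {0..t}" for s
  proof -
    have "norm (d1 (c + s *\<^sub>R v) - d1 (c + 0 *\<^sub>R v)) \<le> K * norm (s - 0)"
      by (rule differentiable_bound[OF convex_real_interval(5) der1]) (use that t in \<open>auto intro!: onorm_le simp: mult.commute[of K] intro!: mult_left_mono[OF K[folded d1_def] abs_ge_zero]\<close>)
    also have "\<dots> \<le> K * t" using that K0 by (auto intro: mult_left_mono)
    finally show ?thesis by simp
  qed
  \<comment> \<open>The mean value inequality is applied to \<open>d\<close> minus its linearisation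
    at \<open>c\<close>, whose derivative along the segment is bounded by \<open>b1\<close>.\<close>
  have "norm ((d (c + t *\<^sub>R v) - t *\<^sub>R d1 c) - (d (c + 0 *\<^sub>R v) - 0 *\<^sub>R d1 c)) \<le> (K * t) * norm (t - 0)"
  proof (rule differentiable_bound[OF convex_real_interval(5)[of 0 t], where f = "\<lambda>s. d (c + s *\<^sub>R v) - s *\<^sub>R d1 c"
        and f' = "\<lambda>s s'. s' *\<^sub>R d1 (c + s *\<^sub>R v) - s' *\<^sub>R d1 c"])
    show "((\<lambda>s. d (c + s *\<^sub>R v) - s *\<^sub>R d1 c) has_derivative (\<lambda>s'. s' *\<^sub>R d1 (c + s *\<^sub>R v) - s' *\<^sub>R d1 c)) (at s within {0..t})" for s
      by (intro has_derivative_diff der) (auto intro!: derivative_eq_intros)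
    show "onorm (\<lambda>s'. s' *\<^sub>R d1 (c + s *\<^sub>R v) - s' *\<^sub>R d1 c) \<le> K * t" if "s \<in> {0..t}" for s
    proof (rule onorm_le)
      fix s' :: real
      have "norm (s' *\<^sub>R (d1 (c + s *\<^sub>R v) - d1 c)) \<le> norm s' * (K * t)"
        using mult_left_mono[OF b1[OF that], of "norm s'"] by simp
      then show "norm (s' *\<^sub>R d1 (c + s *\<^sub>R v) - s' *\<^sub>R d1 c) \<le> K * t * norm s'"
        by (simp add: scaleR_diff_right mult.commute)
    qed
  qed (use t in auto)
  then have "norm (t *\<^sub>R d1 c) \<le> K * t * t + norm (d (c + t *\<^sub>R v) - d c)"
    using t norm_triangle_ineq4[of "d (c + t *\<^sub>R v) - d c" "d (c + t *\<^sub>R v) - t *\<^sub>R d1 c - d c"] by simp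
  also have "\<dots> \<le> K * t * t + 2 * \<delta>"
    using norm_triangle_ineq4[of "d (c + t *\<^sub>R v)" "d c"] \<delta>[of "c + t *\<^sub>R v"] \<delta>[of c] by simp
  finally have "t * norm (d1 c) \<le> K * t * t + 2 * \<delta>" using t by simp
  then have "norm (d1 c) \<le> (K * t * t + 2 * \<delta>) / t" using t by (simp add: pos_le_divide_eq mult.commute)
  also have "\<dots> = 2 * \<delta> / t + K * t" using t by (simp add: field_simps)
  finally show ?thesis unfolding d1_def .
qed

lemma uniform_limit_of_Cauchy:
  fixes u :: "nat \<Rightarrow> 'a \<Rightarrow> 'b::complete_space"
  assumes "uniformly_Cauchy_on S u" "\<And>x. x \<in> S \<Longrightarrow> (\<lambda>N. u N x) \<longlonglongrightarrow> U x"
  shows "uniform_limit S u U sequentially"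
proof -
  obtain l where l: "uniform_limit S u l sequentially"
    using Cauchy_uniformly_convergent[OF assms(1)] unfolding uniformly_convergent_on_def by blast
  have "l x = U x" if "x \<in> S" for x
    using tendsto_uniform_limitI[OF l that] assms(2)[OF that] LIMSEQ_unique by blast
  then show ?thesis using l by (simp cong: uniform_limit_cong')
qed

lemma uniformly_Cauchy_derivative:
  fixes u :: "nat \<Rightarrow> 'a::euclidean_space \<Rightarrow> 'b::euclidean_space"
  assumes u: "\<And>N c. u N differentiable (at c)" "geom_bounded 1 0 (Suc j) (\<lambda>N n c. frechet_derivative (u N) (at c) v)"
    and C: "uniformly_Cauchy_on UNIV u"
  shows "uniformly_Cauchy_on UNIV (\<lambda>N c. frechet_derivative (u N) (at c) v)"
  unfolding uniformly_Cauchy_on_def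
proof (intro allI impI)
  fix e :: real assume e: "e > 0"
  have d1: "(\<lambda>c. frechet_derivative (u N) (at c) v) differentiable (at c)" for N c
    using u(2) by simp
  obtain K where K: "K \<ge> 0" "\<And>N c. norm (frechet_derivative (\<lambda>c. frechet_derivative (u N) (at c) v) (at c) v) \<le> K"
    using geom_bounded_bound_pos[OF geom_bounded_frechet[OF u(2), of v]] by auto
  \<comment> \<open>\<open>t\<close> makes the second derivative term \<open>2 * K * t\<close> at
    most \<open>e / 4\<close>; iterates closer than \<open>e * t / 8\<close> then contribute at most
    another \<open>e / 4\<close>.\<close>
  define t where "t = e / (8 * (K + 1))"
  have t: "t > 0" "2 * K * t \<le> e / 4" unfolding t_def using e K(1) by (auto simp: field_simps)
  obtain M where M: "\<And>c m n. m \<ge> M \<Longrightarrow> n \<ge> M \<Longrightarrow> dist (u m c) (u n c) < e * t / 8"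
    using C[unfolded uniformly_Cauchy_on_def] e t(1) by (metis UNIV_I divide_pos_pos mult_pos_pos zero_less_numeral)
  have "dist (frechet_derivative (u m) (at c) v) (frechet_derivative (u n) (at c) v) < e" if "m \<ge> M" "n \<ge> M" for m n c
  proof -
    let ?d = "\<lambda>c. u m c - u n c"
    have hd: "(?d has_derivative (\<lambda>v. frechet_derivative (u m) (at c) v - frechet_derivative (u n) (at c) v)) (at c)" for c
      by (intro has_derivative_diff differentiable_has_derivative u)
    have fd: "frechet_derivative ?d (at c) v = frechet_derivative (u m) (at c) v - frechet_derivative (u n) (at c) v" for c
      by (simp add: frechet_derivative_eqI[OF hd])
    have hd2: "((\<lambda>c. frechet_derivative (u m) (at c) v - frechet_derivative (u n) (at c) v) has_derivative
       (\<lambda>w. frechet_derivative (\<lambda>c. frechet_derivative (u m) (at c) v) (at c) w - frechet_derivative (\<lambda>c. frechet_derivative (u n) (at c) v) (at c) w)) (at c)" for c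
      by (intro has_derivative_diff differentiable_has_derivative d1)
    have "norm (frechet_derivative ?d (at c) v) \<le> 2 * (e * t / 8) / t + (2 * K) * t"
    proof (rule landau_inequality[OF _ _ _ _ t(1)])
      show "?d differentiable (at x)" for x using hd differentiable_def by blast
      show "(\<lambda>x. frechet_derivative ?d (at x) v) differentiable (at x)" for x
        unfolding fd using hd2 differentiable_def by blast
      show "norm (frechet_derivative (\<lambda>x. frechet_derivative ?d (at x) v) (at x) v) \<le> 2 * K" for x
        unfolding fd frechet_derivative_eqI[OF hd2]
        using norm_triangle_le_diff[OF add_mono[OF K(2)[of m x] K(2)[of n x]]] by simp
      show "norm (?d x) \<le> e * t / 8" for x using M[OF that, of x] by (simp add: dist_norm less_imp_le)
    qed
    then have "norm (frechet_derivative ?d (at c) v) \<le> e / 4 + 2 * K * t" using t(1) by simp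
    then show ?thesis using t(2) e unfolding fd dist_norm by linarith
  qed
  then show "\<exists>M. \<forall>x\<in>UNIV. \<forall>m\<ge>M. \<forall>n\<ge>M. dist (frechet_derivative (u m) (at x) v) (frechet_derivative (u n) (at x) v) < e"
    by blast
qed

text \<open>The hypothesis bounds the derivatives of \<open>u\<close> of orders 1 to
  \<open>k + 1\<close>, while the limit has class \<open>k\<close>: the top order is spent in
  Landau's inequality. No bound on \<open>u\<close> itself is asked for, as the orbits are unbounded
  in \<open>c\<close>.\<close>

lemma Ck_on_uniform_limit:
  fixes u :: "nat \<Rightarrow> 'a::euclidean_space \<Rightarrow> 'b::euclidean_space"
  assumes "\<And>N c. u N differentiable (at c)" "\<And>v. geom_bounded 1 0 k (\<lambda>N n c. frechet_derivative (u N) (at c) v)"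
    and "uniformly_Cauchy_on UNIV u" "\<And>c. (\<lambda>N. u N c) \<longlonglongrightarrow> U c"
  shows "Ck_on k U UNIV"
  using assms
proof (induction k arbitrary: u U)
  case 0
  have "uniform_limit UNIV u U sequentially"
    using uniform_limit_of_Cauchy[OF 0(3)] 0(4) by blast
  then have "continuous_on UNIV U"
    by (rule uniform_limit_theorem[rotated])
      (auto intro!: always_eventually continuous_at_imp_continuous_on differentiable_imp_continuous_within 0(1))
  then show ?case by simp
next
  case (Suc k)
  let ?u = "\<lambda>b N c. frechet_derivative (u N) (at c) b"
  have UC: "uniformly_Cauchy_on UNIV (?u b)" for b
    by (rule uniformly_Cauchy_derivative[OF Suc.prems(1) Suc.prems(2) Suc.prems(3)])
  define G where "G = (\<lambda>b c. lim (\<lambda>N. ?u b N c))"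
  have lim: "(\<lambda>N. ?u b N c) \<longlonglongrightarrow> G b c" for b c
  proof -
    obtain l where "uniform_limit UNIV (?u b) l sequentially"
      using Cauchy_uniformly_convergent[OF UC] unfolding uniformly_convergent_on_def by blast
    then have "(\<lambda>N. ?u b N c) \<longlonglongrightarrow> l c" using tendsto_uniform_limitI by fastforce
    then show ?thesis unfolding G_def by (simp add: limI)
  qed
  have ul: "uniform_limit UNIV (?u b) (G b) sequentially" for b
    by (rule uniform_limit_of_Cauchy[OF UC lim])
  have CG: "Ck_on k (G b) UNIV" for b
    by (rule Suc.IH[where u = "?u b"]) (use Suc.prems(2)[of b] UC lim in auto)
  have "\<exists>g. \<forall>x\<in>UNIV. (\<lambda>n. u n x) \<longlonglongrightarrow> g x \<and> (g has_derivative (\<lambda>h. \<Sum>b\<in>Basis. (h \<bullet> b) *\<^sub>R G b x)) (at x within UNIV)"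
  proof (rule has_derivative_sequence[OF convex_UNIV _ _ UNIV_I Suc.prems(4)])
    show "(u n has_derivative frechet_derivative (u n) (at x)) (at x within UNIV)" for n x
      using differentiable_has_derivative[OF Suc.prems(1)] by simp
    fix e :: real assume e: "e > 0"
    \<comment> \<open>Converts closeness in each basis direction into closeness in operator
      norm.\<close>
    define e' where "e' = e / (real DIM('a) + 1)"
    have e': "e' > 0" "real DIM('a) * e' \<le> e" unfolding e'_def using e by (auto simp: field_simps add_pos_pos)
    have "\<forall>\<^sub>F n in sequentially. \<forall>x\<in>UNIV. dist (?u b n x) (G b x) < e'" for b
      using ul[of b] e'(1) unfolding uniform_limit_iff by blast
    then have "\<forall>\<^sub>F n in sequentially. \<forall>b\<in>Basis. \<forall>x\<in>UNIV. dist (?u b n x) (G b x) < e'"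
      by (intro eventually_ball_finite) auto
    then show "\<forall>\<^sub>F n in sequentially. \<forall>x\<in>UNIV. \<forall>h. norm (frechet_derivative (u n) (at x) h - (\<Sum>b\<in>Basis. (h \<bullet> b) *\<^sub>R G b x)) \<le> e * norm h"
    proof eventually_elim
      fix n assume A: "\<forall>b\<in>Basis. \<forall>x\<in>UNIV. dist (?u b n x) (G b x) < e'"
      show "\<forall>x\<in>UNIV. \<forall>h. norm (frechet_derivative (u n) (at x) h - (\<Sum>b\<in>Basis. (h \<bullet> b) *\<^sub>R G b x)) \<le> e * norm h"
      proof (intro ballI allI)
        fix x h
        have "frechet_derivative (u n) (at x) h - (\<Sum>b\<in>Basis. (h \<bullet> b) *\<^sub>R G b x) = (\<Sum>b\<in>Basis. (h \<bullet> b) *\<^sub>R (?u b n x - G b x))"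
          by (subst linear_Basis_expansion[OF linear_frechet_derivative[OF Suc.prems(1)]])
            (simp add: sum_subtractf scaleR_diff_right)
        also have "norm \<dots> \<le> (\<Sum>b\<in>(Basis::'a set). norm h * e')"
        proof (rule sum_norm_le)
          fix b :: 'a assume b: "b \<in> Basis"
          then have "norm (?u b n x - G b x) \<le> e'" using A by (simp add: dist_norm less_imp_le)
          then show "norm ((h \<bullet> b) *\<^sub>R (?u b n x - G b x)) \<le> norm h * e'"
            using b by (simp add: Basis_le_norm mult_mono)
        qed
        also have "\<dots> \<le> e * norm h"
          using mult_left_mono[OF e'(2), of "norm h"] by (simp add: mult_ac)
        finally show "norm (frechet_derivative (u n) (at x) h - (\<Sum>b\<in>Basis. (h \<bullet> b) *\<^sub>R G b x)) \<le> e * norm h" .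
      qed
    qed
  qed
  then obtain g where g: "\<And>x. (\<lambda>n. u n x) \<longlonglongrightarrow> g x"
    "\<And>x. (g has_derivative (\<lambda>h. \<Sum>b\<in>Basis. (h \<bullet> b) *\<^sub>R G b x)) (at x)" by auto
  have "g = U" using g(1) Suc.prems(4) LIMSEQ_unique by blast
  then show ?case
    using g(2) by (intro Ck_on_SucI[where h' = "\<lambda>x h. \<Sum>b\<in>Basis. (h \<bullet> b) *\<^sub>R G b x"])
     (auto intro!: Ck_on_sum Ck_on_scaleR Ck_on_const CG)
qed

section \<open>Global centre manifolds\<close>

text \<open>When a linear recursion with coefficients of rate \<open>\<sigma> ^ s\<close> is differentiated, the derivative of the
  coefficients times the solution joins the inhomogeneity; \<open>j\<close> derivatives raise the rate of the solution
  by at most \<open>linear_rate j\<close> factors \<open>\<sigma> ^ s\<close>. The coefficients of the variational equation of a backward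
  orbit are compositions with the orbit itself, which gives \<open>orbit_rate\<close>.\<close>

primrec linear_rate :: "nat \<Rightarrow> nat" where
  "linear_rate 0 = 0"
| "linear_rate (Suc j) = 2 * linear_rate j + 1"

primrec orbit_rate :: "nat \<Rightarrow> nat" where
  "orbit_rate 0 = 1"
| "orbit_rate (Suc j) = 1 + linear_rate (Suc j) * (Suc j * orbit_rate j)"

lemma orbit_rate_pos: "1 \<le> orbit_rate j"
  by (cases j) auto

lemma orbit_rate_mono: "i \<le> j \<Longrightarrow> orbit_rate i \<le> orbit_rate j"
proof (induction j)
  case (Suc j)
  have "orbit_rate j \<le> orbit_rate (Suc j)" by simp
  then show ?case using Suc by (auto simp: le_Suc_eq simp del: orbit_rate.simps)
qed simp

lemma has_derivative_norm_bound:
  fixes f :: "'a::real_normed_vector \<Rightarrow> 'b::real_normed_vector"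
  assumes "(f has_derivative f') (at x)" "\<And>x y. norm (f x - f y) \<le> B * norm (x - y)"
  shows "norm (f' v) \<le> B * norm v"
proof -
  have lin: "linear f'" using assms(1) has_derivative_linear by blast
  have "norm (f' v) \<le> (B + e) * norm v" if e: "e > 0" for e
  proof (cases "v = 0")
    case True
    then show ?thesis by (simp add: linear_0[OF lin])
  next
    case False
    obtain d where d: "d > 0" "\<And>y. norm (y - x) < d \<Longrightarrow> norm (f y - f x - f' (y - x)) \<le> e * norm (y - x)"
      using assms(1) e unfolding has_derivative_at_alt by blast
    define t where "t = d / (2 * norm v)"
    have t: "t > 0" "norm (t *\<^sub>R v) < d" using d(1) False unfolding t_def by auto
    have "norm (f (x + t *\<^sub>R v) - f x - t *\<^sub>R f' v) \<le> e * (t * norm v)"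
      using d(2)[of "x + t *\<^sub>R v"] t by (simp add: linear_scale[OF lin])
    moreover have "norm (f (x + t *\<^sub>R v) - f x) \<le> B * (t * norm v)"
      using assms(2)[of "x + t *\<^sub>R v" x] t(1) by simp
    moreover have "norm (t *\<^sub>R f' v) \<le> norm (f (x + t *\<^sub>R v) - f x) + norm (f (x + t *\<^sub>R v) - f x - t *\<^sub>R f' v)"
      using norm_triangle_ineq4[of "f (x + t *\<^sub>R v) - f x" "f (x + t *\<^sub>R v) - f x - t *\<^sub>R f' v"] by simp
    ultimately have "t * norm (f' v) \<le> t * ((B + e) * norm v)" using t(1) by (simp add: algebra_simps)
    then show ?thesis using t(1) by simp
  qed
  then have "norm (f' v) \<le> B * norm v + e" if e: "e > 0" for e
  proof -
    have "e / (norm v + 1) > 0" using e by (simp add: add_nonneg_pos)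
    from \<open>\<And>e. e > 0 \<Longrightarrow> norm (f' v) \<le> (B + e) * norm v\<close>[OF this]
    have "norm (f' v) \<le> B * norm v + e * (norm v / (norm v + 1))" by (simp add: algebra_simps)
    moreover have "norm v / (norm v + 1) \<le> 1" by (simp add: divide_le_eq_1 add_nonneg_pos)
    ultimately show ?thesis using mult_left_mono[of "norm v / (norm v + 1)" 1 e] e by linarith
  qed
  then show ?thesis by (rule field_le_epsilon)
qed

section \<open>Standing assumptions and the basic contraction estimate\<close>

text \<open>On the range of \<open>P\<close>, \<open>D\<close> is an isometric involution, as for
  the eigenvalues 1 and -1, so it inverts itself there; on the complementary range it contracts.
  Weights \<open>\<sigma> ^ (e * n)\<close> measure growth into the past: propagating the centre
  part gains at least \<open>1 / \<sigma>\<close>, propagating the stable part costs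
  \<open>\<sigma> ^ e\<close>. The gap conditions say that both remain contractions with factor
  \<theta> for all rates from 1 to \<open>orbit_rate k\<close>; the 2 in front of \<epsilon> comes
  from \<open>norm_le_nm\<close>.\<close>

locale centre_perturbation =
  fixes D P R :: "'a::euclidean_space \<Rightarrow> 'a" and \<kappa> \<epsilon> \<sigma> \<theta> :: real and k :: nat
  assumes linD: "linear D" and linP: "linear P"
    and PP: "P (P z) = P z"
    and nP: "norm (P z) \<le> norm z" and nQ: "norm (z - P z) \<le> norm z"
    and DP: "D (P z) = P (D z)" and DDP: "D (D (P z)) = P z"
    and nDP: "norm (D (P z)) \<le> norm (P z)"
    and nDQ: "norm (D (z - P z)) \<le> \<kappa> * norm (z - P z)" and \<kappa>0: "0 \<le> \<kappa>"
    and GR: "geom_bounded \<sigma> 0 (Suc k) (\<lambda>N n. R)"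
    and LR: "norm (R z - R z') \<le> \<epsilon> * norm (z - z')" and \<epsilon>0: "0 \<le> \<epsilon>"
    and \<sigma>1: "1 < \<sigma>" and \<theta>: "0 \<le> \<theta>" "\<theta> < 1"
    and gap_centre: "1 / \<sigma> + 2 * \<epsilon> \<le> \<theta>"
    and gap_stable: "(\<kappa> + 2 * \<epsilon>) * \<sigma> ^ orbit_rate k \<le> \<theta>"
begin

definition Q :: "'a \<Rightarrow> 'a" where "Q z = z - P z"

text \<open>A maximum rather than a sum, so that separate estimates of the centre and the stable
  component with a common factor combine without loss.\<close>

definition nm :: "'a \<Rightarrow> real" where "nm z = max (norm (P z)) (norm (Q z))"

lemma linQ: "linear Q"
  unfolding Q_def[abs_def] by (intro linear_compose_sub linear_id[unfolded id_def] linP)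

lemma blP: "bounded_linear P" and blQ: "bounded_linear Q" and blD: "bounded_linear D"
  using linP linQ linD by (auto simp: linear_conv_bounded_linear)

lemma PQ: "P (Q z) = 0" and QP: "Q (P z) = 0" and QQ: "Q (Q z) = Q z" and P_plus_Q: "P z + Q z = z"
  unfolding Q_def by (simp_all add: linear_diff[OF linP] PP)

lemma DQ: "D (Q z) = Q (D z)"
  unfolding Q_def by (simp add: linear_diff[OF linD] DP)

lemma nQ': "norm (Q z) \<le> norm z" and nDQ': "norm (D (Q z)) \<le> \<kappa> * norm (Q z)"
  unfolding Q_def by (rule nQ, rule nDQ)

lemma nm_le: "nm z \<le> norm z" unfolding nm_def using nP nQ' by simp

lemma norm_le_nm: "norm z \<le> 2 * nm z"
proof -
  have "norm z \<le> norm (P z) + norm (Q z)" using norm_triangle_ineq[of "P z" "Q z"] P_plus_Q by simp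
  then show ?thesis unfolding nm_def by linarith
qed

lemma nm_nonneg: "0 \<le> nm z" unfolding nm_def by (simp add: le_max_iff_disj)

lemma nm_add: "nm (x + y) \<le> nm x + nm y"
proof -
  have "norm (P (x + y)) \<le> norm (P x) + norm (P y)" "norm (Q (x + y)) \<le> norm (Q x) + norm (Q y)"
    by (simp_all add: linear_add[OF linP] linear_add[OF linQ] norm_triangle_ineq)
  then show ?thesis unfolding nm_def by linarith
qed

lemma \<sigma>0: "0 < \<sigma>" and \<sigma>ge1: "1 \<le> \<sigma>" using \<sigma>1 by auto

text \<open>The centre component at \<open>Suc n\<close> comes from time \<open>n\<close>, whose
  weight is smaller by a factor of at least \<sigma> because \<open>1 \<le> e\<close>; the stable
  component at \<open>n\<close> comes from \<open>Suc n\<close>, and \<open>gap_stable\<close>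
  absorbs the larger weight. With \<open>B = 0\<close> this is the contraction of the Picard
  iteration; a general \<open>B\<close> gives the a priori bound for inhomogeneous linear
  recursions.\<close>

lemma weighted_contraction:
  assumes e: "1 \<le> e" "e \<le> orbit_rate k"
    and d: "\<And>n. nm (d n) \<le> C * \<sigma> ^ (e * n)"
    and P0: "norm (P (d' 0)) \<le> K"
    and PS: "\<And>n. norm (P (d' (Suc n))) \<le> norm (P (d n)) + \<epsilon> * norm (d (Suc n)) + B * \<sigma> ^ (e * Suc n)"
    and Qn: "\<And>n. norm (Q (d' n)) \<le> \<kappa> * norm (Q (d (Suc n))) + \<epsilon> * norm (d (Suc n)) + B * \<sigma> ^ (e * n)"
    and K: "\<theta> * C + B \<le> K"
  shows "nm (d' n) \<le> K * \<sigma> ^ (e * n)"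
proof -
  have C0: "C \<ge> 0" using d[of 0] nm_nonneg[of "d 0"] by simp
  have dn: "norm (d n) \<le> 2 * (C * \<sigma> ^ (e * n))" for n using norm_le_nm[of "d n"] d[of n] by linarith
  have \<epsilon>dn: "\<epsilon> * norm (d n) \<le> \<epsilon> * (2 * (C * \<sigma> ^ (e * n)))" for n by (rule mult_left_mono[OF dn \<epsilon>0])
  have KB: "(\<theta> * C + B) * \<sigma> ^ (e * n) \<le> K * \<sigma> ^ (e * n)" for n
    using K \<sigma>0 by (intro mult_right_mono) auto
  have "norm (P (d' n)) \<le> K * \<sigma> ^ (e * n)"
  proof (cases n)
    case 0
    then show ?thesis using P0 by simp
  next
    case (Suc m)
    have pos: "0 \<le> C * \<sigma> ^ (e * n)" using C0 \<sigma>0 by simp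
    have s: "\<sigma> ^ (e * m) \<le> \<sigma> ^ (e * n) / \<sigma>"
    proof -
      have "\<sigma> ^ (e * m) * \<sigma> \<le> \<sigma> ^ (e * n)"
        using power_increasing[of "Suc (e * m)" "e * n" \<sigma>] e \<sigma>ge1 Suc by (simp add: mult.commute)
      then show ?thesis using \<sigma>0 by (simp add: pos_le_divide_eq)
    qed
    have "norm (P (d m)) \<le> C * \<sigma> ^ (e * m)" using d[of m] unfolding nm_def by simp
    also have "\<dots> \<le> C * (\<sigma> ^ (e * n) / \<sigma>)" by (rule mult_left_mono[OF s C0])
    also have "\<dots> = (1 / \<sigma>) * (C * \<sigma> ^ (e * n))" by simp
    finally have "norm (P (d' n)) \<le> (1 / \<sigma>) * (C * \<sigma> ^ (e * n)) + \<epsilon> * (2 * (C * \<sigma> ^ (e * n))) + B * \<sigma> ^ (e * n)"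
      using PS[of m] \<epsilon>dn[of "Suc m"] Suc by simp
    also have "\<dots> = (1 / \<sigma> + 2 * \<epsilon>) * (C * \<sigma> ^ (e * n)) + B * \<sigma> ^ (e * n)" by (simp only: algebra_simps)
    also have "\<dots> \<le> \<theta> * (C * \<sigma> ^ (e * n)) + B * \<sigma> ^ (e * n)"
      using mult_right_mono[OF gap_centre pos] by simp
    also have "\<dots> = (\<theta> * C + B) * \<sigma> ^ (e * n)" by (simp only: algebra_simps)
    finally show ?thesis using KB[of n] by linarith
  qed
  moreover have "norm (Q (d' n)) \<le> K * \<sigma> ^ (e * n)"
  proof -
    have pos: "0 \<le> C * \<sigma> ^ (e * n)" using C0 \<sigma>0 by simp
    have "norm (Q (d (Suc n))) \<le> C * \<sigma> ^ (e * Suc n)" using d[of "Suc n"] unfolding nm_def by simp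
    from mult_left_mono[OF this \<kappa>0] have "norm (Q (d' n)) \<le> \<kappa> * (C * \<sigma> ^ (e * Suc n)) + \<epsilon> * (2 * (C * \<sigma> ^ (e * Suc n))) + B * \<sigma> ^ (e * n)"
      using Qn[of n] \<epsilon>dn[of "Suc n"] by linarith
    also have "\<dots> = ((\<kappa> + 2 * \<epsilon>) * \<sigma> ^ e) * (C * \<sigma> ^ (e * n)) + B * \<sigma> ^ (e * n)"
      by (simp add: power_add algebra_simps)
    also have "\<dots> \<le> \<theta> * (C * \<sigma> ^ (e * n)) + B * \<sigma> ^ (e * n)"
    proof -
      have "(\<kappa> + 2 * \<epsilon>) * \<sigma> ^ e \<le> (\<kappa> + 2 * \<epsilon>) * \<sigma> ^ orbit_rate k"
        using \<kappa>0 \<epsilon>0 \<sigma>ge1 e by (intro mult_left_mono power_increasing) auto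
      then have "(\<kappa> + 2 * \<epsilon>) * \<sigma> ^ e \<le> \<theta>" using gap_stable by linarith
      from mult_right_mono[OF this pos] show ?thesis by simp
    qed
    also have "\<dots> = (\<theta> * C + B) * \<sigma> ^ (e * n)" by (simp only: algebra_simps)
    finally show ?thesis using KB[of n] by linarith
  qed
  ultimately show ?thesis unfolding nm_def by simp
qed

text \<open>Fixed points of \<open>step c\<close> are the backward orbits of \<open>D + R\<close>, indexed by the number of steps
  into the past, that end at a point with centre component \<open>P c\<close>: the centre components are
  propagated backwards in time, the stable components forwards.\<close>

definition step :: "'a \<Rightarrow> (nat \<Rightarrow> 'a) \<Rightarrow> nat \<Rightarrow> 'a" where
  "step c z n = P (if n = 0 then c else D (z (n - 1) - R (z n))) + Q (D (z (Suc n)) + R (z (Suc n)))"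

lemma step_P: "P (step c z n) = P (if n = 0 then c else D (z (n - 1) - R (z n)))"
  unfolding step_def by (simp only: linear_add[OF linP] PP PQ add_0_right)

lemma step_Q: "Q (step c z n) = Q (D (z (Suc n)) + R (z (Suc n)))"
  unfolding step_def by (simp only: linear_add[OF linQ] QQ QP add_0_left)

lemma nPD: "norm (P (D z)) \<le> norm (P z)" and nQD: "norm (Q (D z)) \<le> \<kappa> * norm (Q z)"
  using nDP[of z] nDQ'[of z] by (simp_all add: DP DQ)

lemma step_diff:
  "P (step c z 0 - step c' z' 0) = P (c - c')"
  "norm (P (step c z (Suc n) - step c' z' (Suc n))) \<le> norm (P (z n - z' n)) + \<epsilon> * norm (z (Suc n) - z' (Suc n))"
  "norm (Q (step c z n - step c' z' n)) \<le> \<kappa> * norm (Q (z (Suc n) - z' (Suc n))) + \<epsilon> * norm (z (Suc n) - z' (Suc n))"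
proof -
  show "P (step c z 0 - step c' z' 0) = P (c - c')" by (simp add: linear_diff[OF linP] step_P)
  have "P (step c z (Suc n) - step c' z' (Suc n)) = P (D ((z n - z' n) - (R (z (Suc n)) - R (z' (Suc n)))))"
    by (simp add: linear_diff[OF linP] linear_diff[OF linD] step_P)
  then have "norm (P (step c z (Suc n) - step c' z' (Suc n))) \<le> norm (P (z n - z' n) - P (R (z (Suc n)) - R (z' (Suc n))))"
    using nPD[of "(z n - z' n) - (R (z (Suc n)) - R (z' (Suc n)))"] by (simp add: linear_diff[OF linP])
  also have "\<dots> \<le> norm (P (z n - z' n)) + norm (R (z (Suc n)) - R (z' (Suc n)))"
    using norm_triangle_ineq4 nP add_left_mono order_trans by metis
  finally show "norm (P (step c z (Suc n) - step c' z' (Suc n))) \<le> norm (P (z n - z' n)) + \<epsilon> * norm (z (Suc n) - z' (Suc n))"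
    using LR[of "z (Suc n)" "z' (Suc n)"] by linarith
  have "Q (step c z n - step c' z' n) = Q (D (z (Suc n) - z' (Suc n))) + Q (R (z (Suc n)) - R (z' (Suc n)))"
    by (simp add: linear_diff[OF linQ] linear_diff[OF linD] linear_add[OF linQ] step_Q)
  then have "norm (Q (step c z n - step c' z' n)) \<le> norm (Q (D (z (Suc n) - z' (Suc n)))) + norm (Q (R (z (Suc n)) - R (z' (Suc n))))"
    by (simp add: norm_triangle_ineq)
  then show "norm (Q (step c z n - step c' z' n)) \<le> \<kappa> * norm (Q (z (Suc n) - z' (Suc n))) + \<epsilon> * norm (z (Suc n) - z' (Suc n))"
    using nQD[of "z (Suc n) - z' (Suc n)"] nQ'[of "R (z (Suc n)) - R (z' (Suc n))"] LR[of "z (Suc n)" "z' (Suc n)"] by linarith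
qed

lemma step_contraction:
  assumes d: "\<And>n. nm (z n - z' n) \<le> C * \<sigma> ^ n" and c: "norm (P (c - c')) \<le> K" and K: "\<theta> * C \<le> K"
  shows "nm (step c z n - step c' z' n) \<le> K * \<sigma> ^ n"
proof -
  have "nm (step c z n - step c' z' n) \<le> K * \<sigma> ^ (1 * n)"
    by (rule weighted_contraction[where d = "\<lambda>n. z n - z' n" and C = C and B = 0])
      (use d c K step_diff[where c = c and z = z and c' = c' and z' = z'] orbit_rate_pos in auto)
  then show ?thesis by simp
qed

section \<open>Picard iteration for slow backward orbits\<close>

text \<open>The iteration starts from the backward orbit of the unperturbed map through
  \<open>P c\<close>, where \<open>D\<close> is its own inverse: it is exact for
  \<open>R = 0\<close> and linear in \<open>c\<close>, so its derivatives are explicit.\<close>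

primrec it :: "nat \<Rightarrow> nat \<Rightarrow> 'a \<Rightarrow> 'a" where
  "it 0 = (\<lambda>n c. (D ^^ n) (P c))"
| "it (Suc N) = (\<lambda>n c. step c (\<lambda>m. it N m c) n)"

lemma DnP: "P ((D ^^ n) (P c)) = (D ^^ n) (P c)" "norm ((D ^^ n) (P c)) \<le> norm (P c)"
proof (induction n)
  case (Suc n)
  {
    case 1
    then show ?case using Suc by (simp add: DP[symmetric])
  next
    case 2
    then show ?case using Suc nDP[of "(D ^^ n) (P c)"] by simp
  }
qed (simp_all add: PP)

definition RB :: real where "RB = (SOME C. 0 \<le> C \<and> (\<forall>z. norm (R z) \<le> C))"

lemma RB: "0 \<le> RB" "norm (R z) \<le> RB"
proof -
  obtain C where "C \<ge> 0" "\<And>N n c. norm (R c) \<le> C * \<sigma> ^ (0 * n)" using geom_bounded_bound_pos[OF GR \<sigma>0] by metis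
  then have "\<exists>C. 0 \<le> C \<and> (\<forall>z. norm (R z) \<le> C)" by auto
  from someI_ex[OF this] show "0 \<le> RB" "norm (R z) \<le> RB" unfolding RB_def by auto
qed

text \<open>The first step alters the unperturbed orbit by values of \<open>R\<close> only. As
  \<open>R\<close> is globally bounded, the estimate is independent of \<open>c\<close>, and
  convergence will be uniform over the whole space.\<close>

lemma it_initial: "nm (it (Suc 0) n c - it 0 n c) \<le> RB * \<sigma> ^ n"
proof -
  let ?a = "\<lambda>n. (D ^^ n) (P c)"
  have Qa: "Q (?a n) = 0" for n using DnP(1)[of n c] unfolding Q_def by simp
  have *: "RB \<le> RB * \<sigma> ^ n" using mult_left_mono[OF one_le_power[OF \<sigma>ge1] RB(1)] by simp
  have "P (it (Suc 0) n c - it 0 n c) = (if n = 0 then 0 else - P (D (R (?a n))))"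
    by (cases n) (simp_all add: linear_diff[OF linP] linear_diff[OF linD] step_P PP DnP(1) DP[symmetric])
  then have 1: "norm (P (it (Suc 0) n c - it 0 n c)) \<le> RB"
    using nPD[of "R (?a n)"] nP[of "R (?a n)"] RB(2)[of "?a n"] RB(1) by (auto intro: order_trans)
  have "Q (it (Suc 0) n c - it 0 n c) = Q (?a (Suc (Suc n))) + Q (R (?a (Suc n))) - Q (?a n)"
    by (simp add: linear_diff[OF linQ] linear_add[OF linQ] step_Q)
  then have "Q (it (Suc 0) n c - it 0 n c) = Q (R (?a (Suc n)))" using Qa[of "Suc (Suc n)"] Qa[of n] by simp
  then have 2: "norm (Q (it (Suc 0) n c - it 0 n c)) \<le> RB"
    using nQ'[of "R (?a (Suc n))"] RB(2)[of "?a (Suc n)"] by (auto intro: order_trans)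
  from 1 2 * show ?thesis unfolding nm_def by simp
qed

lemma it_step_bound: "nm (it (Suc N) n c - it N n c) \<le> RB * \<theta> ^ N * \<sigma> ^ n"
proof (induction N arbitrary: n)
  case 0
  then show ?case using it_initial by simp
next
  case (Suc N)
  have "nm (step c (\<lambda>m. it (Suc N) m c) n - step c (\<lambda>m. it N m c) n) \<le> (RB * \<theta> ^ Suc N) * \<sigma> ^ n"
    by (rule step_contraction[where C = "RB * \<theta> ^ N"]) (use Suc RB(1) \<theta> in \<open>auto simp: linear_0[OF linP]\<close>)
  then show ?case by simp
qed

text \<open>\<open>(\<theta> ^ N - \<theta> ^ (N + p)) / (1 - \<theta>)\<close> is a partial
  geometric sum in closed form, to which the induction adds one term.\<close>

lemma it_Cauchy_bound: "nm (it (N + p) n c - it N n c) \<le> RB * \<sigma> ^ n * (\<theta> ^ N - \<theta> ^ (N + p)) / (1 - \<theta>)"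
proof (induction p)
  case 0
  then show ?case by (simp add: nm_def linear_0[OF linP] linear_0[OF linQ])
next
  case (Suc p)
  have "nm (it (N + Suc p) n c - it N n c) \<le> nm (it (Suc (N + p)) n c - it (N + p) n c) + nm (it (N + p) n c - it N n c)"
    using nm_add[of "it (Suc (N + p)) n c - it (N + p) n c" "it (N + p) n c - it N n c"] by simp
  also have "\<dots> \<le> RB * \<theta> ^ (N + p) * \<sigma> ^ n + RB * \<sigma> ^ n * (\<theta> ^ N - \<theta> ^ (N + p)) / (1 - \<theta>)"
    by (rule add_mono[OF it_step_bound Suc])
  also have "\<dots> = RB * \<sigma> ^ n * (\<theta> ^ N - \<theta> ^ (N + Suc p)) / (1 - \<theta>)"
    using \<theta> by (simp add: field_simps)
  finally show ?case .
qed

lemma it_Cauchy_le: 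
  assumes "N \<le> M"
  shows "norm (it M n c - it N n c) \<le> (2 * RB * \<sigma> ^ n / (1 - \<theta>)) * \<theta> ^ N"
proof -
  obtain p where p: "M = N + p" using assms le_Suc_ex by blast
  have "norm (it M n c - it N n c) \<le> 2 * (RB * \<sigma> ^ n * (\<theta> ^ N - \<theta> ^ M) / (1 - \<theta>))"
    using norm_le_nm[of "it M n c - it N n c"] it_Cauchy_bound[of N p n c] unfolding p by linarith
  also have "\<dots> \<le> 2 * (RB * \<sigma> ^ n * \<theta> ^ N / (1 - \<theta>))"
    using RB(1) \<sigma>0 \<theta> by (intro mult_left_mono divide_right_mono) auto
  finally show ?thesis by simp
qed

lemma it_uniformly_Cauchy: "uniformly_Cauchy_on UNIV (\<lambda>N c. it N n c)"
  unfolding uniformly_Cauchy_on_def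
proof (intro allI impI)
  fix e :: real assume e: "e > 0"
  define C where "C = 2 * RB * \<sigma> ^ n / (1 - \<theta>)"
  have C0: "C \<ge> 0" unfolding C_def using RB(1) \<sigma>0 \<theta> by simp
  have "(\<lambda>N. C * \<theta> ^ N) \<longlonglongrightarrow> C * 0" using \<theta> by (intro tendsto_intros LIMSEQ_power_zero) auto
  then have "\<forall>\<^sub>F N in sequentially. C * \<theta> ^ N < e / 2" by (rule order_tendstoD(2)) (use e in simp)
  then obtain M where M: "C * \<theta> ^ M < e / 2" unfolding eventually_sequentially by blast
  have "dist (it m n c) (it l n c) < e" if "m \<ge> M" "l \<ge> M" for m l c
  proof -
    have "dist (it m n c) (it l n c) \<le> dist (it m n c) (it M n c) + dist (it l n c) (it M n c)"
      by (rule dist_triangle2)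
    then show ?thesis
      using it_Cauchy_le[OF that(1), of n c] it_Cauchy_le[OF that(2), of n c] M unfolding C_def[symmetric] dist_norm by linarith
  qed
  then show "\<exists>M. \<forall>x\<in>UNIV. \<forall>m\<ge>M. \<forall>l\<ge>M. dist (it m n x) (it l n x) < e" by blast
qed

definition Z :: "nat \<Rightarrow> 'a \<Rightarrow> 'a" where "Z n c = lim (\<lambda>N. it N n c)"

text \<open>The end point of the slow backward orbit with centre component \<open>P c\<close>.
  \<open>H\<close> depends on \<open>P c\<close> only and leaves the centre component unchanged, so
  it projects onto a graph over the range of \<open>P\<close>; this graph, the set of fixed points
  of \<open>H\<close>, is the centre manifold.\<close>

definition H :: "'a \<Rightarrow> 'a" where "H c = Z 0 c"

lemma Z_lim: "(\<lambda>N. it N n c) \<longlonglongrightarrow> Z n c"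
proof -
  obtain l where "uniform_limit UNIV (\<lambda>N c. it N n c) l sequentially"
    using Cauchy_uniformly_convergent[OF it_uniformly_Cauchy] unfolding uniformly_convergent_on_def by blast
  then have "(\<lambda>N. it N n c) \<longlonglongrightarrow> l c" using tendsto_uniform_limitI by fastforce
  then show ?thesis unfolding Z_def by (simp add: limI)
qed

lemma isCont_R: "isCont R z"
  using geom_bounded_has_derivative[OF GR] has_derivative_continuous by blast

lemma Z_step: "Z n c = step c (\<lambda>m. Z m c) n"
proof (rule LIMSEQ_unique)
  show "(\<lambda>N. it (Suc N) n c) \<longlonglongrightarrow> Z n c" using Z_lim by (rule LIMSEQ_Suc)
  have "(\<lambda>N. step c (\<lambda>m. it N m c) n) \<longlonglongrightarrow> step c (\<lambda>m. Z m c) n"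
    unfolding step_def
    by (cases n) (auto intro!: tendsto_intros bounded_linear.tendsto[OF blP] bounded_linear.tendsto[OF blQ]
      bounded_linear.tendsto[OF blD] Z_lim isCont_tendsto_compose[OF isCont_R])
  then show "(\<lambda>N. it (Suc N) n c) \<longlonglongrightarrow> step c (\<lambda>m. Z m c) n" by simp
qed

lemma Z_growth: "\<exists>C. \<forall>n. norm (Z n c) \<le> C * \<sigma> ^ n"
proof -
  define C where "C = 2 * RB / (1 - \<theta>)"
  have "norm (Z n c) \<le> (C + norm c) * \<sigma> ^ n" for n
  proof (rule Lim_norm_ubound[OF _ Z_lim])
    show "\<forall>\<^sub>F N in sequentially. norm (it N n c) \<le> (C + norm c) * \<sigma> ^ n"
    proof (rule always_eventually, rule allI)
      fix N
      have "norm (it N n c) \<le> norm (it N n c - it 0 n c) + norm (it 0 n c)" by norm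
      also have "\<dots> \<le> C * \<sigma> ^ n + norm c"
        using it_Cauchy_le[of 0 N n c] DnP(2)[of n c] nP[of c] unfolding C_def by simp
      also have "\<dots> \<le> C * \<sigma> ^ n + norm c * \<sigma> ^ n"
        using mult_left_mono[OF one_le_power[OF \<sigma>ge1], of "norm c" n] by simp
      finally show "norm (it N n c) \<le> (C + norm c) * \<sigma> ^ n" by (simp add: distrib_right)
    qed
  qed simp
  then show ?thesis by blast
qed

text \<open>Two slow orbits over the same centre component differ by at most
  \<open>B * \<sigma> ^ n\<close>, and each application of \<open>step\<close> improves
  \<open>B\<close> by the factor \<theta>. Growth of order \<open>\<sigma> ^ n\<close> thus singles
  out one orbit; invariance and the inclusion of fixed points follow by exhibiting slow
  orbits.\<close>

lemma step_unique:
  assumes z: "\<And>n. z n = step c z n" "\<And>n. norm (z n) \<le> C * \<sigma> ^ n"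
  shows "z n = Z n c"
proof -
  obtain C' where C': "\<And>n. norm (Z n c) \<le> C' * \<sigma> ^ n" using Z_growth by blast
  define B where "B = C + C'"
  have B: "norm (z n - Z n c) \<le> B * \<sigma> ^ n" for n
    using norm_triangle_le_diff[OF add_mono[OF z(2)[of n] C'[of n]]] unfolding B_def by (simp add: distrib_right)
  have B0: "B \<ge> 0" using B[of 0] norm_ge_zero[of "z 0 - Z 0 c"] by (simp del: norm_ge_zero)
  have it: "nm (z n - Z n c) \<le> (B * \<theta> ^ p) * \<sigma> ^ n" for p n
  proof (induction p arbitrary: n)
    case 0
    then show ?case using nm_le[of "z n - Z n c"] B[of n] by simp
  next
    case (Suc p)
    have "nm (step c z n - step c (\<lambda>m. Z m c) n) \<le> (B * \<theta> ^ Suc p) * \<sigma> ^ n"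
      by (rule step_contraction[where C = "B * \<theta> ^ p"]) (use Suc B0 \<theta> in \<open>auto simp: linear_0[OF linP]\<close>)
    then show ?case using z(1)[of n] Z_step[of n c] by simp
  qed
  have "(\<lambda>p. B * \<theta> ^ p * \<sigma> ^ n) \<longlonglongrightarrow> B * 0 * \<sigma> ^ n"
    using \<theta> by (intro tendsto_intros LIMSEQ_power_zero) auto
  then have "nm (z n - Z n c) \<le> B * 0 * \<sigma> ^ n"
    by (rule LIMSEQ_le_const) (use it in auto)
  then have "norm (z n - Z n c) \<le> 0" using norm_le_nm[of "z n - Z n c"] by linarith
  then show ?thesis by simp
qed

lemma P_H: "P (H c) = P c"
  unfolding H_def by (subst Z_step) (simp add: step_P)

lemma H_P: "H (P c) = H c"
proof -
  have "it N n (P c) = it N n c" for N n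
    by (induction N arbitrary: n) (auto simp: PP step_def)
  then show ?thesis unfolding H_def Z_def by simp
qed

text \<open>Prepending the image of \<open>z\<close> to the backward orbit of \<open>z\<close> gives
  a slow backward orbit of the image, which uniqueness identifies.\<close>

lemma H_invariant:
  assumes z: "H z = z"
  shows "H (D z + R z) = D z + R z"
proof -
  define y where "y = (\<lambda>n. case n of 0 \<Rightarrow> D z + R z | Suc m \<Rightarrow> Z m z)"
  have y0: "y 0 = D z + R z" and yS: "y (Suc m) = Z m z" for m unfolding y_def by auto
  have Z0: "Z 0 z = z" using z unfolding H_def .
  obtain C where C: "\<And>n. norm (Z n z) \<le> C * \<sigma> ^ n" using Z_growth by blast
  have C0: "C \<ge> 0" using C[of 0] norm_ge_zero[of "Z 0 z"] by (simp del: norm_ge_zero)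
  have "y n = step (D z + R z) y n" for n
  proof (cases n)
    case 0
    then show ?thesis unfolding step_def by (simp add: y0 yS Z0 P_plus_Q)
  next
    case (Suc m)
    show ?thesis
    proof (cases m)
      \<comment> \<open>Index 1 is special: in the orbit of \<open>z\<close> this entry had its
        centre component prescribed as \<open>P z\<close>, whereas after the shift the recursion has
        to produce it, by \<open>D (D (P z)) = P z\<close>.\<close>
      case 0
      have "step (D z + R z) y 1 = P z + Q (D (Z 1 z) + R (Z 1 z))"
        unfolding step_def using DDP[of z] by (simp add: y0 yS[of "Suc 0", simplified] yS[of 0, simplified] Z0 DP)
      also have "Q (D (Z 1 z) + R (Z 1 z)) = Q z"
        using step_Q[of z "\<lambda>m. Z m z" 0] Z_step[of 0 z] Z0 by simp
      finally show ?thesis using Suc 0 yS[of 0] Z0 P_plus_Q by simp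
    next
      case (Suc l)
      then show ?thesis using \<open>n = Suc m\<close> Z_step[of "Suc l" z] unfolding step_def by (simp add: yS)
    qed
  qed
  moreover have "norm (y n) \<le> (norm (D z + R z) + C) * \<sigma> ^ n" for n
  proof (cases n)
    case 0
    then show ?thesis using y0 C0 by simp
  next
    case (Suc m)
    have "norm (y n) \<le> C * \<sigma> ^ m" using Suc yS C by simp
    also have "\<dots> \<le> C * \<sigma> ^ n" using C0 \<sigma>ge1 Suc by (intro mult_left_mono power_increasing) auto
    also have "\<dots> \<le> (norm (D z + R z) + C) * \<sigma> ^ n" using \<sigma>0 by (intro mult_right_mono) auto
    finally show ?thesis .
  qed
  ultimately have "y 0 = Z 0 (D z + R z)" by (rule step_unique)
  then show ?thesis unfolding H_def y0 by simp
qed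

text \<open>A fixed point is its own constant, hence slowly growing, backward orbit.\<close>

lemma H_fixed:
  assumes z: "D z + R z = z"
  shows "H z = z"
proof -
  have zR: "z - R z = D z" using z by (metis add_diff_cancel_right')
  have "z = step z (\<lambda>_. z) n" for n
    unfolding step_def zR z using P_plus_Q[of z] DDP[of z] by (simp add: DP)
  moreover have "norm z \<le> norm z * \<sigma> ^ n" for n
    using mult_left_mono[OF one_le_power[OF \<sigma>ge1], of "norm z" n] by simp
  ultimately have "z = Z 0 z" by (rule step_unique[of "\<lambda>_. z"])
  then show ?thesis unfolding H_def by simp
qed

text \<open>Every iterate is Lipschitz in \<open>c\<close> with constant 1 for \<open>nm\<close>, as
  \<theta> is below 1 and \<open>P\<close> does not increase norms. With this constant the error
  estimate in \<open>H_tangent\<close> closes with the factor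
  \<open>\<kappa> + 2 * \<epsilon>\<close>.\<close>

lemma H_lipschitz: "nm (H c - H c') \<le> norm (c - c')"
proof -
  let ?d = "norm (c - c')"
  have *: "nm (it N n c - it N n c') \<le> ?d * \<sigma> ^ n" for N n
  proof (induction N arbitrary: n)
    case 0
    have "it 0 n c - it 0 n c' = (D ^^ n) (P (c - c'))"
    proof (induction n)
      case (Suc n)
      then show ?case by (simp add: linear_diff[OF linD, symmetric])
    qed (simp add: linear_diff[OF linP])
    then have "norm (it 0 n c - it 0 n c') \<le> ?d" using DnP(2)[of n "c - c'"] nP[of "c - c'"] by simp
    then show ?case
      using nm_le[of "it 0 n c - it 0 n c'"] mult_left_mono[OF one_le_power[OF \<sigma>ge1], of ?d n] by simp
  next
    case (Suc N)
    have "\<theta> * ?d \<le> ?d" using \<theta> mult_right_mono[of \<theta> 1 ?d] by simp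
    then show ?case using step_contraction[OF Suc, of c c' ?d] nP[of "c - c'"] by simp
  qed
  have 1: "(\<lambda>N. it N 0 c - it N 0 c') \<longlonglongrightarrow> H c - H c'" unfolding H_def by (intro tendsto_diff Z_lim)
  have "norm (P (H c - H c')) \<le> ?d"
    by (rule Lim_norm_ubound[OF _ bounded_linear.tendsto[OF blP 1]]) (use *[of _ 0] in \<open>auto simp: nm_def\<close>)
  moreover have "norm (Q (H c - H c')) \<le> ?d"
    by (rule Lim_norm_ubound[OF _ bounded_linear.tendsto[OF blQ 1]]) (use *[of _ 0] in \<open>auto simp: nm_def\<close>)
  ultimately show ?thesis unfolding nm_def by simp
qed

section \<open>The variational equation and derivative bounds uniform in the iteration\<close>

lemma R_derivative: "(R has_derivative frechet_derivative R (at z)) (at z)"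
  by (rule geom_bounded_has_derivative[OF GR])

lemma norm_R_derivative: "norm (frechet_derivative R (at z) v) \<le> \<epsilon> * norm v"
proof (rule has_derivative_norm_bound)
  show "(R has_derivative frechet_derivative R (at z)) (at z)" by (rule R_derivative)
qed (rule LR)

text \<open>The derivative of \<open>step\<close> along the iterate \<open>it N\<close>, without the
  datum \<open>P u\<close> at \<open>n = 0\<close>. That datum is treated as an inhomogeneity, so
  that derivatives of every order obey recursions of one form.\<close>

definition lstep :: "nat \<Rightarrow> 'a \<Rightarrow> (nat \<Rightarrow> 'a) \<Rightarrow> nat \<Rightarrow> 'a" where
  "lstep N c w n = P (if n = 0 then 0 else D (w (n - 1) - frechet_derivative R (at (it N n c)) (w n)))
     + Q (D (w (Suc n)) + frechet_derivative R (at (it N (Suc n) c)) (w (Suc n)))"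

lemma lstep_P: "P (lstep N c w n) = P (if n = 0 then 0 else D (w (n - 1) - frechet_derivative R (at (it N n c)) (w n)))"
  unfolding lstep_def by (simp only: linear_add[OF linP] PP PQ add_0_right)

lemma lstep_Q: "Q (lstep N c w n) = Q (D (w (Suc n)) + frechet_derivative R (at (it N (Suc n) c)) (w (Suc n)))"
  unfolding lstep_def by (simp only: linear_add[OF linQ] QQ QP add_0_left)

lemma lstep_bounds:
  "P (lstep N c w 0) = 0"
  "norm (P (lstep N c w (Suc n))) \<le> norm (P (w n)) + \<epsilon> * norm (w (Suc n))"
  "norm (Q (lstep N c w n)) \<le> \<kappa> * norm (Q (w (Suc n))) + \<epsilon> * norm (w (Suc n))"
proof -
  show "P (lstep N c w 0) = 0" by (simp add: lstep_P linear_0[OF linP])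
  let ?r = "\<lambda>n. frechet_derivative R (at (it N n c)) (w n)"
  have "norm (P (lstep N c w (Suc n))) \<le> norm (P (w n - ?r (Suc n)))"
    using nPD[of "w n - ?r (Suc n)"] by (simp add: lstep_P)
  also have "\<dots> \<le> norm (P (w n)) + norm (P (?r (Suc n)))"
    unfolding linear_diff[OF linP] by (rule norm_triangle_ineq4)
  finally show "norm (P (lstep N c w (Suc n))) \<le> norm (P (w n)) + \<epsilon> * norm (w (Suc n))"
    using nP[of "?r (Suc n)"] norm_R_derivative[of "it N (Suc n) c" "w (Suc n)"] by linarith
  have "norm (Q (lstep N c w n)) \<le> norm (Q (D (w (Suc n)))) + norm (Q (?r (Suc n)))"
    unfolding lstep_Q linear_add[OF linQ] by (rule norm_triangle_ineq)
  then show "norm (Q (lstep N c w n)) \<le> \<kappa> * norm (Q (w (Suc n))) + \<epsilon> * norm (w (Suc n))"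
    using nQD[of "w (Suc n)"] nQ'[of "?r (Suc n)"] norm_R_derivative[of "it N (Suc n) c" "w (Suc n)"] by linarith
qed

text \<open>As the derivative of \<open>R\<close> is bounded by \<epsilon> everywhere, the linear
  recursion contracts with the same factor \<theta> as the Picard iteration, wherever its
  coefficients are evaluated. This makes the bound uniform in \<open>N\<close>.\<close>

lemma lstep_recursion_bound:
  assumes rec: "\<And>N n c. w (Suc N) n c = lstep N c (\<lambda>m. w N m c) n + b N n c"
    and w0: "\<And>n c. norm (w 0 n c) \<le> C * \<sigma> ^ (e * n)" and b: "\<And>N n c. norm (b N n c) \<le> B * \<sigma> ^ (e * n)"
    and e: "1 \<le> e" "e \<le> orbit_rate k"
  shows "\<exists>K. \<forall>N n c. norm (w N n c) \<le> K * \<sigma> ^ (e * n)"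
proof -
  \<comment> \<open>The least constant that dominates the initial value and satisfies
    \<open>\<theta> * K + B \<le> K\<close>.\<close>
  define K where "K = max C (B / (1 - \<theta>))"
  have B0: "B \<ge> 0" using order_trans[OF norm_ge_zero b[of 0 0 undefined]] by simp
  have "B / (1 - \<theta>) \<le> K" unfolding K_def by simp
  then have K: "\<theta> * K + B \<le> K" using \<theta> by (simp add: pos_divide_le_eq algebra_simps)
  have BK: "B \<le> K" and K0: "0 \<le> K"
  proof -
    have "B \<le> B / (1 - \<theta>)" using B0 \<theta> by (simp add: pos_le_divide_eq mult_left_le)
    then show "B \<le> K" unfolding K_def by simp
    then show "0 \<le> K" using B0 by simp
  qed
  have nb: "norm (P (b N n c)) \<le> B * \<sigma> ^ (e * n)" "norm (Q (b N n c)) \<le> B * \<sigma> ^ (e * n)" for N n c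
    using nP nQ' b order_trans by blast+
  have "nm (w N n c) \<le> K * \<sigma> ^ (e * n)" for N n c
  proof (induction N arbitrary: n)
    case 0
    have "nm (w 0 n c) \<le> C * \<sigma> ^ (e * n)" using nm_le w0 order_trans by blast
    also have "\<dots> \<le> K * \<sigma> ^ (e * n)" unfolding K_def using \<sigma>0 by (intro mult_right_mono) auto
    finally show ?case .
  next
    case (Suc N)
    show ?case
    proof (rule weighted_contraction[OF e Suc.IH _ _ _ K, where d' = "\<lambda>n. w (Suc N) n c"])
      show "norm (P (w (Suc N) 0 c)) \<le> K"
        using nb(1)[of N 0 c] BK by (simp add: rec linear_add[OF linP] lstep_bounds(1))
      show "norm (P (w (Suc N) (Suc n) c)) \<le> norm (P (w N n c)) + \<epsilon> * norm (w N (Suc n) c) + B * \<sigma> ^ (e * Suc n)" for n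
        unfolding rec linear_add[OF linP]
        using norm_triangle_le[OF add_mono[OF lstep_bounds(2) nb(1)]] .
      show "norm (Q (w (Suc N) n c)) \<le> \<kappa> * norm (Q (w N (Suc n) c)) + \<epsilon> * norm (w N (Suc n) c) + B * \<sigma> ^ (e * n)" for n
        unfolding rec linear_add[OF linQ]
        using norm_triangle_le[OF add_mono[OF lstep_bounds(3) nb(2)]] .
    qed
  qed
  then have "norm (w N n c) \<le> (2 * K) * \<sigma> ^ (e * n)" for N n c
    using norm_le_nm[of "w N n c"] by (simp add: mult.assoc order_trans[OF _ mult_left_mono[of _ _ "2::real"]])
  then show ?thesis by blast
qed

lemma lstep_recursion_geom_bounded:
  assumes rec: "\<And>N n c. w (Suc N) n c = lstep N c (\<lambda>m. w N m c) n + b N n c"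
    and w0: "geom_bounded \<sigma> e j (\<lambda>N. w 0)" and b: "geom_bounded \<sigma> e j b"
    and A: "\<And>v. v \<in> Basis \<Longrightarrow> geom_bounded \<sigma> s j (\<lambda>N n c. frechet_derivative R (at (it N n c)) v)"
    and e: "1 \<le> e" "e + linear_rate j * s \<le> orbit_rate k"
  shows "geom_bounded \<sigma> (e + linear_rate j * s) j w"
  using rec w0 b A e
proof (induction j arbitrary: w b e)
  case 0
  obtain C where C: "\<And>N n c. norm (w 0 n c) \<le> C * \<sigma> ^ (e * n)" using geom_bounded_bound[OF 0(2)] by blast
  obtain B where B: "\<And>N n c. norm (b N n c) \<le> B * \<sigma> ^ (e * n)" using geom_bounded_bound[OF 0(3)] by blast
  show ?case using lstep_recursion_bound[where w = w and b = b, OF 0(1) C B] 0(5,6) by simp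
next
  case (Suc j)
  let ?A = "\<lambda>v N n c. frechet_derivative R (at (it N n c)) v"
  \<comment> \<open>The differentiated coefficients have rate \<open>s\<close> and the solution has
    rate \<open>e + linear_rate j * s\<close> by induction; \<open>e2\<close> is the rate of their
    product. Solving the differentiated recursion with this inhomogeneity adds another
    \<open>linear_rate j * s\<close>, hence the doubling in \<open>linear_rate\<close>.\<close>
  define e2 where "e2 = e + linear_rate j * s + s"
  have e2: "1 \<le> e2" "e \<le> e2" "e + linear_rate j * s \<le> e2" "e2 + linear_rate j * s = e + linear_rate (Suc j) * s" "e2 \<le> orbit_rate k" "e + linear_rate j * s \<le> orbit_rate k"
    using Suc.prems(5,6) unfolding e2_def by (auto simp: algebra_simps)
  have Aj: "geom_bounded \<sigma> s j (?A v)" if "v \<in> Basis" for v using geom_bounded_order_Suc[OF Suc.prems(4)[OF that]] .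
  have wj: "geom_bounded \<sigma> (e + linear_rate j * s) j w"
    by (rule Suc.IH[OF Suc.prems(1) geom_bounded_order_Suc[OF Suc.prems(2)] geom_bounded_order_Suc[OF Suc.prems(3)] Aj Suc.prems(5) e2(6)])
  have linR: "linear (frechet_derivative R (at z))" for z using has_derivative_linear[OF R_derivative] .
  \<comment> \<open>\<open>E\<close> differentiates the coefficients while \<open>w\<close> is held
    fixed. In \<open>b'\<close> it enters the centre part with a minus sign and through
    \<open>D\<close>, and the stable part with index \<open>Suc n\<close>, just as \<open>R\<close>
    does in \<open>step\<close>.\<close>
  define E where "E = (\<lambda>u N n c. \<Sum>v\<in>Basis. (w N n c \<bullet> v) *\<^sub>R frechet_derivative (?A v N n) (at c) u)"
  define b' where "b' = (\<lambda>u N n c. P (if n = 0 then 0 else - D (E u N n c)) + Q (E u N (Suc n) c) + frechet_derivative (b N n) (at c) u)"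
  have hdA: "((\<lambda>c. frechet_derivative R (at (it N n c)) (w N n c)) has_derivative
     (\<lambda>u. frechet_derivative R (at (it N n c)) (w' u) + E u N n c)) (at c)"
    if w': "(w N n has_derivative w') (at c)" for N n c w'
  proof -
    have "((\<lambda>c. \<Sum>v\<in>Basis. (w N n c \<bullet> v) *\<^sub>R ?A v N n c) has_derivative
       (\<lambda>u. \<Sum>v\<in>Basis. (w N n c \<bullet> v) *\<^sub>R frechet_derivative (?A v N n) (at c) u + (w' u \<bullet> v) *\<^sub>R ?A v N n c)) (at c)"
      by (intro has_derivative_sum has_derivative_scaleR has_derivative_inner_left w' geom_bounded_has_derivative[OF Suc.prems(4)])
    then show ?thesis
      unfolding E_def sum.distrib linear_Basis_expansion[OF linR, symmetric] by (simp only: add.commute)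
  qed
  have step: "(w (Suc N) n has_derivative (\<lambda>u. lstep N c (\<lambda>m. w' m u) n + b' u N n c)) (at c)"
    if w': "\<And>m. (w N m has_derivative w' m) (at c)" for N n c w'
  proof -
    have "((\<lambda>c. P (if n = 0 then 0 else D (w N (n - 1) c - frechet_derivative R (at (it N n c)) (w N n c))))
      has_derivative (\<lambda>u. P (if n = 0 then 0 else D (w' (n - 1) u - (frechet_derivative R (at (it N n c)) (w' n u) + E u N n c))))) (at c)"
      by (cases "n = 0") (auto intro!: bounded_linear.has_derivative[OF blP] bounded_linear.has_derivative[OF blD]
        has_derivative_diff w' hdA simp: linear_0[OF linP])
    moreover have "((\<lambda>c. Q (D (w N (Suc n) c) + frechet_derivative R (at (it N (Suc n) c)) (w N (Suc n) c))) has_derivative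
      (\<lambda>u. Q (D (w' (Suc n) u) + (frechet_derivative R (at (it N (Suc n) c)) (w' (Suc n) u) + E u N (Suc n) c)))) (at c)"
      by (intro bounded_linear.has_derivative[OF blQ] bounded_linear.has_derivative[OF blD] has_derivative_add w' hdA)
    moreover have weq: "w (Suc N) n = (\<lambda>c. P (if n = 0 then 0 else D (w N (n - 1) c - frechet_derivative R (at (it N n c)) (w N n c)))
        + Q (D (w N (Suc n) c) + frechet_derivative R (at (it N (Suc n) c)) (w N (Suc n) c)) + b N n c)"
      using Suc.prems(1)[of N n] unfolding lstep_def by blast
    ultimately have "(w (Suc N) n has_derivative (\<lambda>u. 
       P (if n = 0 then 0 else D (w' (n - 1) u - (frechet_derivative R (at (it N n c)) (w' n u) + E u N n c)))
       + Q (D (w' (Suc n) u) + (frechet_derivative R (at (it N (Suc n) c)) (w' (Suc n) u) + E u N (Suc n) c))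
       + frechet_derivative (b N n) (at c) u)) (at c)"
      unfolding weq by (intro has_derivative_add geom_bounded_has_derivative[OF Suc.prems(3)])
    moreover have "(\<lambda>u. 
       P (if n = 0 then 0 else D (w' (n - 1) u - (frechet_derivative R (at (it N n c)) (w' n u) + E u N n c)))
       + Q (D (w' (Suc n) u) + (frechet_derivative R (at (it N (Suc n) c)) (w' (Suc n) u) + E u N (Suc n) c))
       + frechet_derivative (b N n) (at c) u) = (\<lambda>u. lstep N c (\<lambda>m. w' m u) n + b' u N n c)"
      unfolding lstep_def b'_def
      by (cases "n = 0") (auto simp: linear_add[OF linP] linear_add[OF linQ] linear_diff[OF linP] linear_diff[OF linD]
         linear_add[OF linD] linear_neg[OF linP] linear_0[OF linP] fun_eq_iff)
    ultimately show ?thesis by simp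
  qed
  \<comment> \<open>Differentiability of \<open>w N n\<close> is not among the assumptions for
    \<open>N > 0\<close>; the recursion passes it from one iteration to the next.\<close>
  have wd: "w N n differentiable (at c)" for N n c
  proof (induction N arbitrary: n)
    case 0
    then show ?case using Suc.prems(2) by simp
  next
    case (Suc N)
    then show ?case using step[of N "\<lambda>m. frechet_derivative (w N m) (at c)" c n]
      differentiable_has_derivative differentiable_def by blast
  qed
  show ?case
  proof (rule geom_bounded_SucI)
    have "e + linear_rate j * s \<le> e + linear_rate (Suc j) * s" by simp
    then show "\<exists>C. \<forall>N n c. norm (w N n c) \<le> C * \<sigma> ^ ((e + linear_rate (Suc j) * s) * n)"
      by (rule geom_bounded_bound[OF geom_bounded_rate_mono[OF \<sigma>ge1 _ wj]])
    show "(w N n has_derivative frechet_derivative (w N n) (at c)) (at c)" for N n c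
      by (rule differentiable_has_derivative[OF wd])
    fix u
    have EG: "geom_bounded \<sigma> e2 j (E u)"
      unfolding E_def e2_def
      by (intro geom_bounded_sum geom_bounded_bilinear[OF bounded_bilinear_scaleR \<sigma>0] geom_bounded_linear[OF bounded_linear_inner_left wj \<sigma>0] geom_bounded_frechet Suc.prems(4))
    have nD: "bounded_linear (\<lambda>x. - D x)" by (rule bounded_linear_minus[OF blD])
    have b'G: "geom_bounded \<sigma> e2 j (b' u)"
      unfolding b'_def
      by (intro geom_bounded_add geom_bounded_linear[OF blP _ \<sigma>0] geom_bounded_guard[OF _ \<sigma>0] geom_bounded_linear[OF nD EG \<sigma>0] geom_bounded_linear[OF blQ geom_bounded_shift[OF EG] \<sigma>0]
        geom_bounded_rate_mono[OF \<sigma>ge1 e2(2)] geom_bounded_frechet[OF Suc.prems(3)])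
    have "geom_bounded \<sigma> (e2 + linear_rate j * s) j (\<lambda>N n c. frechet_derivative (w N n) (at c) u)"
    proof (rule Suc.IH[OF _ _ b'G Aj e2(1)])
      show "frechet_derivative (w (Suc N) n) (at c) u = lstep N c (\<lambda>m. frechet_derivative (w N m) (at c) u) n + b' u N n c" for N n c
        using frechet_derivative_eqI[OF step[OF differentiable_has_derivative[OF wd]]] by simp
      show "geom_bounded \<sigma> e2 j (\<lambda>N n c. frechet_derivative (w 0 n) (at c) u)"
        by (rule geom_bounded_rate_mono[OF \<sigma>ge1 e2(2) geom_bounded_frechet[OF Suc.prems(2)]])
      show "e2 + linear_rate j * s \<le> orbit_rate k" unfolding e2(4) by (rule Suc.prems(6))
    qed
    then show "geom_bounded \<sigma> (e + linear_rate (Suc j) * s) j (\<lambda>N n c. frechet_derivative (w N n) (at c) u)"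
      unfolding e2(4) .
  qed
qed

lemma it_has_derivative_step:
  assumes "\<And>m. (it N m has_derivative w' m) (at c)"
  shows "(it (Suc N) n has_derivative (\<lambda>u. lstep N c (\<lambda>m. w' m u) n + (if n = 0 then P u else 0))) (at c)"
proof -
  have hR: "((\<lambda>c. R (it N m c)) has_derivative (\<lambda>u. frechet_derivative R (at (it N m c)) (w' m u))) (at c)" for m
    by (rule has_derivative_compose[OF assms R_derivative])
  have "((\<lambda>c. P (if n = 0 then c else D (it N (n - 1) c - R (it N n c)))) has_derivative
     (\<lambda>u. P (if n = 0 then u else D (w' (n - 1) u - frechet_derivative R (at (it N n c)) (w' n u))))) (at c)"
    by (cases "n = 0") (auto intro!: bounded_linear.has_derivative[OF blP] bounded_linear.has_derivative[OF blD]
        has_derivative_diff assms hR)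
  moreover have "((\<lambda>c. Q (D (it N (Suc n) c) + R (it N (Suc n) c))) has_derivative
     (\<lambda>u. Q (D (w' (Suc n) u) + frechet_derivative R (at (it N (Suc n) c)) (w' (Suc n) u)))) (at c)"
    by (intro bounded_linear.has_derivative[OF blQ] bounded_linear.has_derivative[OF blD] has_derivative_add assms hR)
  ultimately have "(it (Suc N) n has_derivative
     (\<lambda>u. P (if n = 0 then u else D (w' (n - 1) u - frechet_derivative R (at (it N n c)) (w' n u)))
       + Q (D (w' (Suc n) u) + frechet_derivative R (at (it N (Suc n) c)) (w' (Suc n) u)))) (at c)"
    unfolding it.simps step_def by (rule has_derivative_add)
  moreover have "(\<lambda>u. P (if n = 0 then u else D (w' (n - 1) u - frechet_derivative R (at (it N n c)) (w' n u)))
       + Q (D (w' (Suc n) u) + frechet_derivative R (at (it N (Suc n) c)) (w' (Suc n) u)))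
     = (\<lambda>u. lstep N c (\<lambda>m. w' m u) n + (if n = 0 then P u else 0))"
    unfolding lstep_def by (auto simp: fun_eq_iff linear_0[OF linP])
  ultimately show ?thesis by simp
qed

lemma bl_Dn: "bounded_linear (\<lambda>c. (D ^^ n) (P c))"
proof (induction n)
  case (Suc n)
  then show ?case using bounded_linear_compose[OF blD Suc] by simp
qed (simp add: blP)

lemma it_differentiable: "it N n differentiable (at c)"
proof (induction N arbitrary: n)
  case 0
  then show ?case using bounded_linear_imp_has_derivative[OF bl_Dn] unfolding it.simps differentiable_def by blast
next
  case (Suc N)
  then show ?case using it_has_derivative_step[of N "\<lambda>m. frechet_derivative (it N m) (at c)" c n]
    differentiable_has_derivative differentiable_def by blast
qed

text \<open>The coefficients of the variational equation are derivatives of \<open>R\<close>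
  composed with the iterates. To bound them to order \<open>Suc j\<close>, the chain rule needs the
  first derivative of the iterates only to order \<open>j\<close>, which the induction hypothesis
  provides.\<close>

lemma it_geom_bounded: "j \<le> k \<Longrightarrow> geom_bounded \<sigma> (orbit_rate j) j (\<lambda>N n c. frechet_derivative (it N n) (at c) v)"
proof (induction j arbitrary: v)
  have rec: "frechet_derivative (it (Suc N) n) (at c) v = lstep N c (\<lambda>m. frechet_derivative (it N m) (at c) v) n + (if n = 0 then P v else 0)" for N n c v
    using frechet_derivative_eqI[OF it_has_derivative_step[OF differentiable_has_derivative[OF it_differentiable]]] by simp
  have w0: "geom_bounded \<sigma> 1 j (\<lambda>N n c. frechet_derivative (it 0 n) (at c) v)" for j v
  proof -
    have eq: "frechet_derivative (it 0 n) (at c) v = (D ^^ n) (P v)" for n c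
      unfolding it.simps frechet_derivative_eqI[OF bounded_linear_imp_has_derivative[OF bl_Dn]] ..
    have "norm ((D ^^ n) (P v)) \<le> norm v * \<sigma> ^ (1 * n)" for n
      using DnP(2)[of n v] nP[of v] mult_left_mono[OF one_le_power[OF \<sigma>ge1], of "norm v" n] by simp
    then show ?thesis unfolding eq by (intro geom_bounded_const_family) blast
  qed
  have b0: "geom_bounded \<sigma> 1 j (\<lambda>N n c. if n = 0 then P v else 0)" for j v
  proof -
    have "norm (if n = 0 then P v else 0) \<le> norm (P v) * \<sigma> ^ (1 * n)" for n using \<sigma>0 by simp
    then show ?thesis by (intro geom_bounded_const_family) blast
  qed
  {
    case 0
    have "geom_bounded \<sigma> (1 + linear_rate 0 * 0) 0 (\<lambda>N n c. frechet_derivative (it N n) (at c) v)"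
    proof (rule lstep_recursion_geom_bounded[OF rec w0 b0])
      fix v
      have "geom_bounded \<sigma> 0 0 (\<lambda>N n c. frechet_derivative R (at c) v)"
        using geom_bounded_order_mono[OF geom_bounded_frechet[OF GR], of 0] by simp
      from geom_bounded_compose[OF \<sigma>ge1 this it_differentiable, of 0]
      show "geom_bounded \<sigma> 0 0 (\<lambda>N n c. frechet_derivative R (at (it N n c)) v)" by simp
    qed (use orbit_rate_pos in auto)
    then show ?case by simp
  next
    case (Suc j)
    have "geom_bounded \<sigma> (1 + linear_rate (Suc j) * (Suc j * orbit_rate j)) (Suc j) (\<lambda>N n c. frechet_derivative (it N n) (at c) v)"
    proof (rule lstep_recursion_geom_bounded[OF rec w0 b0])
      fix v
      have "geom_bounded \<sigma> 0 (Suc j) (\<lambda>N n c. frechet_derivative R (at c) v)"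
        by (rule geom_bounded_order_mono[OF geom_bounded_frechet[OF GR] Suc.prems])
      then show "geom_bounded \<sigma> (Suc j * orbit_rate j) (Suc j) (\<lambda>N n c. frechet_derivative R (at (it N n c)) v)"
        by (rule geom_bounded_compose[OF \<sigma>ge1 _ it_differentiable]) (use Suc in \<open>auto intro: geom_bounded_order_mono simp: less_Suc_eq_le simp del: geom_bounded.simps\<close>)
    qed (use orbit_rate_mono[OF Suc.prems] in auto)
    then show ?case by simp
  }
qed

theorem H_Ck: "Ck_on k H UNIV"
proof (rule Ck_on_uniform_limit)
  show "it N 0 differentiable at c" for N c by (rule it_differentiable)
  show "geom_bounded 1 0 k (\<lambda>N n c. frechet_derivative (it N 0) (at c) v)" for v
    using geom_bounded_slice[OF it_geom_bounded[of k v]] by simp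
  show "uniformly_Cauchy_on UNIV (\<lambda>N. it N 0)" by (rule it_uniformly_Cauchy)
  show "(\<lambda>N. it N 0 c) \<longlonglongrightarrow> H c" for c unfolding H_def by (rule Z_lim)
qed

text \<open>The error \<open>d\<close> lies in the range of \<open>Q\<close>; the invariance of the tangent space reproduces it up to the
  sign \<open>s\<close>, while \<open>D + R\<close> contracts it.\<close>

lemma H_tangent:
  assumes z: "D z + R z = z" and H': "(H has_derivative H') (at z)"
    and s: "\<bar>s\<bar> = 1" "D e + frechet_derivative R (at z) e = s *\<^sub>R e"
  shows "H' e = e"
proof -
  define F where "F = (\<lambda>z. D z + R z)"
  define F' where "F' = (\<lambda>v. D v + frechet_derivative R (at z) v)"
  have F': "(F has_derivative F') (at z)"
    unfolding F_def F'_def by (intro has_derivative_add bounded_linear_imp_has_derivative[OF blD] R_derivative)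
  have linH: "linear H'" and linF: "linear F'" using H' F' has_derivative_linear by auto
  have Hz: "H z = z" by (rule H_fixed[OF z])
  have HH: "H (H c) = H c" for c
    using H_P[of "H c"] H_P[of c] by (simp add: P_H)
  have Fz: "F z = z" unfolding F_def by (rule z)
  have FH: "((\<lambda>c. F (H c)) has_derivative (\<lambda>v. F' (H' v))) (at z)"
    by (rule has_derivative_compose[OF H']) (simp add: Hz F')
  have "((\<lambda>c. H (F (H c))) has_derivative (\<lambda>v. H' (F' (H' v)))) (at z)"
    by (rule has_derivative_compose[OF FH]) (simp add: Hz Fz H')
  \<comment> \<open>Every \<open>H c\<close> lies on the invariant manifold, so the identity holds
    for all \<open>c\<close> and may be differentiated at \<open>z\<close>.\<close>
  moreover have "(\<lambda>c. H (F (H c))) = (\<lambda>c. F (H c))"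
    unfolding F_def using H_invariant[OF HH] by auto
  ultimately have inv: "H' (F' (H' v)) = F' (H' v)" for v
    using has_derivative_unique[OF FH] by metis
  have "((\<lambda>c. P (H c)) has_derivative (\<lambda>v. P (H' v))) (at z)"
    by (rule bounded_linear.has_derivative[OF blP H'])
  then have PH: "P (H' v) = P v" for v
    using has_derivative_unique[OF _ bounded_linear_imp_has_derivative[OF blP, of "at z"]] unfolding P_H by metis
  define d where "d = H' e - e"
  have Pd: "P d = 0" unfolding d_def by (simp add: linear_diff[OF linP] PH)
  have Qd: "Q d = d" using P_plus_Q[of d] Pd by simp
  have Fe: "F' e = s *\<^sub>R e" unfolding F'_def by (rule s(2))
  have Fd: "F' d = F' (H' e) - s *\<^sub>R e" unfolding d_def by (simp add: linear_diff[OF linF] Fe)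
  have HFd: "H' (F' d) = F' (H' e) - s *\<^sub>R H' e"
    unfolding Fd by (simp add: linear_diff[OF linH] linear_scale[OF linH] inv)
  have "s *\<^sub>R d = F' d - H' (F' d)"
    by (subst HFd, subst Fd) (simp add: d_def scaleR_diff_right)
  then have sd: "s *\<^sub>R d = Q (F' d) - Q (H' (F' d))"
    using Qd by (metis linear_diff linear_scale linQ)
  have H'bound: "norm (Q (H' v)) \<le> norm v" for v
  proof (rule has_derivative_norm_bound[where B = 1, simplified])
    show "((\<lambda>c. Q (H c)) has_derivative (\<lambda>v. Q (H' v))) (at z)"
      by (rule bounded_linear.has_derivative[OF blQ H'])
    show "norm (Q (H x) - Q (H y)) \<le> norm (x - y)" for x y
      using H_lipschitz[of x y] unfolding nm_def by (simp add: linear_diff[OF linQ])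
  qed
  have HQ: "H' v = H' (P v)" for v
  proof -
    have "((\<lambda>c. z + Q c) has_derivative Q) (at 0)"
      using has_derivative_add[OF has_derivative_const[of z] bounded_linear_imp_has_derivative[OF blQ, of "at 0"]] by simp
    then have "((\<lambda>c. H (z + Q c)) has_derivative (\<lambda>v. H' (Q v))) (at 0)"
      by (rule has_derivative_compose) (simp add: linear_0[OF linQ] H')
    moreover have "(\<lambda>c. H (z + Q c)) = (\<lambda>c. H z)"
    proof
      fix c show "H (z + Q c) = H z"
        using H_P[of "z + Q c"] H_P[of z] by (simp add: linear_add[OF linP] PQ)
    qed
    ultimately have "H' (Q v) = 0"
      using has_derivative_unique[OF _ has_derivative_const] by metis
    then show ?thesis using P_plus_Q[of v] linear_add[OF linH, of "P v" "Q v"] by simp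
  qed
  have DPd: "D d = Q (D d)" using DQ[of d] Qd by simp
  have PF: "P (F' d) = P (frechet_derivative R (at z) d)"
    unfolding F'_def using DPd PQ by (metis add_0_left linP linear_add)
  have "norm d \<le> norm (Q (F' d)) + norm (Q (H' (P (F' d))))"
  proof -
    have "norm d = norm (s *\<^sub>R d)" using s(1) by simp
    also have "\<dots> \<le> norm (Q (F' d)) + norm (Q (H' (F' d)))" unfolding sd by (rule norm_triangle_ineq4)
    finally show ?thesis using HQ[of "F' d"] by simp
  qed
  moreover have "norm (Q (H' (P (F' d)))) \<le> \<epsilon> * norm d"
    using H'bound[of "P (F' d)"] PF nP[of "frechet_derivative R (at z) d"] norm_R_derivative[of z d] by simp
  moreover have "norm (Q (F' d)) \<le> (\<kappa> + \<epsilon>) * norm d"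
  proof -
    have "norm (Q (F' d)) \<le> norm (Q (D d)) + norm (Q (frechet_derivative R (at z) d))"
      unfolding F'_def linear_add[OF linQ] by (rule norm_triangle_ineq)
    then show ?thesis
      using nQD[of d] nQ'[of "frechet_derivative R (at z) d"] norm_R_derivative[of z d] Qd by (simp add: distrib_right)
  qed
  ultimately have "norm d \<le> (\<kappa> + 2 * \<epsilon>) * norm d" by (simp add: algebra_simps)
  moreover have "\<kappa> + 2 * \<epsilon> \<le> \<theta>"
  proof -
    have "(\<kappa> + 2 * \<epsilon>) * 1 \<le> (\<kappa> + 2 * \<epsilon>) * \<sigma> ^ orbit_rate k"
      using \<kappa>0 \<epsilon>0 one_le_power[OF \<sigma>ge1] by (intro mult_left_mono) auto
    then show ?thesis using gap_stable by simp
  qed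
  ultimately have "norm d \<le> \<theta> * norm d" using mult_right_mono[of "\<kappa> + 2 * \<epsilon>" \<theta> "norm d"] by simp
  then have "(1 - \<theta>) * norm d \<le> 0" by (simp add: algebra_simps)
  then have "norm d = 0" using \<theta> by (simp add: mult_le_0_iff)
  then show ?thesis unfolding d_def by simp
qed

end

section \<open>Local centre manifolds\<close>

text \<open>A plateau function of finite class suffices, and powers of the positive part supply it
  by an elementary induction: the derivative of one power is a multiple of the next lower
  one.\<close>

lemma Ck_on_positive_part_power: "Ck_on r (\<lambda>t::real. max 0 t ^ Suc r) UNIV"
proof (induction r)
  case 0
  then show ?case by (auto intro!: continuous_intros)
next
  case (Suc r)
  have eq: "max 0 t ^ Suc (Suc r) = t *\<^sub>R max 0 t ^ Suc r" for t :: real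
    by (cases "t \<ge> 0") (auto simp: max_def)
  have "((\<lambda>t::real. max 0 t ^ Suc (Suc r)) has_derivative (\<lambda>v. (real (Suc (Suc r)) * v) *\<^sub>R max 0 t ^ Suc r)) (at t)" for t
  proof (cases "t = 0")
    case True
    have "isCont (\<lambda>t::real. max 0 t ^ Suc r) 0" by (intro continuous_intros)
    from has_derivative_scaleR_vanishing[OF has_derivative_ident _ this]
    show ?thesis unfolding eq True by simp
  next
    case False
    then consider "t > 0" | "t < 0" by linarith
    then show ?thesis
    proof cases
      case 1
      have "((\<lambda>t::real. t ^ Suc (Suc r)) has_derivative (\<lambda>v. (real (Suc (Suc r)) * v) *\<^sub>R max 0 t ^ Suc r)) (at t)"
        using has_derivative_power[OF has_derivative_ident, where n = "Suc (Suc r)" and x = t and S = UNIV] 1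
        by (simp add: max_def mult_ac del: of_nat_Suc power_Suc)
      then show ?thesis
        by (rule has_derivative_transform_within_open[of _ _ _ _ "{0<..}"]) (use 1 in \<open>auto simp: max_def\<close>)
    next
      case 2
      have "((\<lambda>t::real. 0) has_derivative (\<lambda>v. (real (Suc (Suc r)) * v) *\<^sub>R max 0 t ^ Suc r)) (at t)"
        using 2 by (simp add: max_def)
      then show ?thesis
        by (rule has_derivative_transform_within_open[of _ _ _ _ "{..<0}"]) (use 2 in \<open>auto simp: max_def\<close>)
    qed
  qed
  then show ?case
    by (rule Ck_on_SucI[OF open_UNIV]) (intro Ck_on_scaleR Ck_on_const open_UNIV Suc)
qed

lemma plateau_function:
  obtains \<omega> :: "real \<Rightarrow> real" where "Ck_on r \<omega> UNIV" "\<And>t. t \<le> 1 \<Longrightarrow> \<omega> t = 1" "\<And>t. t \<ge> 2 \<Longrightarrow> \<omega> t = 0"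
    "\<And>t. 0 \<le> \<omega> t" "\<And>t. \<omega> t \<le> 1"
proof
  let ?p = "\<lambda>t::real. max 0 t ^ Suc r"
  have C1: "Ck_on r (\<lambda>t. ?p (2 - t)) UNIV"
    by (rule Ck_on_compose[OF open_UNIV open_UNIV subset_UNIV Ck_on_positive_part_power])
      (intro Ck_on_diff Ck_on_const Ck_on_ident open_UNIV)
  have C2: "Ck_on r (\<lambda>t. ?p (t - 1)) UNIV"
    by (rule Ck_on_compose[OF open_UNIV open_UNIV subset_UNIV Ck_on_positive_part_power])
      (intro Ck_on_diff Ck_on_const Ck_on_ident open_UNIV)
  have nz: "?p (2 - t) + ?p (t - 1) > 0" for t
  proof (cases "t < 2")
    case True
    then have "?p (2 - t) > 0" by simp
    moreover have "?p (t - 1) \<ge> 0" by simp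
    ultimately show ?thesis by linarith
  next
    case False
    then have "?p (t - 1) > 0" by simp
    moreover have "?p (2 - t) \<ge> 0" by simp
    ultimately show ?thesis by linarith
  qed
  let ?\<omega> = "\<lambda>t. ?p (2 - t) / (?p (2 - t) + ?p (t - 1))"
  show "Ck_on r ?\<omega> UNIV"
    by (intro Ck_on_divide Ck_on_add C1 C2 open_UNIV) (use nz in \<open>metis less_irrefl\<close>)
  show "?\<omega> t = 1" if "t \<le> 1" for t using that by (simp add: max_def)
  show "?\<omega> t = 0" if "t \<ge> 2" for t using that by (simp add: max_def)
  show "0 \<le> ?\<omega> t" for t using nz[of t] by (intro divide_nonneg_pos) auto
  show "?\<omega> t \<le> 1" for t using nz[of t] by (subst divide_le_eq_1_pos) auto
qed

lemma has_derivative_const_on_open: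
  assumes "open S" "x \<in> S" "\<And>y. y \<in> S \<Longrightarrow> h y = c"
  shows "(h has_derivative (\<lambda>v. 0)) (at x)"
  by (rule has_derivative_transform_within_open[OF has_derivative_const assms(1,2)]) (simp add: assms(3))

lemma compact_support_geom_bounded:
  fixes h :: "'a::euclidean_space \<Rightarrow> 'b::euclidean_space"
  assumes "Ck_on j h UNIV" "\<And>z. \<rho> < norm z \<Longrightarrow> h z = 0"
  shows "geom_bounded \<sigma> 0 j (\<lambda>N n. h)"
  using assms
proof (induction j arbitrary: h)
  have *: "\<exists>C. \<forall>z. norm (h z) \<le> C" if h: "Ck_on j h UNIV" "\<And>z. \<rho> < norm z \<Longrightarrow> h z = 0" for j and h :: "'a \<Rightarrow> 'b"
  proof -
    have "continuous_on (cball 0 \<rho>) h" using Ck_on_continuous[OF h(1)] continuous_on_subset by blast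
    then have "bounded (h ` cball 0 \<rho>)" using compact_continuous_image compact_cball compact_imp_bounded by blast
    then obtain C where C: "C > 0" "\<And>z. z \<in> cball 0 \<rho> \<Longrightarrow> norm (h z) \<le> C" unfolding bounded_pos by auto
    have "norm (h z) \<le> C" for z
      using C h(2)[of z] by (cases "norm z \<le> \<rho>") auto
    then show ?thesis by blast
  qed
  {
    case 0
    then show ?case using *[of 0 h] by auto
  next
    case (Suc j)
    have "frechet_derivative h (at z) v = 0" if "\<rho> < norm z" for z v
    proof -
      have "open {z::'a. \<rho> < norm z}" by (intro open_Collect_less continuous_intros)
      then show ?thesis
        using frechet_derivative_eqI[OF has_derivative_const_on_open[of "{z. \<rho> < norm z}" z h 0]] that Suc.prems(2) by simp
    qed
    then have "geom_bounded \<sigma> 0 j (\<lambda>N n c. frechet_derivative h (at c) v)" for v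
      by (intro Suc.IH Ck_on_frechet[OF Suc.prems(1)])
    then show ?case using *[OF Suc.prems] Suc.prems(1) by auto
  }
qed

text \<open>Cutting off at scale \<delta> costs a factor of order \<open>1 / \<delta>\<close> in the
  derivative, but \<open>R0\<close> is small compared with \<open>norm z\<close> near 0, because its
  derivative vanishes there; the product stays below \<epsilon>.\<close>

lemma cutoff_perturbation:
  fixes R0 :: "'a::euclidean_space \<Rightarrow> 'b::euclidean_space"
  assumes R0: "Ck_on (Suc r) R0 UNIV" "R0 0 = 0" "\<And>v. frechet_derivative R0 (at 0) v = 0" and \<epsilon>: "\<epsilon> > 0"
  obtains R \<delta> \<rho> where "\<delta> > 0" "Ck_on (Suc r) R UNIV" "\<And>z. norm z < \<delta> \<Longrightarrow> R z = R0 z"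
    "\<And>z z'. norm (R z - R z') \<le> \<epsilon> * norm (z - z')" "\<And>z. \<rho> < norm z \<Longrightarrow> R z = 0"
proof -
  obtain \<omega> :: "real \<Rightarrow> real" where \<omega>: "Ck_on (Suc r) \<omega> UNIV" "\<And>t. t \<le> 1 \<Longrightarrow> \<omega> t = 1" "\<And>t. t \<ge> 2 \<Longrightarrow> \<omega> t = 0"
    "\<And>t. 0 \<le> \<omega> t" "\<And>t. \<omega> t \<le> 1" using plateau_function by blast
  have d\<omega>: "(\<omega> has_derivative frechet_derivative \<omega> (at t)) (at t)" for t using Ck_on_has_derivative[OF \<omega>(1)] by simp
  have "continuous_on {0..4} (\<lambda>t. frechet_derivative \<omega> (at t) 1)"
    using Ck_on_frechet_continuous[OF \<omega>(1)] continuous_on_subset by blast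
  then have "bounded ((\<lambda>t. frechet_derivative \<omega> (at t) 1) ` {0..4})"
    using compact_continuous_image compact_Icc compact_imp_bounded by blast
  then obtain C where C: "C > 0" "\<And>t. t \<in> {0..4} \<Longrightarrow> \<bar>frechet_derivative \<omega> (at t) 1\<bar> \<le> C" unfolding bounded_pos by auto
  have \<omega>lin: "frechet_derivative \<omega> (at t) v = v * frechet_derivative \<omega> (at t) 1" for t v
    using linear_scale[OF has_derivative_linear[OF d\<omega>], of t v 1] by simp
  \<comment> \<open>The two terms of the product rule contribute \<open>\<epsilon>0\<close> and
    \<open>8 * C * \<epsilon>0\<close>, which add up to \<epsilon>.\<close>
  define \<epsilon>0 where "\<epsilon>0 = \<epsilon> / (8 * C + 1)"
  have \<epsilon>0: "\<epsilon>0 > 0" "(8 * C + 1) * \<epsilon>0 = \<epsilon>" unfolding \<epsilon>0_def using \<epsilon> C(1) by auto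
  obtain d where d: "d > 0" "\<And>x v. x \<in> ball 0 d \<Longrightarrow> norm (frechet_derivative R0 (at x) v) \<le> \<epsilon>0 * norm v"
    using frechet_derivative_near[OF open_UNIV R0(1) UNIV_I \<epsilon>0(1), of 0] R0(3) by (metis diff_zero)
  \<comment> \<open>The cut-off is supported inside \<open>norm z < 2 * \<delta>\<close>, which has
    to lie in the ball where the derivative of \<open>R0\<close> is at most
    \<open>\<epsilon>0\<close>.\<close>
  define \<delta> where "\<delta> = d / 4"
  have \<delta>: "\<delta> > 0" "2 * \<delta> < d" unfolding \<delta>_def using d(1) by auto
  have dR0: "(R0 has_derivative frechet_derivative R0 (at z)) (at z)" for z using Ck_on_has_derivative[OF R0(1)] by simp
  have R0b: "norm (R0 z) \<le> \<epsilon>0 * norm z" if "z \<in> ball 0 d" for z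
  proof -
    have "norm (R0 z - R0 0) \<le> \<epsilon>0 * norm (z - 0)"
    proof (rule differentiable_bound[OF convex_ball])
      show "(R0 has_derivative frechet_derivative R0 (at x)) (at x within ball 0 d)" for x
        by (rule has_derivative_at_withinI[OF dR0])
      show "onorm (frechet_derivative R0 (at x)) \<le> \<epsilon>0" if "x \<in> ball 0 d" for x
        by (rule onorm_le[OF d(2)[OF that]])
    qed (use that d(1) in auto)
    then show ?thesis using R0(2) by simp
  qed
  \<comment> \<open>The squared norm keeps the cut-off differentiable at the origin;
    \<open>norm z < 2 * \<delta>\<close> means \<open>s z < 4\<close>, whence the interval on which
    \<open>C\<close> was chosen.\<close>
  define s where "s = (\<lambda>z::'a. (z \<bullet> z) / \<delta>\<^sup>2)"
  define R where "R = (\<lambda>z. \<omega> (s z) *\<^sub>R R0 z)"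
  have sC: "Ck_on (Suc r) s UNIV"
    unfolding s_def divide_inverse by (intro Ck_on_mult Ck_on_inner Ck_on_ident Ck_on_const open_UNIV)
  have RC: "Ck_on (Suc r) R UNIV"
    unfolding R_def by (intro Ck_on_scaleR R0 open_UNIV Ck_on_compose[OF open_UNIV open_UNIV subset_UNIV \<omega>(1) sC])
  have ds: "(s has_derivative (\<lambda>v. 2 * (z \<bullet> v) / \<delta>\<^sup>2)) (at z)" for z
    unfolding s_def divide_inverse by (auto intro!: derivative_eq_intros simp: inner_commute)
  define R' where "R' = (\<lambda>z v. \<omega> (s z) *\<^sub>R frechet_derivative R0 (at z) v + frechet_derivative \<omega> (at (s z)) (2 * (z \<bullet> v) / \<delta>\<^sup>2) *\<^sub>R R0 z)"
  have dR: "(R has_derivative R' z) (at z)" for z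
    unfolding R_def R'_def by (intro has_derivative_scaleR has_derivative_compose[OF ds d\<omega>] dR0)
  have far: "R z = 0" if "2 * \<delta>\<^sup>2 \<le> z \<bullet> z" for z
    unfolding R_def using \<omega>(3)[of "s z"] that \<delta>(1) by (simp add: s_def pos_le_divide_eq)
  have nz: "z \<bullet> z = (norm z)\<^sup>2" for z :: 'a by (simp add: power2_norm_eq_inner)
  have bound: "norm (R' z v) \<le> \<epsilon> * norm v" for z v
  proof (cases "norm z < 2 * \<delta>")
    case True
    have zd: "z \<in> ball 0 d" using True \<delta>(2) by simp
    have "(norm z)\<^sup>2 \<le> (2 * \<delta>)\<^sup>2" using True by (intro power_mono) auto
    then have "s z \<in> {0..4}" unfolding s_def nz using \<delta>(1) by (simp add: pos_divide_le_eq power_mult_distrib)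
    then have c: "\<bar>frechet_derivative \<omega> (at (s z)) 1\<bar> \<le> C" by (rule C(2))
    have "norm (\<omega> (s z) *\<^sub>R frechet_derivative R0 (at z) v) \<le> 1 * (\<epsilon>0 * norm v)"
      unfolding norm_scaleR using \<omega>(4,5)[of "s z"] d(2)[OF zd, of v] by (intro mult_mono) auto
    moreover have "norm (frechet_derivative \<omega> (at (s z)) (2 * (z \<bullet> v) / \<delta>\<^sup>2) *\<^sub>R R0 z) \<le> (4 * norm v / \<delta> * C) * (\<epsilon>0 * (2 * \<delta>))"
    proof -
      have "\<bar>2 * (z \<bullet> v) / \<delta>\<^sup>2\<bar> \<le> 2 * (2 * \<delta> * norm v) / \<delta>\<^sup>2"
        using order_trans[OF Cauchy_Schwarz_ineq2[of z v] mult_right_mono[of "norm z" "2 * \<delta>" "norm v"]] True \<delta>(1)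
        by (simp add: divide_right_mono abs_mult)
      also have "\<dots> = 4 * norm v / \<delta>" using \<delta>(1) by (simp add: power2_eq_square)
      finally have "\<bar>frechet_derivative \<omega> (at (s z)) (2 * (z \<bullet> v) / \<delta>\<^sup>2)\<bar> \<le> 4 * norm v / \<delta> * C"
        unfolding \<omega>lin[of "s z" "2 * (z \<bullet> v) / \<delta>\<^sup>2"] abs_mult using c \<delta>(1) by (intro mult_mono) auto
      moreover have "norm (R0 z) \<le> \<epsilon>0 * (2 * \<delta>)"
        by (rule order_trans[OF R0b[OF zd] mult_left_mono]) (use True \<epsilon>0(1) in auto)
      ultimately show ?thesis
        unfolding norm_scaleR using C(1) \<delta>(1) by (intro mult_mono) auto
    qed
    moreover have "(4 * norm v / \<delta> * C) * (\<epsilon>0 * (2 * \<delta>)) = 8 * C * \<epsilon>0 * norm v" using \<delta>(1) by simp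
    ultimately have "norm (R' z v) \<le> 1 * (\<epsilon>0 * norm v) + 8 * C * \<epsilon>0 * norm v"
      unfolding R'_def by (intro norm_triangle_le) linarith
    also have "\<dots> = ((8 * C + 1) * \<epsilon>0) * norm v" by (simp add: algebra_simps)
    finally show ?thesis unfolding \<epsilon>0(2) .
  next
    case False
    have "(2 * \<delta>)\<^sup>2 \<le> (norm z)\<^sup>2" using False \<delta>(1) by (intro power_mono) auto
    then have "4 * \<delta>\<^sup>2 \<le> z \<bullet> z" unfolding nz by (simp add: power_mult_distrib)
    then have "2 * \<delta>\<^sup>2 < z \<bullet> z" using zero_less_power[OF \<delta>(1), of 2] by linarith
    moreover have "open {z::'a. 2 * \<delta>\<^sup>2 < z \<bullet> z}" by (intro open_Collect_less continuous_intros)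
    ultimately have "(R has_derivative (\<lambda>v. 0)) (at z)"
      by (intro has_derivative_const_on_open[of "{z. 2 * \<delta>\<^sup>2 < z \<bullet> z}" z R 0]) (use far in auto)
    then have "R' z = (\<lambda>v. 0)" using has_derivative_unique[OF dR] by blast
    then show ?thesis using \<epsilon> by simp
  qed
  show ?thesis
  proof
    show "\<delta> > 0" by (rule \<delta>)
    show "Ck_on (Suc r) R UNIV" by (rule RC)
    show "R z = R0 z" if "norm z < \<delta>" for z
    proof -
      have "(norm z)\<^sup>2 \<le> \<delta>\<^sup>2" using that by (intro power_mono) auto
      then have "s z \<le> 1" unfolding s_def nz using \<delta>(1) by simp
      then show ?thesis unfolding R_def by (simp add: \<omega>(2))
    qed
    show "norm (R z - R z') \<le> \<epsilon> * norm (z - z')" for z z'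
      by (rule differentiable_bound[OF convex_UNIV, where f' = R']) (use dR in \<open>auto intro!: onorm_le bound\<close>)
    show "R z = 0" if "2 * \<delta> < norm z" for z
    proof (rule far)
      have "(2 * \<delta>)\<^sup>2 \<le> (norm z)\<^sup>2" using that \<delta>(1) by (intro power_mono) auto
      then have "4 * \<delta>\<^sup>2 \<le> z \<bullet> z" unfolding nz by (simp add: power_mult_distrib)
      then show "2 * \<delta>\<^sup>2 \<le> z \<bullet> z" using zero_le_power2[of \<delta>] by linarith
    qed
  qed
qed

text \<open>\<sigma> is chosen first, so close to 1 that \<open>\<kappa> * \<sigma> ^ E\<close> is
  still below 1; then \<epsilon> is made small against the two remaining gaps
  \<open>1 - 1 / \<sigma>\<close> and \<open>1 - \<kappa> * \<sigma> ^ E\<close>.\<close>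

lemma gap_constants:
  fixes \<kappa> :: real
  assumes "0 \<le> \<kappa>" "\<kappa> < 1"
  obtains \<sigma> \<epsilon> \<theta> where "1 < \<sigma>" "0 < \<epsilon>" "0 \<le> \<theta>" "\<theta> < 1" "1 / \<sigma> + 2 * \<epsilon> \<le> \<theta>" "(\<kappa> + 2 * \<epsilon>) * \<sigma> ^ E \<le> \<theta>"
proof -
  have "((\<lambda>s::real. \<kappa> * s ^ E) \<longlongrightarrow> \<kappa> * 1 ^ E) (at_right 1)" by (intro tendsto_intros)
  then have "\<forall>\<^sub>F s in at_right 1. \<kappa> * s ^ E < 1" by (rule order_tendstoD(2)) (use assms in simp)
  moreover have "\<forall>\<^sub>F s in at_right (1::real). 1 < s" by (rule eventually_at_right_less)
  ultimately have "\<forall>\<^sub>F s in at_right (1::real). \<kappa> * s ^ E < 1 \<and> 1 < s" by (rule eventually_conj)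
  then obtain \<sigma> :: real where \<sigma>: "\<kappa> * \<sigma> ^ E < 1" "1 < \<sigma>"
    using eventually_happens trivial_limit_at_right_real by blast
  define \<epsilon> where "\<epsilon> = min ((1 - 1 / \<sigma>) / 4) ((1 - \<kappa> * \<sigma> ^ E) / (4 * \<sigma> ^ E))"
  define \<theta> where "\<theta> = max (1 / \<sigma> + 2 * \<epsilon>) ((\<kappa> + 2 * \<epsilon>) * \<sigma> ^ E)"
  have p: "\<sigma> ^ E > 0" using \<sigma> by simp
  have e1: "1 / \<sigma> < 1" using \<sigma>(2) by simp
  have \<epsilon>: "0 < \<epsilon>" unfolding \<epsilon>_def using \<sigma> p e1 by (auto intro!: divide_pos_pos)
  have "\<epsilon> \<le> (1 - \<kappa> * \<sigma> ^ E) / (4 * \<sigma> ^ E)" unfolding \<epsilon>_def by (rule min.cobounded2)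
  then have "\<epsilon> * (4 * \<sigma> ^ E) \<le> 1 - \<kappa> * \<sigma> ^ E" using p by (simp add: pos_le_divide_eq)
  moreover have "0 < \<epsilon> * \<sigma> ^ E" using \<epsilon> p by simp
  ultimately have e2: "(\<kappa> + 2 * \<epsilon>) * \<sigma> ^ E < 1" using \<sigma>(1) by (simp add: algebra_simps)
  have "\<epsilon> \<le> (1 - 1 / \<sigma>) / 4" unfolding \<epsilon>_def by (rule min.cobounded1)
  then have e3: "1 / \<sigma> + 2 * \<epsilon> < 1"
    using e1 by (simp only: diff_divide_distrib) (simp add: algebra_simps)
  have "0 \<le> (\<kappa> + 2 * \<epsilon>) * \<sigma> ^ E" using assms(1) \<epsilon> p by simp
  then show ?thesis using that[OF \<sigma>(2) \<epsilon>, of \<theta>] e2 e3 unfolding \<theta>_def by simp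
qed

text \<open>On the ball of radius \<delta> the cut-off perturbation agrees with \<open>R0\<close>
  together with its derivative, so the properties of the global \<open>H\<close> hold for the
  original map there. The image of a point may leave the ball; it still lies on the global
  manifold.\<close>

theorem local_centre_manifold:
  fixes D P R0 :: "'a::euclidean_space \<Rightarrow> 'a"
  assumes lin: "linear D" "linear P"
    and P: "\<And>z. P (P z) = P z" "\<And>z. norm (P z) \<le> norm z" "\<And>z. norm (z - P z) \<le> norm z"
    and DP: "\<And>z. D (P z) = P (D z)" "\<And>z. D (D (P z)) = P z" "\<And>z. norm (D (P z)) \<le> norm (P z)"
    and DQ: "\<And>z. norm (D (z - P z)) \<le> \<kappa> * norm (z - P z)" "0 \<le> \<kappa>" "\<kappa> < 1"
    and R0: "Ck_on (Suc k) R0 UNIV" "R0 0 = 0" "\<And>v. frechet_derivative R0 (at 0) v = 0"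
    and k: "1 \<le> k"
  obtains H \<delta> where "0 < \<delta>" "Ck_on k H UNIV" "\<And>c. P (H c) = P c" "\<And>c. H (P c) = H c"
    "\<And>z. norm z < \<delta> \<Longrightarrow> H z = z \<Longrightarrow> H (D z + R0 z) = D z + R0 z"
    "\<And>z. norm z < \<delta> \<Longrightarrow> D z + R0 z = z \<Longrightarrow> H z = z"
    "\<And>z s e. norm z < \<delta> \<Longrightarrow> D z + R0 z = z \<Longrightarrow> \<bar>s\<bar> = 1 \<Longrightarrow> D e + frechet_derivative R0 (at z) e = s *\<^sub>R e \<Longrightarrow>
       frechet_derivative H (at z) e = e"
proof -
  obtain \<sigma> \<epsilon> \<theta> where c: "1 < \<sigma>" "0 < \<epsilon>" "0 \<le> \<theta>" "\<theta> < 1" "1 / \<sigma> + 2 * \<epsilon> \<le> \<theta>" "(\<kappa> + 2 * \<epsilon>) * \<sigma> ^ orbit_rate k \<le> \<theta>"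
    using gap_constants[OF DQ(2,3)] by blast
  obtain R \<delta> \<rho> where R: "\<delta> > 0" "Ck_on (Suc k) R UNIV" "\<And>z. norm z < \<delta> \<Longrightarrow> R z = R0 z"
    "\<And>z z'. norm (R z - R z') \<le> \<epsilon> * norm (z - z')" "\<And>z. \<rho> < norm z \<Longrightarrow> R z = 0"
    by (rule cutoff_perturbation[OF R0 c(2)]) (rule that; assumption)
  have GBR: "geom_bounded \<sigma> 0 (Suc k) (\<lambda>N n. R)" by (rule compact_support_geom_bounded[OF R(2)]) (rule R(5))
  interpret centre_perturbation D P R \<kappa> \<epsilon> \<sigma> \<theta> k
    by (rule centre_perturbation.intro[OF lin P DP DQ(1,2) GBR R(4) less_imp_le[OF c(2)] c(1,3-6)])
  have dR: "frechet_derivative R0 (at z) = frechet_derivative R (at z)" if "norm z < \<delta>" for z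
  proof -
    have "(R has_derivative frechet_derivative R (at z)) (at z)" using Ck_on_has_derivative[OF R(2)] by simp
    then have "(R0 has_derivative frechet_derivative R (at z)) (at z)"
      by (rule has_derivative_transform_within_open[OF _ open_ball[of 0 \<delta>]]) (use that R(3) in auto)
    then show ?thesis by (rule frechet_derivative_eqI)
  qed
  obtain k' where k': "k = Suc k'" using k by (cases k) auto
  show ?thesis
  proof
    show "0 < \<delta>" by (rule R)
    show "Ck_on k H UNIV" by (rule H_Ck)
    show "P (H c) = P c" "H (P c) = H c" for c by (rule P_H, rule H_P)
    show "H (D z + R0 z) = D z + R0 z" if "norm z < \<delta>" "H z = z" for z
      using H_invariant[OF that(2)] R(3)[OF that(1)] by simp
    show "H z = z" if "norm z < \<delta>" "D z + R0 z = z" for z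
      using H_fixed[of z] that R(3)[OF that(1)] by simp
    show "frechet_derivative H (at z) e = e" if "norm z < \<delta>" "D z + R0 z = z" "\<bar>s\<bar> = 1"
      "D e + frechet_derivative R0 (at z) e = s *\<^sub>R e" for z s e
    proof (rule H_tangent[OF _ _ that(3)])
      show "D z + R z = z" using that R(3)[OF that(1)] by simp
      show "(H has_derivative frechet_derivative H (at z)) (at z)"
        using Ck_on_has_derivative[OF H_Ck[unfolded k']] by simp
      show "D e + frechet_derivative R (at z) e = s *\<^sub>R e" using that(4) dR[OF that(1)] by simp
    qed
  qed
qed

section \<open>Symmetric operators\<close>

text \<open>A maximiser \<open>e\<close> of the quadratic form on the unit sphere of
  \<open>V\<close> is an eigenvector: moving from it in the direction of the defect
  \<open>A e - r *\<^sub>R e\<close> would improve the Rayleigh quotient to first order unless the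
  defect is 0.\<close>

lemma symmetric_max_eigenvector:
  fixes A :: "'a::euclidean_space \<Rightarrow> 'a"
  assumes lin: "linear A" and sym: "\<And>x y. A x \<bullet> y = x \<bullet> A y"
    and V: "subspace V" "V \<noteq> {0}" "A ` V \<subseteq> V"
  obtains e r where "e \<in> V" "norm e = 1" "A e = r *\<^sub>R e" "\<And>v. v \<in> V \<Longrightarrow> v \<bullet> A v \<le> r * (v \<bullet> v)"
proof -
  obtain x where x: "x \<in> V" "x \<noteq> 0" using V subspace_0 by blast
  have bl: "bounded_linear A" using lin by (simp add: linear_conv_bounded_linear)
  let ?S = "V \<inter> sphere 0 1"
  have "compact ?S" using closed_Int_compact[OF closed_subspace[OF V(1)] compact_sphere] .
  moreover have "x /\<^sub>R norm x \<in> ?S" using x V(1) by (simp add: subspace_scale)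
  moreover have "continuous_on ?S (\<lambda>v. v \<bullet> A v)"
    by (intro continuous_on_inner continuous_on_id linear_continuous_on bl)
  ultimately obtain e where e: "e \<in> ?S" "\<And>v. v \<in> ?S \<Longrightarrow> v \<bullet> A v \<le> e \<bullet> A e"
    using continuous_attains_sup[of ?S "\<lambda>v. v \<bullet> A v"] by blast
  define r where "r = e \<bullet> A e"
  have ee: "e \<bullet> e = 1" using e(1) by (simp add: norm_eq_1)
  have max: "v \<bullet> A v \<le> r * (v \<bullet> v)" if v: "v \<in> V" for v
  proof (cases "v = 0")
    case False
    let ?u = "v /\<^sub>R norm v"
    have "?u \<in> ?S" using v False V(1) by (simp add: subspace_scale)
    then have "?u \<bullet> A ?u \<le> r" using e(2) r_def by blast
    then have "(v \<bullet> A v) / (norm v)\<^sup>2 \<le> r"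
      by (simp add: linear_scale[OF lin] power2_eq_square divide_inverse mult_ac)
    then show ?thesis using False by (simp add: pos_divide_le_eq power2_norm_eq_inner)
  qed (simp add: linear_0[OF lin])
  define w where "w = A e - r *\<^sub>R e"
  have wV: "w \<in> V" unfolding w_def using e(1) V by (auto intro!: subspace_diff subspace_scale)
  define q where "q = r * (w \<bullet> w) - w \<bullet> A w"
  have q0: "q \<ge> 0" unfolding q_def using max[OF wV] by simp
  have key: "2 * t * (w \<bullet> w) \<le> t\<^sup>2 * q" for t
  proof -
    have "e + t *\<^sub>R w \<in> V" using e(1) wV V(1) by (auto intro!: subspace_add subspace_scale)
    from max[OF this] have "(e + t *\<^sub>R w) \<bullet> A (e + t *\<^sub>R w) \<le> r * ((e + t *\<^sub>R w) \<bullet> (e + t *\<^sub>R w))" .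
    moreover have "w \<bullet> A e = w \<bullet> w + r * (w \<bullet> e)" unfolding w_def by (simp add: inner_diff_right inner_diff_left inner_commute algebra_simps)
    moreover have "e \<bullet> A w = w \<bullet> A e" using sym[of e w] by (simp add: inner_commute)
    ultimately show ?thesis
      unfolding q_def
      by (simp add: linear_add[OF lin] linear_scale[OF lin] inner_add_left inner_add_right r_def[symmetric] ee
        inner_commute[of e w] algebra_simps power2_eq_square)
  qed
  have "w \<bullet> w = 0"
  proof (rule ccontr)
    assume "w \<bullet> w \<noteq> 0"
    then have pos: "w \<bullet> w > 0" using inner_ge_zero[of w] by linarith
    \<comment> \<open>So small that \<open>t * q < w \<bullet> w\<close>: the first order term then
      beats the quadratic one.\<close>
    define t where "t = (w \<bullet> w) / (q + 1)"
    have t: "t > 0" "t * (q + 1) = w \<bullet> w" unfolding t_def using pos q0 by auto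
    have "t * (2 * (w \<bullet> w)) \<le> t * (t * q)" using key[of t] by (simp add: power2_eq_square mult_ac)
    then have "2 * (w \<bullet> w) \<le> t * q" using t(1) by simp
    moreover have "t * q < w \<bullet> w" using t by (simp add: algebra_simps)
    ultimately show False using pos by linarith
  qed
  then have "A e = r *\<^sub>R e" unfolding w_def by simp
  then show ?thesis using that[of e r] e(1) max by auto
qed

lemma eigenspace_subspace: "linear A \<Longrightarrow> subspace (eigenspace A r)"
  unfolding eigenspace_def
  by (auto simp: subspace_def linear_0 linear_add linear_scale scaleR_add_right)

lemma symmetric_eigenvectors_orthogonal:
  assumes sym: "\<And>x y. A x \<bullet> y = x \<bullet> A y" and "A e = r *\<^sub>R e" "A f = s *\<^sub>R f" "r \<noteq> s"
  shows "e \<bullet> f = 0"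
  using sym[of e f] assms(2-4) by simp

text \<open>The sum in \<open>eigenvalue_mset\<close> is meaningful only over a finite set of
  eigenvalues; finiteness comes from the orthogonality of eigenvectors of a symmetric operator to
  distinct eigenvalues.\<close>

lemma count_eigenvalue_mset:
  fixes A :: "'a::euclidean_space \<Rightarrow> 'a"
  assumes lin: "linear A" and sym: "\<And>x y. A x \<bullet> y = x \<bullet> A y"
  shows "count (eigenvalue_mset A) r = dim (eigenspace A r)"
proof -
  let ?S = "{r. eigenspace A r \<noteq> {0}}"
  have "\<exists>e. A e = r *\<^sub>R e \<and> e \<noteq> 0" if "r \<in> ?S" for r
    using that subspace_0[OF eigenspace_subspace[OF lin, of r]] unfolding eigenspace_def by auto
  then obtain e where e: "A (e r) = r *\<^sub>R e r" "e r \<noteq> 0" if "r \<in> ?S" for r by metis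
  have orth: "e r \<bullet> e s = 0" if "r \<in> ?S" "s \<in> ?S" "r \<noteq> s" for r s
    using symmetric_eigenvectors_orthogonal[OF sym e(1)[OF that(1)] e(1)[OF that(2)] that(3)] .
  have inj: "inj_on e ?S"
    by (rule inj_onI) (metis orth e(2) inner_eq_zero_iff)
  have "finite (e ` ?S)"
    by (rule pairwise_orthogonal_imp_finite) (use orth in \<open>auto simp: pairwise_def orthogonal_def\<close>)
  then have fin: "finite ?S" using inj finite_imageD by blast
  have "count (eigenvalue_mset A) r = (\<Sum>s\<in>?S. if s = r then dim (eigenspace A s) else 0)"
    unfolding eigenvalue_mset_def count_sum by (intro sum.cong) auto
  also have "\<dots> = dim (eigenspace A r)" using fin by (auto simp: sum.delta)
  finally show ?thesis .
qed

lemma mem_eigenvalue_mset: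
  fixes A :: "'a::euclidean_space \<Rightarrow> 'a"
  assumes lin: "linear A" and sym: "\<And>x y. A x \<bullet> y = x \<bullet> A y"
  shows "r \<in># eigenvalue_mset A \<longleftrightarrow> (\<exists>e. e \<noteq> 0 \<and> A e = r *\<^sub>R e)"
  unfolding count_greater_zero_iff[symmetric] count_eigenvalue_mset[OF assms]
  using dim_eq_0[of "eigenspace A r"] unfolding eigenspace_def by (auto simp: zero_less_iff_neq_zero)

text \<open>Translates multiplicities into the two list entries that serve as first and second
  eigenvalue. The last part asks for a further element \<open>s\<close> of \<open>M\<close>, since
  otherwise the list has length 1 and its entry at index 1 is unspecified.\<close>

lemma eigenvalue_nr_largest:
  fixes M :: "real multiset"
  assumes "\<mu> \<in># M" "\<And>s. s \<in># M \<Longrightarrow> s \<le> \<mu>"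
  shows "rev (sorted_list_of_multiset M) ! 0 = \<mu>"
    and "count M \<mu> \<ge> 2 \<Longrightarrow> rev (sorted_list_of_multiset M) ! 1 = \<mu>"
    and "count M \<mu> = 1 \<Longrightarrow> s \<in># M \<Longrightarrow> s \<noteq> \<mu> \<Longrightarrow> rev (sorted_list_of_multiset M) ! 1 \<noteq> \<mu>"
proof -
  define L where "L = rev (sorted_list_of_multiset M)"
  have mL: "mset L = M" unfolding L_def by simp
  have sL: "sorted_wrt (\<ge>) L" unfolding L_def by (simp add: sorted_wrt_rev)
  have setL: "set L = set_mset M" using mL by (metis set_mset_mset)
  obtain x L' where L: "L = x # L'" using assms(1) setL by (cases L) auto
  have "\<mu> \<le> x" using assms(1) sL unfolding setL[symmetric] L by auto
  moreover have "x \<le> \<mu>" using assms(2) L setL by (metis list.set_intros(1))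
  ultimately have x: "x = \<mu>" by simp
  then show "rev (sorted_list_of_multiset M) ! 0 = \<mu>" unfolding L_def[symmetric] L by simp
  have cL': "count M \<mu> = Suc (count (mset L') \<mu>)" using mL L x by auto
  show "rev (sorted_list_of_multiset M) ! 1 = \<mu>" if "count M \<mu> \<ge> 2"
  proof -
    have "\<mu> \<in> set L'" using that cL' by (metis Suc_le_mono count_greater_eq_one_iff numeral_2_eq_2 set_mset_mset One_nat_def)
    then obtain y L'' where L': "L' = y # L''" by (cases L') auto
    have "\<mu> \<le> y" using \<open>\<mu> \<in> set L'\<close> sL unfolding L L' by auto
    moreover have "y \<le> \<mu>" using sL unfolding L L' x by auto
    ultimately show ?thesis unfolding L_def[symmetric] L L' by simp
  qed
  show "rev (sorted_list_of_multiset M) ! 1 \<noteq> \<mu>" if "count M \<mu> = 1" "s \<in># M" "s \<noteq> \<mu>"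
  proof -
    have n: "\<mu> \<notin> set L'" using that(1) cL' by (metis Suc_inject One_nat_def count_eq_zero_iff set_mset_mset)
    have "s \<in> set L'" using that(2,3) setL L x by auto
    then have "L' ! 0 \<in> set L'" by (cases L') auto
    then show ?thesis using n unfolding L_def[symmetric] L by auto
  qed
qed

lemma span_singleton_of_form_bound:
  fixes A :: "'a::euclidean_space \<Rightarrow> 'a"
  assumes lin: "linear A" and v: "v \<noteq> 0" "A v = \<mu> *\<^sub>R v"
    and r: "r < \<mu>" "\<And>u. u \<bullet> v = 0 \<Longrightarrow> u \<bullet> A u \<le> r * (u \<bullet> u)"
  shows "eigenspace A \<mu> = span {v}"
proof
  show "span {v} \<subseteq> eigenspace A \<mu>"
    by (rule span_minimal[OF _ eigenspace_subspace[OF lin]]) (use v in \<open>simp add: eigenspace_def\<close>)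
  show "eigenspace A \<mu> \<subseteq> span {v}"
  proof
    fix u assume u: "u \<in> eigenspace A \<mu>"
    define c where "c = (u \<bullet> v) / (v \<bullet> v)"
    define u' where "u' = u - c *\<^sub>R v"
    have o: "u' \<bullet> v = 0" unfolding u'_def c_def using v(1) by (simp add: inner_diff_left)
    have "A u' = \<mu> *\<^sub>R u'" unfolding u'_def using u v(2)
      by (simp add: eigenspace_def linear_diff[OF lin] linear_scale[OF lin] scaleR_diff_right)
    then have "\<mu> * (u' \<bullet> u') \<le> r * (u' \<bullet> u')" using r(2)[OF o] by simp
    then have "u' \<bullet> u' = 0" using r(1) mult_strict_right_mono[of r \<mu> "u' \<bullet> u'"] inner_ge_zero[of u'] by fastforce
    then have "u = c *\<^sub>R v" unfolding u'_def by simp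
    then show "u \<in> span {v}" by (simp add: span_base span_scale)
  qed
qed

lemma orthogonal_complement_nontrivial:
  fixes v :: "'a::euclidean_space"
  assumes "DIM('a) \<ge> 2"
  shows "{u. u \<bullet> v = 0} \<noteq> {0}"
proof
  assume *: "{u. u \<bullet> v = 0} = {0}"
  have "u \<in> span {v}" for u
  proof -
    obtain y z where "y \<in> span {v}" "\<And>w. w \<in> span {v} \<Longrightarrow> orthogonal z w" "u = y + z"
      using orthogonal_subspace_decomp_exists[of "{v}" u] by metis
    moreover from this have "z \<in> {u. u \<bullet> v = 0}" by (simp add: orthogonal_def span_base)
    ultimately show ?thesis using * by simp
  qed
  then have "DIM('a) \<le> dim {v}" by (metis UNIV_I dim_UNIV dim_span dim_subset subsetI)
  also have "\<dots> \<le> 1" using dim_le_card'[of "{v}"] by simp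
  finally show False using assms by simp
qed

text \<open>A gap of the quadratic form on the complement of \<open>v\<close> certifies that \<mu>
  is both largest and simple; unlike the sorted list, such a gap is easily carried to nearby points.
  The dimension bound provides a second eigenvalue to compare with.\<close>

lemma eigenvalue_nr_top:
  fixes A :: "'a::euclidean_space \<Rightarrow> 'a"
  assumes lin: "linear A" and sym: "\<And>x y. A x \<bullet> y = x \<bullet> A y" and v: "v \<noteq> 0" "A v = \<mu> *\<^sub>R v"
    and r: "r < \<mu>" "\<And>u. u \<bullet> v = 0 \<Longrightarrow> u \<bullet> A u \<le> r * (u \<bullet> u)" and d: "DIM('a) \<ge> 2"
  shows "eigenvalue_nr A 1 = \<mu>" "eigenvalue_nr A 2 \<noteq> \<mu>"
proof -
  let ?M = "eigenvalue_mset A"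
  have mem: "\<mu> \<in># ?M" unfolding mem_eigenvalue_mset[OF lin sym] using v by blast
  have small: "s \<le> r" if "e \<noteq> 0" "A e = s *\<^sub>R e" "e \<bullet> v = 0" for s e
    using r(2)[OF that(3)] that(1,2) by simp
  have le: "s \<le> \<mu>" if sM: "s \<in># ?M" for s
  proof (rule ccontr)
    assume s: "\<not> s \<le> \<mu>"
    obtain e where e: "e \<noteq> 0" "A e = s *\<^sub>R e" using sM unfolding mem_eigenvalue_mset[OF lin sym] by blast
    have "e \<bullet> v = 0" using symmetric_eigenvectors_orthogonal[OF sym e(2) v(2)] s by simp
    from small[OF e this] show False using r(1) s by simp
  qed
  let ?V = "{u. u \<bullet> v = 0}"
  have V: "subspace ?V" "A ` ?V \<subseteq> ?V"
    using sym[of _ v] v(2) by (auto simp: subspace_def inner_add_left)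
  obtain e s where e: "e \<in> ?V" "norm e = 1" "A e = s *\<^sub>R e"
    by (rule symmetric_max_eigenvector[OF lin sym V(1) orthogonal_complement_nontrivial[OF d] V(2)]) (rule that; assumption)
  have e0: "e \<noteq> 0" using e(2) by auto
  have s: "s \<in># ?M" "s \<noteq> \<mu>"
    unfolding mem_eigenvalue_mset[OF lin sym] using e e0 small[OF e0 e(3)] r(1) by auto
  have "count ?M \<mu> = 1"
  proof -
    have "eigenspace A \<mu> = span {v}" by (rule span_singleton_of_form_bound[OF lin v r])
    then show ?thesis unfolding count_eigenvalue_mset[OF lin sym] using v(1) by (simp add: dim_insert)
  qed
  with eigenvalue_nr_largest[OF mem le] s show "eigenvalue_nr A 1 = \<mu>" "eigenvalue_nr A 2 \<noteq> \<mu>"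
    unfolding eigenvalue_nr_def by auto
qed

text \<open>\<open>r\<close> is the maximum of the form on the unit vectors orthogonal to the top
  eigenvector, if there are any; were it equal to the top eigenvalue, the eigenspace would contain
  two independent vectors.\<close>

lemma eigenvalue_nr_simple_top:
  fixes A :: "'a::euclidean_space \<Rightarrow> 'a"
  assumes lin: "linear A" and sym: "\<And>x y. A x \<bullet> y = x \<bullet> A y" and ne: "eigenvalue_nr A 1 \<noteq> eigenvalue_nr A 2"
  obtains v r where "norm v = 1" "A v = eigenvalue_nr A 1 *\<^sub>R v" "r < eigenvalue_nr A 1"
    "\<And>u. u \<bullet> v = 0 \<Longrightarrow> u \<bullet> A u \<le> r * (u \<bullet> u)" "\<And>u. u \<bullet> A u \<le> eigenvalue_nr A 1 * (u \<bullet> u)"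
proof -
  let ?M = "eigenvalue_mset A"
  obtain b :: 'a where "b \<in> Basis" using nonempty_Basis by blast
  then have "b \<noteq> 0" by auto
  then have U: "(UNIV::'a set) \<noteq> {0}" by (metis UNIV_I singletonD)
  obtain e \<mu> where e: "norm e = 1" "A e = \<mu> *\<^sub>R e" "\<And>v. v \<bullet> A v \<le> \<mu> * (v \<bullet> v)"
    by (rule symmetric_max_eigenvector[OF lin sym subspace_UNIV U subset_UNIV]) (rule that; simp)
  have e0: "e \<noteq> 0" using e(1) by auto
  have mem: "\<mu> \<in># ?M" unfolding mem_eigenvalue_mset[OF lin sym] using e e0 by blast
  have le: "s \<le> \<mu>" if "s \<in># ?M" for s
  proof -
    obtain f where f: "f \<noteq> 0" "A f = s *\<^sub>R f" using \<open>s \<in># ?M\<close> unfolding mem_eigenvalue_mset[OF lin sym] by blast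
    then show ?thesis using e(3)[of f] by simp
  qed
  have 1: "eigenvalue_nr A 1 = \<mu>" using eigenvalue_nr_largest(1)[OF mem le] unfolding eigenvalue_nr_def by simp
  have "\<not> count ?M \<mu> \<ge> 2" using eigenvalue_nr_largest(2)[OF mem le] ne 1 unfolding eigenvalue_nr_def by auto
  then have dim: "\<not> dim (eigenspace A \<mu>) \<ge> 2" unfolding count_eigenvalue_mset[OF lin sym] .
  let ?V = "{u. u \<bullet> e = 0}"
  have V: "subspace ?V" "A ` ?V \<subseteq> ?V"
    using sym[of _ e] e(2) by (auto simp: subspace_def inner_add_left)
  have "\<exists>r<\<mu>. \<forall>u. u \<bullet> e = 0 \<longrightarrow> u \<bullet> A u \<le> r * (u \<bullet> u)"
  proof (cases "?V = {0}")
    case True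
    then have "u \<bullet> A u \<le> (\<mu> - 1) * (u \<bullet> u)" if "u \<bullet> e = 0" for u
      using that by (metis (mono_tags, lifting) inner_zero_left mem_Collect_eq mult_zero_right order_refl singletonD)
    then show ?thesis by (intro exI[of _ "\<mu> - 1"]) simp
  next
    case False
    obtain f r where f: "f \<in> ?V" "norm f = 1" "A f = r *\<^sub>R f" "\<And>v. v \<in> ?V \<Longrightarrow> v \<bullet> A v \<le> r * (v \<bullet> v)"
      by (rule symmetric_max_eigenvector[OF lin sym V(1) False V(2)]) (rule that; assumption)
    have f0: "f \<noteq> 0" using f(2) by auto
    have "r \<le> \<mu>" using e(3)[of f] f(2,3) by (simp add: norm_eq_1)
    moreover have "r \<noteq> \<mu>"
    proof
      assume r: "r = \<mu>"
      have "e \<noteq> f" using f(1) e0 by auto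
      have "independent {e, f}"
        by (rule pairwise_orthogonal_independent) (use e0 f0 f(1) in \<open>auto simp: pairwise_def orthogonal_def inner_commute\<close>)
      moreover have "{e, f} \<subseteq> eigenspace A \<mu>" using e(2) f(3) r unfolding eigenspace_def by auto
      ultimately have "card {e, f} \<le> dim (eigenspace A \<mu>)" by (rule independent_card_le_dim[rotated])
      then show False using dim \<open>e \<noteq> f\<close> by simp
    qed
    ultimately show ?thesis using f(4) by (intro exI[of _ r]) auto
  qed
  then show ?thesis using that[of e] e 1 by auto
qed

text \<open>Let \<open>t * t\<close> be the largest eigenvalue of \<open>D\<close> applied twice on
  \<open>V\<close>, with eigenvector \<open>e\<close>. Either \<open>D e = - t *\<^sub>R e\<close>,
  or \<open>D e + t *\<^sub>R e\<close> is an eigenvector of \<open>D\<close> for \<open>t\<close>.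
  In both cases \<open>b\<close> gives \<open>t \<le> 1\<close>, and \<open>V0\<close> excludes
  \<open>t = 1\<close>.\<close>

lemma symmetric_contraction:
  fixes D :: "'a::euclidean_space \<Rightarrow> 'a"
  assumes lin: "linear D" and sym: "\<And>x y. D x \<bullet> y = x \<bullet> D y" and V: "subspace V" "D ` V \<subseteq> V"
    and b: "\<And>z. \<bar>z \<bullet> D z\<bar> \<le> z \<bullet> z" and V0: "\<And>z. z \<in> V \<Longrightarrow> D (D z) = z \<Longrightarrow> z = 0"
  obtains \<kappa> where "0 \<le> \<kappa>" "\<kappa> < 1" "\<And>z. z \<in> V \<Longrightarrow> norm (D z) \<le> \<kappa> * norm z"
proof (cases "V = {0}")
  case True
  then show ?thesis using that[of 0] by (simp add: linear_0[OF lin])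
next
  case False
  have lin2: "linear (\<lambda>z. D (D z))" using linear_compose[OF lin lin] by (simp add: o_def)
  have sym2: "D (D x) \<bullet> y = x \<bullet> D (D y)" for x y by (simp add: sym)
  have V2: "(\<lambda>z. D (D z)) ` V \<subseteq> V" using V(2) by auto
  obtain e r where e: "e \<in> V" "norm e = 1" "D (D e) = r *\<^sub>R e" "\<And>v. v \<in> V \<Longrightarrow> v \<bullet> D (D v) \<le> r * (v \<bullet> v)"
    by (rule symmetric_max_eigenvector[OF lin2 sym2 V(1) False V2]) (rule that; assumption)
  have e0: "e \<noteq> 0" using e(2) by auto
  have r0: "r \<ge> 0"
  proof -
    have "r = D e \<bullet> D e" using sym[of e "D e"] e(2,3) by (simp add: norm_eq_1)
    then show ?thesis by simp
  qed
  define t where "t = sqrt r"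
  have t: "t \<ge> 0" "t * t = r" unfolding t_def using r0 by auto
  have "t < 1"
  proof (rule ccontr)
    assume "\<not> t < 1"
    then have t1: "t \<ge> 1" by simp
    define u where "u = D e + t *\<^sub>R e"
    have uV: "u \<in> V" unfolding u_def using e(1) V by (auto intro!: subspace_add subspace_scale)
    show False
    proof (cases "u = 0")
      case True
      then have De: "D e = - t *\<^sub>R e" unfolding u_def by (simp add: eq_neg_iff_add_eq_0)
      have "\<bar>- t\<bar> \<le> 1" using b[of e] e(2) unfolding De by (simp add: norm_eq_1)
      then have "t = 1" using t1 by simp
      then have "D (D e) = e" using e(3) t by simp
      then show False using V0[OF e(1)] e0 by simp
    next
      case False
      have Du: "D u = t *\<^sub>R u" unfolding u_def
        by (simp add: linear_add[OF lin] linear_scale[OF lin] e(3) t(2)[symmetric] scaleR_add_right)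
      have "t * (u \<bullet> u) \<le> 1 * (u \<bullet> u)" using b[of u] Du by simp
      then have "t \<le> 1" using False by (simp only: mult_le_cancel_right) (use inner_gt_zero_iff[of u] False in auto)
      then have "t = 1" using t1 by simp
      then show False using V0[OF uV] Du False by simp
    qed
  qed
  moreover have "norm (D z) \<le> t * norm z" if "z \<in> V" for z
  proof (rule power2_le_imp_le)
    have "(norm (D z))\<^sup>2 = z \<bullet> D (D z)" using sym[of z "D z"] by (simp add: power2_norm_eq_inner)
    also have "\<dots> \<le> r * (z \<bullet> z)" by (rule e(4)[OF that])
    also have "\<dots> = (t * norm z)\<^sup>2" using t(2) by (simp add: power_mult_distrib power2_norm_eq_inner power2_eq_square[of t])
    finally show "(norm (D z))\<^sup>2 \<le> (t * norm z)\<^sup>2" .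
  qed (use t in auto)
  ultimately show ?thesis using that t(1) by blast
qed

text \<open>The orthogonal complement of \<open>e1\<close> and \<open>e2\<close> in \<open>E\<close>
  is invariant; were it nontrivial, it would contain an eigenvector, with eigenvalue 1 or -1, which
  \<open>no\<close> excludes. This computes \<open>Ec\<close> from its abstract
  characterisation.\<close>

lemma symmetric_invariant_plane:
  fixes D :: "'a::euclidean_space \<Rightarrow> 'a"
  assumes lin: "linear D" and sym: "\<And>x y. D x \<bullet> y = x \<bullet> D y" and E: "subspace E" "D ` E \<subseteq> E"
    and ev: "restricted_eigenvalues D E \<subseteq> {1, -1}" and e: "e1 \<in> E" "e2 \<in> E" "D e1 = - e1" "D e2 = e2"
    and no: "\<And>z. z \<in> E \<Longrightarrow> D z = z \<or> D z = - z \<Longrightarrow> z \<bullet> e1 = 0 \<Longrightarrow> z \<bullet> e2 = 0 \<Longrightarrow> z = 0"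
  shows "E = span {e1, e2}"
proof
  show "span {e1, e2} \<subseteq> E" using e(1,2) E(1) by (intro span_minimal) auto
  let ?V = "{z \<in> E. z \<bullet> e1 = 0 \<and> z \<bullet> e2 = 0}"
  have V: "subspace ?V" using E(1) by (auto simp: subspace_def inner_add_left)
  have DV: "D ` ?V \<subseteq> ?V" using E(2) sym[of _ e1] sym[of _ e2] e(3,4) by auto
  have V0: "?V = {0}"
  proof (rule ccontr)
    assume "?V \<noteq> {0}"
    then obtain f r where f: "f \<in> ?V" "norm f = 1" "D f = r *\<^sub>R f"
      by (rule symmetric_max_eigenvector[OF lin sym V _ DV]) (rule that; assumption)
    have f0: "f \<noteq> 0" using f(2) by auto
    then have "r \<in> restricted_eigenvalues D E" using f unfolding restricted_eigenvalues_def by auto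
    then have "r = 1 \<or> r = -1" using ev by auto
    then show False using no[of f] f f0 by auto
  qed
  show "E \<subseteq> span {e1, e2}"
  proof
    fix x assume x: "x \<in> E"
    obtain y z where yz: "y \<in> span {e1, e2}" "\<And>w. w \<in> span {e1, e2} \<Longrightarrow> orthogonal z w" "x = y + z"
      using orthogonal_subspace_decomp_exists[of "{e1, e2}" x] by metis
    have "y \<in> E" using yz(1) \<open>span {e1, e2} \<subseteq> E\<close> by blast
    then have "z \<in> E" using subspace_diff[OF E(1) x] yz(3) by fastforce
    moreover have "z \<bullet> e1 = 0" "z \<bullet> e2 = 0" using yz(2) by (simp_all add: orthogonal_def span_base)
    ultimately have "z = 0" using V0 by blast
    then show "x \<in> span {e1, e2}" using yz by simp
  qed
qed

lemma orthogonal_projection_exists: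
  fixes V :: "'a::euclidean_space set"
  assumes V: "subspace V"
  obtains P where "linear P" "\<And>v. P v \<in> V" "\<And>v. v \<in> V \<Longrightarrow> P v = v" "\<And>v w. w \<in> V \<Longrightarrow> (v - P v) \<bullet> w = 0"
proof -
  obtain B where B: "B \<subseteq> V" "pairwise orthogonal B" "\<And>x. x \<in> B \<Longrightarrow> norm x = 1" "independent B" "span B = V"
    using orthonormal_basis_subspace[OF V] by metis
  have fin: "finite B" using B(4) by (rule independent_imp_finite)
  define P where "P = (\<lambda>v. \<Sum>b\<in>B. (v \<bullet> b) *\<^sub>R b)"
  have bb: "b \<bullet> b' = (if b = b' then 1 else 0)" if "b \<in> B" "b' \<in> B" for b b'
    using B(2,3) that unfolding pairwise_def orthogonal_def by (auto simp: norm_eq_1)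
  have lin: "linear P" unfolding P_def
    by (auto intro!: linearI simp: inner_add_left scaleR_add_left sum.distrib scaleR_sum_right)
  have PV: "P v \<in> V" for v unfolding P_def using B(1) V by (auto intro!: subspace_sum subspace_scale)
  have orthB: "(v - P v) \<bullet> b = 0" if "b \<in> B" for v b
  proof -
    have "P v \<bullet> b = (\<Sum>b'\<in>B. (v \<bullet> b') * (if b' = b then 1 else 0))"
      unfolding P_def inner_sum_left using bb that by (intro sum.cong) auto
    also have "\<dots> = v \<bullet> b" using fin that by (simp add: if_distrib sum.delta' cong: if_cong)
    finally show ?thesis by (simp add: inner_diff_left)
  qed
  have orth: "(v - P v) \<bullet> w = 0" if "w \<in> V" for v w
  proof -
    have "w \<in> span B" using that B(5) by simp
    then have "orthogonal (v - P v) w"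
      by (rule orthogonal_to_span) (use orthB in \<open>simp add: orthogonal_def\<close>)
    then show ?thesis by (simp add: orthogonal_def)
  qed
  have "P v = v" if "v \<in> V" for v
  proof -
    have "(v - P v) \<bullet> (v - P v) = 0" by (rule orth) (use that PV V in \<open>auto intro: subspace_diff\<close>)
    then show ?thesis by simp
  qed
  with lin PV orth that show ?thesis by blast
qed

lemma orthogonal_projection_norms:
  fixes P :: "'a::euclidean_space \<Rightarrow> 'a"
  assumes "\<And>v. P v \<in> V" "\<And>v w. w \<in> V \<Longrightarrow> (v - P v) \<bullet> w = 0"
  shows "norm (P v) \<le> norm v" "norm (v - P v) \<le> norm v"
proof -
  have "orthogonal (P v) (v - P v)" using assms(2)[OF assms(1)] unfolding orthogonal_def by (simp add: inner_commute)
  from norm_add_Pythagorean[OF this] have "(norm v)\<^sup>2 = (norm (P v))\<^sup>2 + (norm (v - P v))\<^sup>2" by simp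
  then show "norm (P v) \<le> norm v" "norm (v - P v) \<le> norm v" by (auto intro: power2_le_imp_le)
qed

text \<open>For self-adjoint \<open>D\<close> the centre space is the fixed space of
  \<open>D\<close> applied twice, and its orthogonal complement is invariant. Hence the commutation
  with \<open>P\<close>, the isometry on the centre space and the contraction factor \<kappa> all
  follow from \<open>b\<close> and symmetry.\<close>

theorem local_centre_manifold_symmetric:
  fixes D R0 P :: "'a::euclidean_space \<Rightarrow> 'a"
  assumes lin: "linear D" and sym: "\<And>x y. D x \<bullet> y = x \<bullet> D y" and b: "\<And>z. \<bar>z \<bullet> D z\<bar> \<le> z \<bullet> z"
    and P: "linear P" "\<And>v. D (D (P v)) = P v" "\<And>v. D (D v) = v \<Longrightarrow> P v = v"
      "\<And>v w. D (D w) = w \<Longrightarrow> (v - P v) \<bullet> w = 0"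
    and R0: "Ck_on (Suc k) R0 UNIV" "R0 0 = 0" "\<And>v. frechet_derivative R0 (at 0) v = 0"
    and k: "1 \<le> k"
  obtains H \<delta> where "0 < \<delta>" "Ck_on k H UNIV" "\<And>c. P (H c) = P c" "\<And>c. H (P c) = H c"
    "\<And>z. norm z < \<delta> \<Longrightarrow> H z = z \<Longrightarrow> H (D z + R0 z) = D z + R0 z"
    "\<And>z. norm z < \<delta> \<Longrightarrow> D z + R0 z = z \<Longrightarrow> H z = z"
    "\<And>z s e. norm z < \<delta> \<Longrightarrow> D z + R0 z = z \<Longrightarrow> \<bar>s\<bar> = 1 \<Longrightarrow> D e + frechet_derivative R0 (at z) e = s *\<^sub>R e \<Longrightarrow>
       frechet_derivative H (at z) e = e"
proof -
  let ?C = "{z. D (D z) = z}"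
  let ?V = "{z. \<forall>w\<in>?C. z \<bullet> w = 0}"
  have V: "subspace ?V" by (auto simp: subspace_def inner_add_left)
  have DC: "D w \<in> ?C" if "w \<in> ?C" for w using that by simp
  have DV: "D ` ?V \<subseteq> ?V"
  proof (rule image_subsetI)
    fix z assume z: "z \<in> ?V"
    have "D z \<bullet> w = 0" if "w \<in> ?C" for w using z DC[OF that] unfolding sym by blast
    then show "D z \<in> ?V" by blast
  qed
  have V0: "z = 0" if "z \<in> ?V" "D (D z) = z" for z
  proof -
    have "z \<bullet> z = 0" using that by blast
    then show ?thesis by simp
  qed
  obtain \<kappa> where \<kappa>: "0 \<le> \<kappa>" "\<kappa> < 1" "\<And>z. z \<in> ?V \<Longrightarrow> norm (D z) \<le> \<kappa> * norm z"
    by (rule symmetric_contraction[OF lin sym V DV b V0]) (assumption | rule that)+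
  have PC: "P v \<in> ?C" for v using P(2) by simp
  have PV: "v - P v \<in> ?V" for v using P(4) by simp
  have PO: "(v - P v) \<bullet> w = 0" if "w \<in> ?C" for v w using P(4) that by simp
  have DP: "D (P z) = P (D z)" for z
  proof -
    have d: "D z = D (P z) + D (z - P z)" using linear_add[OF lin, of "P z" "z - P z"] by simp
    have 1: "P (D (P z)) = D (P z)" using P(2)[of z] by (intro P(3)) simp
    have 2: "P (D (z - P z)) = 0"
    proof -
      have "D (z - P z) \<in> ?V" using DV PV by blast
      then have "D (z - P z) \<bullet> P (D (z - P z)) = 0" using PC by blast
      moreover have "(D (z - P z) - P (D (z - P z))) \<bullet> P (D (z - P z)) = 0" by (rule PO[OF PC])
      ultimately have "P (D (z - P z)) \<bullet> P (D (z - P z)) = 0" by (simp add: inner_diff_left)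
      then show ?thesis by simp
    qed
    show ?thesis using 1 2 linear_add[OF P(1), of "D (P z)" "D (z - P z)"] d by simp
  qed
  have nDP: "norm (D (P z)) \<le> norm (P z)" for z
  proof -
    have "D (P z) \<bullet> D (P z) = P z \<bullet> P z" using sym[of "P z" "D (P z)"] P(2)[of z] by simp
    then show ?thesis by (simp add: norm_eq_sqrt_inner)
  qed
  show ?thesis
  proof (rule local_centre_manifold[OF lin P(1) _ _ _ DP P(2) nDP _ \<kappa>(1,2) R0 k])
    show "P (P z) = P z" for z using P(2) by (intro P(3))
    show "norm (P z) \<le> norm z" "norm (z - P z) \<le> norm z" for z
      using orthogonal_projection_norms[of P ?C, OF PC PO] by auto
    show "norm (D (z - P z)) \<le> \<kappa> * norm (z - P z)" for z using \<kappa>(3)[OF PV] .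
  qed (rule that; assumption)
qed

section \<open>Charts, tangent spaces and foliations\<close>

lemma tangent_space_Int_open:
  assumes "open A" "q \<in> A"
  shows "tangent_space (S \<inter> A) q = tangent_space S q"
proof
  show "tangent_space (S \<inter> A) q \<subseteq> tangent_space S q" unfolding tangent_space_def by fastforce
  show "tangent_space S q \<subseteq> tangent_space (S \<inter> A) q"
  proof
    fix v assume "v \<in> tangent_space S q"
    then obtain \<gamma> e where g: "e > 0" "\<gamma> C1_differentiable_on {-e<..<e}" "\<gamma> ` {-e<..<e} \<subseteq> S" "\<gamma> 0 = q"
      "(\<gamma> has_vector_derivative v) (at 0)" unfolding tangent_space_def by blast
    have "isCont \<gamma> 0" using g(5) has_vector_derivative_continuous by blast
    then have "\<forall>\<^sub>F t in at 0. \<gamma> t \<in> A"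
      using assms g(4) topological_tendstoD[of \<gamma> "\<gamma> 0" "at 0" A] unfolding isCont_def by auto
    then obtain d where d: "d > 0" "\<And>t. t \<noteq> 0 \<Longrightarrow> dist t 0 < d \<Longrightarrow> \<gamma> t \<in> A" unfolding eventually_at by blast
    have "\<gamma> ` {-(min d e)<..<min d e} \<subseteq> S \<inter> A"
    proof (rule image_subsetI)
      fix t assume t: "t \<in> {-(min d e)<..<min d e}"
      then have "\<gamma> t \<in> S" using g(3) by auto
      moreover have "\<gamma> t \<in> A" using d(2)[of t] t g(4) assms(2) by (cases "t = 0") (auto simp: dist_real_def)
      ultimately show "\<gamma> t \<in> S \<inter> A" by simp
    qed
    moreover have "\<gamma> C1_differentiable_on {-(min d e)<..<min d e}"
      using g(2) by (rule C1_differentiable_on_subset) auto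
    ultimately show "v \<in> tangent_space (S \<inter> A) q"
      unfolding tangent_space_def using g(1,4,5) d(1) by (intro CollectI exI[of _ \<gamma>] exI[of _ "min d e"]) auto
  qed
qed

text \<open>In the chart, a curve inside the slice is annihilated, up to the constant
  \<open>c\<close>, by all of \<open>V\<^sup>\<bottom>\<close>, so its velocity lies in
  \<open>V\<close>; conversely \<open>\<psi>\<close> carries straight lines of the slice to
  admissible curves.\<close>

lemma tangent_space_slice:
  fixes \<phi> :: "'a::euclidean_space \<Rightarrow> 'b::euclidean_space"
  assumes d: "Ck_diffeo (Suc k) A B \<phi> \<psi>" and V: "subspace V" and c: "c \<in> B"
  shows "tangent_space (\<psi> ` {z \<in> B. z - c \<in> V}) (\<psi> c) = frechet_derivative \<psi> (at c) ` V"
proof -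
  let ?S = "\<psi> ` {z \<in> B. z - c \<in> V}"
  have A: "open A" "open B" "homeomorphism A B \<phi> \<psi>" "Ck_on (Suc k) \<phi> A" "Ck_on (Suc k) \<psi> B"
    using d unfolding Ck_diffeo_def by auto
  have pc: "\<psi> c \<in> A" "\<phi> (\<psi> c) = c"
    using homeomorphism_image2[OF A(3)] homeomorphism_apply2[OF A(3)] c by auto
  have d\<psi>: "(\<psi> has_derivative frechet_derivative \<psi> (at x)) (at x)" if "x \<in> B" for x
    by (rule Ck_on_has_derivative[OF A(5) that])
  have d\<phi>: "(\<phi> has_derivative frechet_derivative \<phi> (at (\<psi> c))) (at (\<psi> c))"
    by (rule Ck_on_has_derivative[OF A(4) pc(1)])
  have inv: "frechet_derivative \<psi> (at c) (frechet_derivative \<phi> (at (\<psi> c)) v) = v" for v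
    using Ck_diffeo_derivatives(1)[OF d pc(1)] pc(2) by simp
  show ?thesis
  proof
    show "tangent_space ?S (\<psi> c) \<subseteq> frechet_derivative \<psi> (at c) ` V"
    proof
      fix v assume "v \<in> tangent_space ?S (\<psi> c)"
      then obtain \<gamma> e where g: "e > 0" "\<gamma> ` {-e<..<e} \<subseteq> ?S" "\<gamma> 0 = \<psi> c" "(\<gamma> has_vector_derivative v) (at 0)"
        unfolding tangent_space_def by blast
      let ?w = "frechet_derivative \<phi> (at (\<psi> c)) v"
      have "((\<lambda>t. \<phi> (\<gamma> t)) has_derivative (\<lambda>t. frechet_derivative \<phi> (at (\<psi> c)) (t *\<^sub>R v))) (at 0)"
        using g(4) unfolding has_vector_derivative_def
        by (rule has_derivative_compose) (simp add: g(3) d\<phi>)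
      then have "((\<lambda>t. \<phi> (\<gamma> t)) has_vector_derivative ?w) (at 0)"
        unfolding has_vector_derivative_def by (simp add: linear_scale[OF has_derivative_linear[OF d\<phi>]])
      note d\<phi>\<gamma> = this
      have "?w \<in> V\<^sup>\<bottom>\<^sup>\<bottom>"
        unfolding orthogonal_comp_def[of "V\<^sup>\<bottom>"] orthogonal_def
      proof (intro CollectI ballI)
        fix u assume u: "u \<in> V\<^sup>\<bottom>"
        have "((\<lambda>t. u \<bullet> (\<phi> (\<gamma> t) - c)) has_derivative (\<lambda>t. u \<bullet> (t *\<^sub>R ?w - 0))) (at 0)"
          using d\<phi>\<gamma> unfolding has_vector_derivative_def
          by (intro has_derivative_inner_right has_derivative_diff has_derivative_const)
        moreover have "((\<lambda>t. u \<bullet> (\<phi> (\<gamma> t) - c)) has_derivative (\<lambda>t. 0)) (at 0)"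
        proof (rule has_derivative_const_on_open[of "{-e<..<e}"])
          fix t assume "t \<in> {-e<..<e}"
          then obtain z where z: "z \<in> B" "z - c \<in> V" "\<gamma> t = \<psi> z" using g(2) by blast
          then have "\<phi> (\<gamma> t) - c \<in> V" using homeomorphism_apply2[OF A(3)] by simp
          then show "u \<bullet> (\<phi> (\<gamma> t) - c) = 0"
            using u unfolding orthogonal_comp_def orthogonal_def by (simp add: inner_commute[of u])
        qed (use g(1) in auto)
        ultimately have "(\<lambda>t. u \<bullet> (t *\<^sub>R ?w - 0)) = (\<lambda>t. 0)" by (rule has_derivative_unique)
        from fun_cong[OF this, of 1] show "u \<bullet> ?w = 0" by simp
      qed
      then have "?w \<in> V" using orthogonal_comp_self[OF V] by simp
      then show "v \<in> frechet_derivative \<psi> (at c) ` V" using inv[of v] by (metis imageI)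
    qed
    show "frechet_derivative \<psi> (at c) ` V \<subseteq> tangent_space ?S (\<psi> c)"
    proof (rule image_subsetI)
      fix v assume v: "v \<in> V"
      obtain r where r: "r > 0" "ball c r \<subseteq> B" using A(2) c open_contains_ball by blast
      define e where "e = r / (norm v + 1)"
      have n1: "norm v + 1 > 0" using norm_ge_zero[of v] by linarith
      have e: "e > 0" unfolding e_def using r n1 by simp
      have inB: "c + t *\<^sub>R v \<in> B" if "t \<in> {-e<..<e}" for t
      proof -
        have "\<bar>t\<bar> * norm v \<le> e * norm v" using that by (intro mult_right_mono) auto
        also have "\<dots> < e * (norm v + 1)" using e by simp
        also have "\<dots> = r" unfolding e_def using n1 by simp
        finally show ?thesis using r(2) by (auto simp: dist_norm)
      qed
      have dg: "((\<lambda>t. \<psi> (c + t *\<^sub>R v)) has_vector_derivative frechet_derivative \<psi> (at (c + t *\<^sub>R v)) v) (at t)"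
        if t: "t \<in> {-e<..<e}" for t
      proof -
        have "((\<lambda>t. c + t *\<^sub>R v) has_derivative (\<lambda>s. s *\<^sub>R v)) (at t)" by (auto intro!: derivative_eq_intros)
        then have "((\<lambda>t. \<psi> (c + t *\<^sub>R v)) has_derivative (\<lambda>s. frechet_derivative \<psi> (at (c + t *\<^sub>R v)) (s *\<^sub>R v))) (at t)"
          by (rule has_derivative_compose) (rule d\<psi>[OF inB[OF t]])
        then show ?thesis
          unfolding has_vector_derivative_def by (simp add: linear_scale[OF has_derivative_linear[OF d\<psi>[OF inB[OF t]]]])
      qed
      have "continuous_on {-e<..<e} (\<lambda>t. frechet_derivative \<psi> (at (c + t *\<^sub>R v)) v)"
      proof (rule continuous_on_compose2[OF Ck_on_frechet_continuous[OF A(5), of v]])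
        show "continuous_on {-e<..<e} (\<lambda>t. c + t *\<^sub>R v)" by (intro continuous_intros)
        show "(\<lambda>t. c + t *\<^sub>R v) ` {-e<..<e} \<subseteq> B" by (rule image_subsetI) (rule inB)
      qed
      then have "(\<lambda>t. \<psi> (c + t *\<^sub>R v)) C1_differentiable_on {-e<..<e}"
        unfolding C1_differentiable_on_def
        by (intro exI[of _ "\<lambda>t. frechet_derivative \<psi> (at (c + t *\<^sub>R v)) v"] conjI ballI dg)
      moreover have "(\<lambda>t. \<psi> (c + t *\<^sub>R v)) ` {-e<..<e} \<subseteq> ?S"
        by (rule image_subsetI, rule imageI) (use inB subspace_scale[OF V v] in simp)
      ultimately show "frechet_derivative \<psi> (at c) v \<in> tangent_space ?S (\<psi> c)"
        unfolding tangent_space_def using dg[of 0] e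
        by (intro CollectI exI[of _ "\<lambda>t. \<psi> (c + t *\<^sub>R v)"] exI[of _ e] conjI) simp_all
    qed
  qed
qed

lemma Ck_diffeo_sym: "Ck_diffeo k A B \<phi> \<psi> \<Longrightarrow> Ck_diffeo k B A \<psi> \<phi>"
  unfolding Ck_diffeo_def using homeomorphism_sym by blast

lemma Ck_diffeo_restrict:
  assumes d: "Ck_diffeo k A B \<phi> \<psi>" and A': "open A'" "A' \<subseteq> A"
  shows "Ck_diffeo k A' (\<phi> ` A') \<phi> \<psi>"
proof -
  have *: "open A" "open B" "homeomorphism A B \<phi> \<psi>" "Ck_on k \<phi> A" "Ck_on k \<psi> B"
    using d unfolding Ck_diffeo_def by auto
  have sub: "\<phi> ` A' \<subseteq> B" using A'(2) homeomorphism_image1[OF *(3)] by blast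
  have hom: "homeomorphism A' (\<phi> ` A') \<phi> \<psi>" by (rule homeomorphism_of_subsets[OF *(3) A'(2) _ refl]) (rule sub)
  have eq: "\<phi> ` A' = {y \<in> B. \<psi> y \<in> A'}"
    using sub homeomorphism_apply1[OF *(3)] homeomorphism_apply2[OF *(3)] A'(2) by (auto simp: image_iff) (metis)
  have "open (\<phi> ` A')"
    unfolding eq using continuous_open_preimage[OF Ck_on_continuous[OF *(5)] *(2) A'(1)]
    by (simp add: vimage_def Int_def)
  then show ?thesis
    unfolding Ck_diffeo_def using A' hom Ck_on_subset[OF *(4) A'(2)] Ck_on_subset[OF *(5) sub] by blast
qed

lemma is_direct_sum_image:
  assumes M: "linear M" "\<And>v. M v = 0 \<Longrightarrow> v = 0" and s: "is_direct_sum V A B"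
  shows "is_direct_sum (M ` V) (M ` A) (M ` B)"
proof -
  have s': "subspace A" "subspace B" "A \<inter> B = {0}" "V = {a + b |a b. a \<in> A \<and> b \<in> B}"
    using s unfolding is_direct_sum_def by auto
  have inj: "M u = M v \<Longrightarrow> u = v" for u v using M(2)[of "u - v"] by (simp add: linear_diff[OF M(1)])
  have "M ` A \<inter> M ` B = {0}"
  proof
    show "M ` A \<inter> M ` B \<subseteq> {0}"
    proof
      fix x assume "x \<in> M ` A \<inter> M ` B"
      then obtain a b where ab: "a \<in> A" "b \<in> B" "x = M a" "x = M b" by blast
      then have "a = b" using inj by metis
      then have "a = 0" using ab s'(3) by blast
      then show "x \<in> {0}" using ab by (simp add: linear_0[OF M(1)])
    qed
    show "{0} \<subseteq> M ` A \<inter> M ` B" using subspace_0[OF s'(1)] subspace_0[OF s'(2)] linear_0[OF M(1)] by (metis IntI empty_subsetI imageI insert_subset)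
  qed
  moreover have "M ` V = {a + b |a b. a \<in> M ` A \<and> b \<in> M ` B}"
  proof
    show "M ` V \<subseteq> {a + b |a b. a \<in> M ` A \<and> b \<in> M ` B}"
      unfolding s'(4) using linear_add[OF M(1)] by blast
    show "{a + b |a b. a \<in> M ` A \<and> b \<in> M ` B} \<subseteq> M ` V"
    proof
      fix x assume "x \<in> {a + b |a b. a \<in> M ` A \<and> b \<in> M ` B}"
      then obtain a b where "a \<in> A" "b \<in> B" "x = M (a + b)" using linear_add[OF M(1)] by fastforce
      then show "x \<in> M ` V" unfolding s'(4) by blast
    qed
  qed
  ultimately show ?thesis
    unfolding is_direct_sum_def using linear_subspace_image[OF M(1)] s'(1,2) by blast
qed

text \<open>The component of \<open>e\<close> in \<open>B\<close> satisfies the same eigenvector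
  equation, since the defect lies in both summands; but \<open>D\<close> has no eigenvalue of
  modulus 1 on \<open>B\<close>.\<close>

lemma splitting_eigenvector_mem:
  assumes lin: "linear D" and s: "is_direct_sum N A B" and inv: "D ` A \<subseteq> A" "D ` B \<subseteq> B"
    and ev: "restricted_eigenvalues D B \<subseteq> {-1<..<1}" and e: "e \<in> N" "D e = r *\<^sub>R e" "\<bar>r\<bar> = 1"
  shows "e \<in> A"
proof -
  have s': "subspace A" "subspace B" "A \<inter> B = {0}" "N = {a + b |a b. a \<in> A \<and> b \<in> B}"
    using s unfolding is_direct_sum_def by auto
  obtain a b where ab: "a \<in> A" "b \<in> B" "e = a + b" using e(1) s'(4) by blast
  have "D a - r *\<^sub>R a = r *\<^sub>R b - D b"
    using e(2) unfolding ab(3) by (simp add: linear_add[OF lin] scaleR_add_right algebra_simps)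
  moreover have "D a - r *\<^sub>R a \<in> A" using ab inv s' by (auto intro!: subspace_diff subspace_scale)
  moreover have "r *\<^sub>R b - D b \<in> B" using ab inv s' by (auto intro!: subspace_diff subspace_scale)
  ultimately have "r *\<^sub>R b - D b = 0" using s'(3) by (metis IntI singletonD)
  then have "D b = r *\<^sub>R b" by simp
  then have "b \<noteq> 0 \<Longrightarrow> r \<in> restricted_eigenvalues D B" using ab(2) unfolding restricted_eigenvalues_def by blast
  then have "b = 0" using ev e(3) by fastforce
  then show ?thesis using ab by simp
qed

text \<open>A single chart suffices: its domain is shrunk so that its range is convex, and then the leaves are
  exactly the plaques.\<close>

lemma centre_foliation_of_chart:
  fixes \<phi> \<psi> :: "'a::euclidean_space \<Rightarrow> 'a" and T Wg :: "'a set"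
  assumes d: "Ck_diffeo (Suc k) A B \<phi> \<psi>" and B: "convex B"
    and L: "is_direct_sum L L1 P2" "subspace L" "dim L = d" "dim P2 = q"
    and W: "A \<inter> Wg = \<psi> ` (B \<inter> L)" and T: "A \<inter> T = \<psi> ` (B \<inter> L1)"
    and E: "\<And>l. l \<in> B \<inter> L1 \<Longrightarrow> frechet_derivative \<psi> (at l) ` P2 = Ec (\<psi> l)"
    and f: "continuous_on UNIV f" "\<And>x. x \<in> A \<inter> T \<Longrightarrow> f x = x" "\<And>x. x \<in> A \<inter> Wg \<Longrightarrow> f x \<in> Wg"
  shows "openin (top_of_set T) (T \<inter> A)"
    "centre_manifold (Suc k) d f (T \<inter> A) (A \<inter> Wg)"
    "\<And>x. x \<in> T \<inter> A \<Longrightarrow> is_direct_sum (tangent_space (A \<inter> Wg) x) (tangent_space (T \<inter> A) x) (Ec x)"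
    "\<exists>LL. Ck_foliation (Suc k) q d (A \<inter> Wg) LL \<and> (\<forall>F\<in>LL. \<forall>x\<in>(T \<inter> A) \<inter> F. tangent_space F x = Ec x)"
proof -
  have A: "open A" "open B" "homeomorphism A B \<phi> \<psi>" "Ck_on (Suc k) \<phi> A" "Ck_on (Suc k) \<psi> B"
    using d unfolding Ck_diffeo_def by auto
  have s: "subspace L1" "subspace P2" "L = {a + b |a b. a \<in> L1 \<and> b \<in> P2}" using L(1) unfolding is_direct_sum_def by auto
  have sum: "a + b \<in> L" if "a \<in> L1" "b \<in> P2" for a b unfolding s(3) using that by blast
  have L1L: "L1 \<subseteq> L" and P2L: "P2 \<subseteq> L"
    using sum[OF _ subspace_0[OF s(2)]] sum[OF subspace_0[OF s(1)]] by auto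
  have \<psi>A: "\<psi> z \<in> A" "\<phi> (\<psi> z) = z" if "z \<in> B" for z
    using that homeomorphism_image2[OF A(3)] homeomorphism_apply2[OF A(3)] by auto
  have inj: "z = z'" if "z \<in> B" "z' \<in> B" "\<psi> z = \<psi> z'" for z z' using \<psi>A that by metis
  have \<phi>\<psi>: "\<phi> ` (\<psi> ` X) = X" if "X \<subseteq> B" for X
  proof -
    have "(\<lambda>x. \<phi> (\<psi> x)) ` X = (\<lambda>x. x) ` X" by (rule image_cong) (use that \<psi>A(2) in auto)
    then show ?thesis by (simp add: image_image)
  qed
  let ?W = "A \<inter> Wg"
  have \<phi>W: "\<phi> ` (A \<inter> ?W) = B \<inter> L"
  proof -
    have "A \<inter> ?W = \<psi> ` (B \<inter> L)" using W by blast
    then show ?thesis using \<phi>\<psi>[of "B \<inter> L"] by (simp only: Int_lower1)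
  qed
  have sub: "Ck_submanifold (Suc k) d ?W"
    unfolding Ck_submanifold_def
  proof
    fix p assume "p \<in> ?W"
    then show "\<exists>A B (\<phi>::'a \<Rightarrow> 'a) \<psi> L. p \<in> A \<and> Ck_diffeo (Suc k) A B \<phi> \<psi> \<and> subspace L \<and> dim L = d \<and> \<phi> ` (A \<inter> ?W) = B \<inter> L"
      using d L(2,3) \<phi>W
      by (intro exI[of _ A] exI[of _ B] exI[of _ \<phi>] exI[of _ \<psi>] exI[of _ L]) auto
  qed
  show "openin (top_of_set T) (T \<inter> A)" using A(1) by (rule openin_open_Int)
  show "centre_manifold (Suc k) d f (T \<inter> A) ?W"
    unfolding centre_manifold_def
  proof (intro conjI sub exI)
    show "T \<inter> A \<subseteq> ?W" using W T L1L by blast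
    \<comment> \<open>\<open>f\<close> keeps points in \<open>Wg\<close> but may move them out of
      \<open>A\<close>. Passing to the preimage of \<open>A\<close> repairs this, and still leaves
      all of \<open>T \<inter> A\<close>, which \<open>f\<close> fixes pointwise.\<close>
    have "openin (top_of_set ?W) (?W \<inter> f -` A)"
      using continuous_openin_preimage_gen[OF continuous_on_subset[OF f(1) subset_UNIV] A(1)] .
    then show "openin (top_of_set ?W) (?W \<inter> f -` A)" .
    show "T \<inter> A \<subseteq> ?W \<inter> f -` A"
    proof
      fix x assume x: "x \<in> T \<inter> A"
      then have "x \<in> \<psi> ` (B \<inter> L)" using T L1L by blast
      then show "x \<in> ?W \<inter> f -` A" using W x f(2)[of x] by auto
    qed
    show "f ` (?W \<inter> f -` A) \<subseteq> ?W" using f(3) by blast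
  qed
  have slice: "{z \<in> B. z - c \<in> V} = B \<inter> V" if "subspace V" "c \<in> V" for c V
  proof -
    have "z - c \<in> V \<longleftrightarrow> z \<in> V" for z
      using subspace_diff[OF that(1) _ that(2), of z] subspace_add[OF that(1) _ that(2), of "z - c"] by auto
    then show ?thesis by blast
  qed
  have inj': "v = 0" if "frechet_derivative \<psi> (at l) v = 0" "l \<in> B" for v l
    using Ck_diffeo_derivatives(1)[OF Ck_diffeo_sym[OF d] that(2), of v] that(1)
      linear_0[OF linear_frechet_derivative[OF Ck_on_differentiable[OF A(4) \<psi>A(1)[OF that(2)]]]] by simp
  show "is_direct_sum (tangent_space ?W x) (tangent_space (T \<inter> A) x) (Ec x)" if x: "x \<in> T \<inter> A" for x
  proof -
    obtain l where l: "l \<in> B" "l \<in> L1" "x = \<psi> l" using x T by blast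
    have "tangent_space ?W x = frechet_derivative \<psi> (at l) ` L"
      unfolding W l(3) using tangent_space_slice[OF d L(2) l(1)] slice[OF L(2), of l] l(2) L1L by auto
    moreover have "tangent_space (T \<inter> A) x = frechet_derivative \<psi> (at l) ` L1"
      using tangent_space_slice[OF d s(1) l(1)] slice[OF s(1) l(2)] T unfolding l(3) by (simp add: Int_commute)
    moreover have "Ec x = frechet_derivative \<psi> (at l) ` P2" using E l by auto
    moreover have "linear (frechet_derivative \<psi> (at l))"
      by (rule linear_frechet_derivative[OF Ck_on_differentiable[OF A(5) l(1)]])
    ultimately show ?thesis using is_direct_sum_image[OF _ inj'[OF _ l(1)] L(1)] by simp
  qed
  define leaf where "leaf = (\<lambda>c. \<psi> ` {z \<in> B. z - c \<in> P2})"
  have leafeq: "leaf c = leaf c'" if "c - c' \<in> P2" for c c'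
  proof -
    have "z - c \<in> P2 \<longleftrightarrow> z - c' \<in> P2" for z
      using that subspace_add[OF s(2), of "z - c" "c - c'"] subspace_diff[OF s(2), of "z - c'" "c - c'"] by auto
    then show ?thesis unfolding leaf_def by simp
  qed
  have conv: "convex {z \<in> B. z - c \<in> P2}" for c
  proof -
    have "{z \<in> B. z - c \<in> P2} = B \<inter> (+) c ` P2" by (force simp: image_iff algebra_simps)
    then show ?thesis using B subspace_imp_convex[OF s(2)] by (simp add: convex_Int convex_translation)
  qed
  have pc: "path_connected (leaf c)" for c
    unfolding leaf_def
    by (rule path_connected_continuous_image[OF continuous_on_subset[OF Ck_on_continuous[OF A(5)]] convex_imp_path_connected[OF conv]]) auto
  define LL where "LL = leaf ` (B \<inter> L)"
  have mem: "\<psi> c \<in> leaf c" if "c \<in> B" for c unfolding leaf_def using that subspace_0[OF s(2)] by auto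
  have leafA: "leaf c \<subseteq> A" for c unfolding leaf_def using \<psi>A(1) by blast
  have "Ck_foliation (Suc k) q d ?W LL"
    unfolding Ck_foliation_def
  proof (intro conjI ballI)
    show "\<Union> LL = ?W"
    proof
      show "\<Union> LL \<subseteq> ?W"
      proof
        fix x assume "x \<in> \<Union> LL"
        then obtain c z where cz: "c \<in> L" "z \<in> B" "z - c \<in> P2" "x = \<psi> z" unfolding LL_def leaf_def by blast
        have "z = c + (z - c)" by simp
        then have "z \<in> L" using subspace_add[OF L(2) cz(1)] cz(3) P2L by (metis subsetD)
        then show "x \<in> ?W" unfolding W using cz by blast
      qed
      show "?W \<subseteq> \<Union> LL" unfolding W LL_def using mem by blast
    qed
    show "pairwise disjnt LL"
    proof (rule pairwiseI)
      fix F F' assume FF: "F \<in> LL" "F' \<in> LL" "F \<noteq> F'"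
      obtain c c' where cc: "F = leaf c" "F' = leaf c'" using FF unfolding LL_def by blast
      show "disjnt F F'"
      proof (rule ccontr)
        assume "\<not> disjnt F F'"
        then obtain z z' where z: "z \<in> B" "z' \<in> B" "z - c \<in> P2" "z' - c' \<in> P2" "\<psi> z = \<psi> z'"
          unfolding disjnt_def cc leaf_def by blast
        then have "z = z'" using inj by blast
        then have "leaf c = leaf c'" using leafeq[OF z(3)] leafeq[OF z(4)] by simp
        then show False using FF(3) cc by simp
      qed
    qed
    show "F \<noteq> {}" "path_connected F" if "F \<in> LL" for F using that mem pc unfolding LL_def by blast+
    fix p assume p: "p \<in> ?W"
    have "\<exists>c\<in>L. \<phi> ` C = {z \<in> B. z - c \<in> P2}" if F: "F \<in> LL" "C \<in> components (A \<inter> F)" for F C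
    proof -
      obtain c where c: "c \<in> B" "c \<in> L" "F = leaf c" using F(1) unfolding LL_def by blast
      have AF: "A \<inter> F = leaf c" using leafA c by blast
      have "components (leaf c) = {leaf c}"
        using path_connected_imp_connected[OF pc] mem[OF c(1)] by (metis components_eq_sing_iff empty_iff)
      then have "C = leaf c" using F(2) AF by simp
      then have "\<phi> ` C = {z \<in> B. z - c \<in> P2}" unfolding leaf_def using \<phi>\<psi>[of "{z \<in> B. z - c \<in> P2}"] by auto
      then show ?thesis using c(2) by blast
    qed
    then have leaves: "\<forall>F\<in>LL. \<forall>C\<in>components (A \<inter> F). \<exists>c\<in>L. \<phi> ` C = {z \<in> B. z - c \<in> P2}" by blast
    have pA: "p \<in> A" using p by simp
    show "\<exists>A B (\<phi>::'a \<Rightarrow> 'a) \<psi> L P. p \<in> A \<and> Ck_diffeo (Suc k) A B \<phi> \<psi> \<and> subspace L \<and> dim L = d \<and>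
        \<phi> ` (A \<inter> ?W) = B \<inter> L \<and> subspace P \<and> dim P = q \<and> P \<subseteq> L \<and>
        (\<forall>F\<in>LL. \<forall>C\<in>components (A \<inter> F). \<exists>c\<in>L. \<phi> ` C = {z \<in> B. z - c \<in> P})"
      by (intro exI[of _ A] exI[of _ B] exI[of _ \<phi>] exI[of _ \<psi>] exI[of _ L] exI[of _ P2] conjI)
        (rule pA d L(2,3,4) \<phi>W s(2) P2L leaves)+
  qed
  moreover have "tangent_space F x = Ec x" if F: "F \<in> LL" "x \<in> (T \<inter> A) \<inter> F" for F x
  proof -
    obtain l where l: "l \<in> B" "l \<in> L1" "x = \<psi> l" using F(2) T by blast
    obtain c where c: "F = leaf c" using F(1) unfolding LL_def by blast
    then obtain z where z: "z \<in> B" "z - c \<in> P2" "x = \<psi> z" using F(2) unfolding leaf_def by blast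
    then have "F = leaf l" using inj l leafeq[OF z(2)] c by metis
    then show ?thesis unfolding leaf_def l(3) using tangent_space_slice[OF d s(2) l(1)] E l by auto
  qed
  ultimately show "\<exists>LL. Ck_foliation (Suc k) q d ?W LL \<and> (\<forall>F\<in>LL. \<forall>x\<in>(T \<inter> A) \<inter> F. tangent_space F x = Ec x)"
    by blast
qed

section \<open>Gradient descent near a regular level set\<close>

text \<open>The chart \<open>\<Psi>\<close> constructed below is explicit only along certain lines,
  so its derivative is computed direction by direction from the values there.\<close>

lemma line_derivative_eq:
  fixes F :: "'a::real_normed_vector \<Rightarrow> 'b::real_normed_vector" and E :: "'c::real_normed_vector \<Rightarrow> 'b"
  assumes F: "(F has_derivative F') (at l)" and E: "(E has_derivative E') (at z)"
    and "open O'" "0 \<in> O'" and eq: "\<And>r. r \<in> O' \<Longrightarrow> F (l + r *\<^sub>R d) = E (z + r *\<^sub>R e)"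
  shows "F' d = E' e"
proof -
  have line: "((\<lambda>r::real. c + r *\<^sub>R d) has_derivative (\<lambda>r. r *\<^sub>R d)) (at 0)" for c d :: "'x::real_normed_vector"
    by (auto intro!: derivative_eq_intros)
  have "((\<lambda>r. F (l + r *\<^sub>R d)) has_derivative (\<lambda>r. F' (r *\<^sub>R d))) (at 0)"
    by (rule has_derivative_compose[OF line]) (simp add: F)
  moreover have "((\<lambda>r. F (l + r *\<^sub>R d)) has_derivative (\<lambda>r. E' (r *\<^sub>R e))) (at 0)"
  proof (rule has_derivative_transform_within_open[OF _ assms(3,4)])
    show "((\<lambda>r. E (z + r *\<^sub>R e)) has_derivative (\<lambda>r. E' (r *\<^sub>R e))) (at 0)"
      by (rule has_derivative_compose[OF line]) (simp add: E)
  qed (simp add: eq)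
  ultimately have "(\<lambda>r. F' (r *\<^sub>R d)) = (\<lambda>r. E' (r *\<^sub>R e))" by (rule has_derivative_unique)
  from fun_cong[OF this, of 1] show ?thesis by simp
qed

lemma frechet_derivative_snd:
  assumes F: "F differentiable (at (a, b))" and F': "((\<lambda>z. F (a, z)) has_derivative F') (at b)"
  shows "frechet_derivative F (at (a, b)) (0, w) = F' w"
proof -
  have "((\<lambda>z. (a, z)) has_derivative (\<lambda>w. (0, w))) (at b)" by (auto intro!: derivative_eq_intros)
  then have "((\<lambda>z. F (a, z)) has_derivative (\<lambda>w. frechet_derivative F (at (a, b)) (0, w))) (at b)"
    by (rule has_derivative_compose) (rule differentiable_has_derivative[OF F])
  from has_derivative_unique[OF this F'] show ?thesis by (rule fun_cong)
qed

lemma quadratic_form_bound: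
  fixes A :: "'a::euclidean_space \<Rightarrow> 'a"
  assumes lin: "linear A" and sym: "\<And>x y. A x \<bullet> y = x \<bullet> A y" and v: "norm v = 1" "A v = \<mu> *\<^sub>R v"
    and r: "\<And>u. u \<bullet> v = 0 \<Longrightarrow> u \<bullet> A u \<le> r * (u \<bullet> u)"
  shows "u \<bullet> A u \<le> r * (u \<bullet> u) + (\<mu> - r) * (u \<bullet> v)\<^sup>2"
proof -
  define c where "c = u \<bullet> v"
  define u' where "u' = u - c *\<^sub>R v"
  have vv: "v \<bullet> v = 1" using v(1) by (simp add: norm_eq_1)
  have o: "u' \<bullet> v = 0" unfolding u'_def c_def using vv by (simp add: inner_diff_left)
  have u: "u = u' + c *\<^sub>R v" unfolding u'_def by simp
  have oA: "v \<bullet> A u' = 0" using sym[of v u'] v(2) o by (simp add: inner_commute)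
  have "u \<bullet> A u = u' \<bullet> A u' + \<mu> * c\<^sup>2"
    unfolding u using o oA vv v(2)
    by (simp add: linear_add[OF lin] linear_scale[OF lin] inner_add_left inner_add_right inner_commute[of v u'] power2_eq_square)
  moreover have "u \<bullet> u = u' \<bullet> u' + c\<^sup>2"
    unfolding u using o vv by (simp add: inner_add_left inner_add_right inner_commute[of v u'] power2_eq_square)
  ultimately show ?thesis using r[OF o] unfolding c_def[symmetric] by (simp add: algebra_simps)
qed

section \<open>The loss and the gradient descent map on the level set\<close>

locale regular_level =
  fixes g :: "real^'n \<Rightarrow> real^'m" and y :: "real^'m"
  assumes smooth: "smooth_on g UNIV" and regular: "regular_value g y" and dims: "CARD('m) < CARD('n)"
begin

definition dg :: "real^'n \<Rightarrow> real^'n \<Rightarrow> real^'m" where "dg x = frechet_derivative g (at x)"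

text \<open>The transpose of \<open>dg x\<close>, expanded in the standard basis.\<close>

definition dgT :: "real^'n \<Rightarrow> real^'m \<Rightarrow> real^'n" where "dgT x z = (\<Sum>b\<in>Basis. (dg x b \<bullet> z) *\<^sub>R b)"

text \<open>It coincides with the Hessian of the loss where \<open>g x = y\<close>, but is symmetric
  and positive semidefinite everywhere, so the top eigenpair can be continued to an open subset of
  the whole space.\<close>

definition G :: "real^'n \<Rightarrow> real^'n \<Rightarrow> real^'n" where "G x v = dgT x (dg x v)"

lemma gC: "Ck_on k g UNIV" using smooth unfolding smooth_on_def by blast

lemma hd_g: "(g has_derivative dg x) (at x)" unfolding dg_def using Ck_on_has_derivative[OF gC UNIV_I] .

lemma lin_dg: "linear (dg x)" using has_derivative_linear[OF hd_g] .

lemma lin_dgT: "linear (dgT x)"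
  unfolding dgT_def by (auto intro!: linearI simp: inner_add_right scaleR_add_left sum.distrib scaleR_sum_right)

lemma inner_dgT: "u \<bullet> dgT x z = dg x u \<bullet> z"
  unfolding dgT_def linear_Basis_expansion[OF lin_dg, of x u]
  by (simp add: inner_sum_right inner_sum_left mult.commute)

lemma inner_dgT': "dgT x z \<bullet> u = dg x u \<bullet> z"
  using inner_dgT[of u x z] by (simp add: inner_commute)

lemma lin_G: "linear (G x)"
  unfolding G_def[abs_def] using linear_compose[OF lin_dg lin_dgT] by (simp add: o_def)

lemma inner_G: "u \<bullet> G x v = dg x u \<bullet> dg x v"
  unfolding G_def by (rule inner_dgT)

lemma sym_G: "G x u \<bullet> v = u \<bullet> G x v"
  using inner_G[of v x u] inner_G[of u x v] by (simp add: inner_commute)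

lemma G_eq_0_iff: "G x v = 0 \<longleftrightarrow> dg x v = 0"
proof
  assume "G x v = 0"
  then have "v \<bullet> G x v = 0" by simp
  then show "dg x v = 0" unfolding inner_G by simp
qed (simp add: G_def linear_0[OF lin_dgT])

lemma dgT_inj: "g x = y \<Longrightarrow> dgT x z = 0 \<Longrightarrow> z = 0"
proof -
  assume x: "g x = y" and z: "dgT x z = 0"
  have "surj (dg x)" using regular x unfolding regular_value_def dg_def by blast
  then obtain u where "z = dg x u" by (rule surjE)
  then have "z \<bullet> z = u \<bullet> dgT x z" unfolding inner_dgT by simp
  then show "z = 0" using z by simp
qed

lemma Ck_dg:
  assumes "open S" "Ck_on k u S" "Ck_on k w S"
  shows "Ck_on k (\<lambda>x. dg (u x) (w x)) S"
  unfolding dg_def by (rule Ck_on_frechet_apply[OF assms(1) open_UNIV subset_UNIV gC assms(2,3)])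

lemma Ck_dgT:
  assumes "open S" "Ck_on k u S" "Ck_on k w S"
  shows "Ck_on k (\<lambda>x. dgT (u x) (w x)) S"
  unfolding dgT_def by (intro Ck_on_sum Ck_on_scaleR Ck_on_inner Ck_dg Ck_on_const assms)

lemma Ck_G:
  assumes "open S" "Ck_on k u S" "Ck_on k w S"
  shows "Ck_on k (\<lambda>x. G (u x) (w x)) S"
  unfolding G_def by (intro Ck_dgT Ck_dg assms)

lemma gradient_loss: "gradient (loss g y) x = dgT x (g x - y)"
proof -
  have "(loss g y has_derivative (\<lambda>h. h \<bullet> dgT x (g x - y))) (at x)"
  proof -
    have l: "loss g y = (\<lambda>x. 1 / 2 * ((y - g x) \<bullet> (y - g x)))"
      unfolding loss_def by (simp add: power2_norm_eq_inner fun_eq_iff)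
    have "(loss g y has_derivative (\<lambda>h. 1 / 2 * ((y - g x) \<bullet> (0 - dg x h) + (0 - dg x h) \<bullet> (y - g x)))) (at x)"
      unfolding l by (intro has_derivative_mult_right has_derivative_inner has_derivative_diff has_derivative_const hd_g)
    moreover have "(\<lambda>h. 1 / 2 * ((y - g x) \<bullet> (0 - dg x h) + (0 - dg x h) \<bullet> (y - g x))) = (\<lambda>h. h \<bullet> dgT x (g x - y))"
      unfolding inner_dgT by (simp add: fun_eq_iff inner_commute[of "y - g x"] inner_diff_right)
    ultimately show ?thesis by simp
  qed
  then have D: "GDERIV (loss g y) x :> dgT x (g x - y)" unfolding gderiv_def .
  show ?thesis unfolding gradient_def
  proof (rule the_equality, rule D)
    fix D' assume "GDERIV (loss g y) x :> D'"
    then have "(\<lambda>h. h \<bullet> D') = (\<lambda>h. h \<bullet> dgT x (g x - y))"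
      using D unfolding gderiv_def by (rule has_derivative_unique)
    then show "D' = dgT x (g x - y)" by (metis vector_eq_ldot)
  qed
qed

text \<open>The second derivatives of \<open>g\<close> occur with the factor \<open>g x - y\<close>,
  which vanishes on the level set; only \<open>G x\<close> is left.\<close>

lemma hd_gradient:
  assumes "g x = y"
  shows "((\<lambda>x. dgT x (g x - y)) has_derivative G x) (at x)"
proof -
  have hdb: "((\<lambda>x. dg x b) has_derivative frechet_derivative (\<lambda>x. dg x b) (at x)) (at x)" for b
    using Ck_on_has_derivative[OF Ck_dg[OF open_UNIV Ck_on_ident[OF open_UNIV] Ck_on_const] UNIV_I] .
  have "((\<lambda>x. dgT x (g x - y)) has_derivative
     (\<lambda>v. \<Sum>b\<in>Basis. (dg x b \<bullet> (dg x v - 0) + frechet_derivative (\<lambda>x. dg x b) (at x) v \<bullet> (g x - y)) *\<^sub>R b)) (at x)"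
    unfolding dgT_def
    by (intro has_derivative_sum has_derivative_scaleR_left has_derivative_inner hdb has_derivative_diff hd_g has_derivative_const)
  moreover have "G x = (\<lambda>v. \<Sum>b\<in>Basis. (dg x b \<bullet> dg x v) *\<^sub>R b)"
    unfolding G_def[abs_def] dgT_def ..
  ultimately show ?thesis by (simp add: assms)
qed

lemma lam_eq: "g x = y \<Longrightarrow> lam g y i x = eigenvalue_nr (G x) i"
proof -
  assume x: "g x = y"
  have "gradient (loss g y) = (\<lambda>x. dgT x (g x - y))" using gradient_loss by auto
  then have "hessian (loss g y) x = G x"
    unfolding hessian_def using frechet_derivative_eqI[OF hd_gradient[OF x]] by simp
  then show "lam g y i x = eigenvalue_nr (G x) i" unfolding lam_def by simp
qed

lemma gd_step_eq: "gd_step g y = (\<lambda>z. (fst z - snd z *\<^sub>R dgT (fst z) (g (fst z) - y), snd z))"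
  unfolding gd_step_def gradient_loss by (auto simp: fun_eq_iff)

lemma Ck_gd_step: "Ck_on k (gd_step g y) UNIV"
  unfolding gd_step_eq
  by (intro Ck_on_Pair Ck_on_diff Ck_on_scaleR Ck_dgT Ck_on_fst Ck_on_snd Ck_on_ident Ck_on_const open_UNIV
      Ck_on_compose[OF open_UNIV open_UNIV subset_UNIV gC])

lemma gd_step_fixed: "g x = y \<Longrightarrow> gd_step g y (x, \<eta>) = (x, \<eta>)"
  unfolding gd_step_eq by (simp add: linear_0[OF lin_dgT])

lemma gd_step_derivative:
  assumes "g x = y"
  shows "frechet_derivative (gd_step g y) (at (x, \<eta>)) = (\<lambda>v. (fst v - \<eta> *\<^sub>R G x (fst v), snd v))"
proof -
  have f: "(fst has_derivative fst) (at (x, \<eta>))" and s: "(snd has_derivative snd) (at (x, \<eta>))"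
    using bounded_linear_imp_has_derivative[OF bounded_linear_fst] bounded_linear_imp_has_derivative[OF bounded_linear_snd] by blast+
  have "((\<lambda>z. dgT (fst z) (g (fst z) - y)) has_derivative (\<lambda>v. G x (fst v))) (at (x, \<eta>))"
    by (rule has_derivative_compose[OF f]) (simp add: hd_gradient[OF assms])
  from has_derivative_Pair[OF has_derivative_diff[OF f has_derivative_scaleR[OF s this]] s]
  have "(gd_step g y has_derivative (\<lambda>v. (fst v - (\<eta> *\<^sub>R G x (fst v) + snd v *\<^sub>R dgT x (g x - y)), snd v))) (at (x, \<eta>))"
    unfolding gd_step_eq by simp
  then show ?thesis using frechet_derivative_eqI by (simp add: assms linear_0[OF lin_dgT]) blast
qed

lemma DIM_ge_2: "DIM(real^'n) \<ge> 2"
proof -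
  have "1 \<le> CARD('m)" by (simp add: Suc_le_eq)
  then have "2 \<le> CARD('n)" using dims by linarith
  then show ?thesis by simp
qed

text \<open>The kernel is the orthogonal complement of the range of the transpose, which is
  injective at a regular point.\<close>

lemma dim_kernel:
  assumes "g x = y"
  shows "dim {t. dg x t = 0} = CARD('n) - CARD('m)"
proof -
  have inj: "inj (dgT x)" using dgT_inj[OF assms] by (simp add: linear_injective_0[OF lin_dgT])
  have sub: "subspace (range (dgT x))" by (rule linear_subspace_image[OF lin_dgT subspace_UNIV])
  have "{t. dg x t = 0} = {t \<in> UNIV. \<forall>w\<in>range (dgT x). orthogonal w t}"
  proof (intro set_eqI iffI)
    fix t assume "t \<in> {t \<in> UNIV. \<forall>w\<in>range (dgT x). orthogonal w t}"
    then have "dgT x (dg x t) \<bullet> t = 0" by (auto simp: orthogonal_def)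
    then show "t \<in> {t. dg x t = 0}" unfolding inner_dgT' by simp
  qed (auto simp: orthogonal_def inner_dgT')
  moreover have "dim (range (dgT x)) = CARD('m)"
    using dim_image_eq[OF lin_dgT[of x], of UNIV] inj by (simp add: inj_on_def)
  moreover have "dim {t \<in> UNIV. \<forall>w\<in>range (dgT x). orthogonal w t} + dim (range (dgT x)) = dim (UNIV :: (real^'n) set)"
    by (rule dim_subspace_orthogonal_to_vectors[OF sub subspace_UNIV subset_UNIV])
  ultimately show ?thesis by simp
qed

section \<open>Smooth data near a point of T: top eigenpair and tangential gradient\<close>

text \<open>Implicit function theorem for \<open>G x v = \<mu> *\<^sub>R v\<close> with
  \<open>v\<close> normalised, in the unknowns \<open>v\<close> and \<open>\<mu>\<close>; simplicity
  makes the linearisation injective. The gap that certifies simplicity is then shown to persist, so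
  the continued eigenvalue remains the top one.\<close>

lemma top_eigenpair:
  assumes x0: "g x0 = y" and ne: "lam g y 1 x0 \<noteq> lam g y 2 x0"
  obtains X v \<mu> where "open X" "x0 \<in> X" "Ck_on (Suc k) v X" "Ck_on (Suc k) \<mu> X" "\<mu> x0 = lam g y 1 x0"
    "\<And>x. x \<in> X \<Longrightarrow> G x (v x) = \<mu> x *\<^sub>R v x" "\<And>x. x \<in> X \<Longrightarrow> norm (v x) = 1" "\<And>x. x \<in> X \<Longrightarrow> 0 < \<mu> x"
    "\<And>x. x \<in> X \<Longrightarrow> \<exists>r<\<mu> x. \<forall>u. u \<bullet> v x = 0 \<longrightarrow> u \<bullet> G x u \<le> r * (u \<bullet> u)"
proof -
  define \<nu> where "\<nu> = lam g y 1 x0"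
  have \<nu>: "\<nu> = eigenvalue_nr (G x0) 1" unfolding \<nu>_def lam_eq[OF x0] ..
  have ne': "eigenvalue_nr (G x0) 1 \<noteq> eigenvalue_nr (G x0) 2" using ne unfolding lam_eq[OF x0] .
  obtain v0 r0 where v0: "norm v0 = 1" "G x0 v0 = \<nu> *\<^sub>R v0" and r0: "r0 < \<nu>"
    "\<And>u. u \<bullet> v0 = 0 \<Longrightarrow> u \<bullet> G x0 u \<le> r0 * (u \<bullet> u)" "\<And>u. u \<bullet> G x0 u \<le> \<nu> * (u \<bullet> u)"
    by (rule eigenvalue_nr_simple_top[OF lin_G sym_G ne', folded \<nu>]) (rule that; assumption)
  have vv: "v0 \<bullet> v0 = 1" using v0(1) by (simp add: norm_eq_1)
  have \<nu>pos: "\<nu> > 0"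
  proof -
    obtain b :: "real^'m" where "b \<in> Basis" using nonempty_Basis by blast
    then have b: "b \<noteq> 0" by auto
    have "surj (dg x0)" using regular x0 unfolding regular_value_def dg_def by blast
    then obtain u where u: "b = dg x0 u" by (rule surjE)
    then have "0 < u \<bullet> G x0 u" unfolding inner_G using b by (simp add: u[symmetric])
    then have "0 < \<nu> * (u \<bullet> u)" using r0(3)[of u] by linarith
    then show ?thesis using inner_ge_zero[of u] by (auto simp: zero_less_mult_iff simp del: inner_ge_zero)
  qed
  define F where "F = (\<lambda>z::(real^'n) \<times> ((real^'n) \<times> real).
     (G (fst z) (fst (snd z)) - snd (snd z) *\<^sub>R fst (snd z), fst (snd z) \<bullet> fst (snd z) - 1))"
  have FC: "Ck_on (Suc k) F UNIV"
    unfolding F_def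
    by (intro Ck_on_Pair Ck_on_diff Ck_on_scaleR Ck_on_inner Ck_G Ck_on_fst Ck_on_snd Ck_on_ident Ck_on_const open_UNIV)
  have F0: "F (x0, (v0, \<nu>)) = 0" unfolding F_def using v0 vv by (simp add: zero_prod_def)
  have inj: "w = 0" if w: "frechet_derivative F (at (x0, (v0, \<nu>))) (0, w) = 0" for w
  proof -
    have blG: "bounded_linear (G x0)" using lin_G by (simp add: linear_conv_bounded_linear)
    have f: "(fst has_derivative fst) (at (v0, \<nu>))" and s: "(snd has_derivative snd) (at (v0, \<nu>))"
      using bounded_linear_imp_has_derivative[OF bounded_linear_fst] bounded_linear_imp_has_derivative[OF bounded_linear_snd] by blast+
    have hF: "((\<lambda>z. F (x0, z)) has_derivative (\<lambda>w. (G x0 (fst w) - (\<nu> *\<^sub>R fst w + snd w *\<^sub>R v0), v0 \<bullet> fst w + fst w \<bullet> v0 - 0))) (at (v0, \<nu>))"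
      unfolding F_def fst_conv snd_conv
      using has_derivative_Pair[OF has_derivative_diff[OF bounded_linear.has_derivative[OF blG f] has_derivative_scaleR[OF s f]]
         has_derivative_diff[OF has_derivative_inner[OF f f] has_derivative_const[of 1]]] by simp
    have "frechet_derivative F (at (x0, (v0, \<nu>))) (0, w) = (G x0 (fst w) - (\<nu> *\<^sub>R fst w + snd w *\<^sub>R v0), v0 \<bullet> fst w + fst w \<bullet> v0 - 0)"
      by (rule frechet_derivative_snd[OF Ck_on_differentiable[OF FC UNIV_I] hF])
    then have 1: "G x0 (fst w) = \<nu> *\<^sub>R fst w + snd w *\<^sub>R v0" and 2: "v0 \<bullet> fst w = 0"
      using w by (auto simp: zero_prod_def inner_commute)
    have "v0 \<bullet> G x0 (fst w) = \<nu> * (v0 \<bullet> fst w)" using sym_G[of x0 v0 "fst w"] v0(2) by simp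
    then have 3: "snd w = 0" using 1 2 vv by (simp add: inner_add_right)
    have "\<nu> * (fst w \<bullet> fst w) \<le> r0 * (fst w \<bullet> fst w)"
      using r0(2)[of "fst w"] 1 2 3 by (simp add: inner_commute)
    then have "fst w \<bullet> fst w = 0"
      using r0(1) mult_strict_right_mono[of r0 \<nu> "fst w \<bullet> fst w"] inner_ge_zero[of "fst w"] by fastforce
    then show "w = 0" using 3 by (simp add: prod_eq_iff)
  qed
  obtain A s where A: "open A" "x0 \<in> A" "Ck_on (Suc k) s A" "s x0 = (v0, \<nu>)" "\<And>x. x \<in> A \<Longrightarrow> (x, s x) \<in> UNIV \<and> F (x, s x) = 0"
    by (rule Ck_implicit_function[OF open_UNIV UNIV_I FC F0 inj]) (assumption | rule that)+
  define v where "v = (\<lambda>x. fst (s x))"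
  define \<mu> where "\<mu> = (\<lambda>x. snd (s x))"
  have vC: "Ck_on (Suc k) v A" and \<mu>C: "Ck_on (Suc k) \<mu> A"
    unfolding v_def \<mu>_def by (intro Ck_on_fst Ck_on_snd A)+
  have eig: "G x (v x) = \<mu> x *\<^sub>R v x" "norm (v x) = 1" if "x \<in> A" for x
    using A(5)[OF that] unfolding F_def v_def \<mu>_def by (auto simp: zero_prod_def norm_eq_1)
  have v\<mu>0: "v x0 = v0" "\<mu> x0 = \<nu>" unfolding v_def \<mu>_def by (simp_all add: A(4))
  \<comment> \<open>A nonnegative bound, so that its square root bounds
    \<open>norm (dg x0 u)\<close> for unit vectors \<open>u\<close> orthogonal to \<open>v0\<close>;
    it stays below \<nu> since \<nu> is positive.\<close>
  define r where "r = max r0 0"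
  have r: "0 \<le> r" "r < \<nu>" "\<And>u. u \<bullet> v0 = 0 \<Longrightarrow> u \<bullet> G x0 u \<le> r * (u \<bullet> u)"
  proof -
    show "0 \<le> r" "r < \<nu>" unfolding r_def using r0(1) \<nu>pos by auto
    fix u assume "u \<bullet> v0 = 0"
    then have "u \<bullet> G x0 u \<le> r0 * (u \<bullet> u)" by (rule r0(2))
    also have "\<dots> \<le> r * (u \<bullet> u)" unfolding r_def by (intro mult_right_mono) auto
    finally show "u \<bullet> G x0 u \<le> r * (u \<bullet> u)" .
  qed
  \<comment> \<open>If \<open>v x\<close> and \<open>dg x\<close> are within \<open>e\<close> of
    their values at \<open>x0\<close>, then
    \<open>u \<bullet> G x u \<le> \<rho> e * (u \<bullet> u)\<close> for \<open>u\<close>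
    orthogonal to \<open>v x\<close>. As \<open>e\<close> tends to 0, \<open>\<rho> e\<close> tends
    to \<open>r\<close> and falls below the midpoint of \<open>r\<close> and \<nu>, while
    \<open>\<mu> x\<close> is kept above it.\<close>
  define \<rho> where "\<rho> = (\<lambda>e. (sqrt (r + (\<nu> - r) * e\<^sup>2) + e)\<^sup>2)"
  have "(\<rho> \<longlongrightarrow> (sqrt (r + (\<nu> - r) * 0\<^sup>2) + 0)\<^sup>2) (at_right 0)" unfolding \<rho>_def by (intro tendsto_intros)
  then have "(\<rho> \<longlongrightarrow> r) (at_right 0)" using r(1) by simp
  then have "\<forall>\<^sub>F e in at_right 0. \<rho> e < (\<nu> + r) / 2" by (rule order_tendstoD(2)) (use r(2) in simp)
  moreover have "\<forall>\<^sub>F e in at_right (0::real). 0 < e" by (rule eventually_at_right_less)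
  ultimately have "\<forall>\<^sub>F e in at_right 0. \<rho> e < (\<nu> + r) / 2 \<and> 0 < e" by (rule eventually_conj)
  then obtain e where e: "\<rho> e < (\<nu> + r) / 2" "0 < e" using eventually_happens trivial_limit_at_right_real by blast
  obtain d where d: "d > 0" "\<And>x u. x \<in> ball x0 d \<Longrightarrow> norm (dg x u - dg x0 u) \<le> e * norm u"
    by (rule frechet_derivative_near[OF open_UNIV gC UNIV_I e(2), of x0, folded dg_def]) (rule that; assumption)
  define X where "X = A \<inter> (A \<inter> \<mu> -` {(\<nu> + r) / 2<..}) \<inter> (A \<inter> v -` ball v0 e) \<inter> ball x0 d"
  show ?thesis
  proof
    show "open X" unfolding X_def
      by (intro open_Int A continuous_open_preimage[OF Ck_on_continuous[OF \<mu>C]] continuous_open_preimage[OF Ck_on_continuous[OF vC]]) auto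
    show "x0 \<in> X" unfolding X_def using A(2) v\<mu>0 r(2) e(2) d(1) by auto
    show "Ck_on (Suc k) v X" "Ck_on (Suc k) \<mu> X"
      by (rule Ck_on_subset[OF vC], simp add: X_def subset_iff, rule Ck_on_subset[OF \<mu>C], simp add: X_def subset_iff)
    show "\<mu> x0 = lam g y 1 x0" using v\<mu>0 unfolding \<nu>_def by simp
    fix x assume x: "x \<in> X"
    then show "G x (v x) = \<mu> x *\<^sub>R v x" "norm (v x) = 1" unfolding X_def using eig by auto
    have \<mu>x: "(\<nu> + r) / 2 < \<mu> x" using x unfolding X_def by auto
    then show "0 < \<mu> x" using r(1) \<nu>pos by simp
    show "\<exists>r<\<mu> x. \<forall>u. u \<bullet> v x = 0 \<longrightarrow> u \<bullet> G x u \<le> r * (u \<bullet> u)"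
    proof (intro exI[of _ "\<rho> e"] conjI allI impI)
      show "\<rho> e < \<mu> x" using e(1) \<mu>x by simp
      fix u assume u: "u \<bullet> v x = 0"
      have "\<bar>u \<bullet> v0\<bar> = \<bar>u \<bullet> (v0 - v x)\<bar>" using u by (simp add: inner_diff_right)
      also have "\<dots> \<le> norm u * norm (v0 - v x)" by (rule Cauchy_Schwarz_ineq2)
      also have "\<dots> \<le> norm u * e" using x unfolding X_def by (intro mult_left_mono) (auto simp: dist_norm)
      finally have "(u \<bullet> v0)\<^sup>2 \<le> (norm u * e)\<^sup>2" by (metis abs_ge_zero power2_abs power_mono)
      then have "(\<nu> - r) * (u \<bullet> v0)\<^sup>2 \<le> (\<nu> - r) * (norm u * e)\<^sup>2" using r(2) by (intro mult_left_mono) auto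
      then have "(norm (dg x0 u))\<^sup>2 \<le> r * (u \<bullet> u) + (\<nu> - r) * (norm u * e)\<^sup>2"
        using quadratic_form_bound[OF lin_G sym_G v0 r(3), of u] unfolding inner_G power2_norm_eq_inner by linarith
      also have "\<dots> = (r + (\<nu> - r) * e\<^sup>2) * (norm u)\<^sup>2"
        by (simp add: power2_norm_eq_inner[symmetric] power_mult_distrib algebra_simps)
      also have "\<dots> = (sqrt (r + (\<nu> - r) * e\<^sup>2) * norm u)\<^sup>2"
        using r(1,2) by (simp add: power_mult_distrib)
      finally have "norm (dg x0 u) \<le> sqrt (r + (\<nu> - r) * e\<^sup>2) * norm u"
        by (rule power2_le_imp_le) (use r(1,2) in simp)
      moreover have "norm (dg x u - dg x0 u) \<le> e * norm u" using d(2) x unfolding X_def by auto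
      ultimately have "norm (dg x u) \<le> (sqrt (r + (\<nu> - r) * e\<^sup>2) + e) * norm u"
        using norm_triangle_ineq2[of "dg x u" "dg x0 u"] by (simp add: distrib_right)
      then have "(norm (dg x u))\<^sup>2 \<le> ((sqrt (r + (\<nu> - r) * e\<^sup>2) + e) * norm u)\<^sup>2" by (intro power_mono) auto
      then show "u \<bullet> G x u \<le> \<rho> e * (u \<bullet> u)"
        unfolding inner_G \<rho>_def by (simp add: power_mult_distrib power2_norm_eq_inner)
    qed
  qed
qed

text \<open>\<open>w x\<close> is the orthogonal projection of the gradient of \<tau> to the kernel
  of \<open>dg x\<close>, determined together with a Lagrange multiplier \<open>z\<close> by
  \<open>w + dgT x z = gr x\<close> and \<open>dg x w = 0\<close>. Solving this linear system by the
  implicit function theorem yields the regularity of \<open>w\<close> without a formula for the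
  inverse.\<close>

lemma tangential_gradient:
  fixes \<tau> :: "real^'n \<Rightarrow> real"
  assumes X: "open X" "x0 \<in> X" and x0: "g x0 = y" and \<tau>: "Ck_on (Suc (Suc k)) \<tau> X"
  obtains X' w where "open X'" "x0 \<in> X'" "X' \<subseteq> X" "Ck_on (Suc k) w X'"
    "\<And>x. x \<in> X' \<Longrightarrow> dg x (w x) = 0" "\<And>x t. x \<in> X' \<Longrightarrow> dg x t = 0 \<Longrightarrow> w x \<bullet> t = frechet_derivative \<tau> (at x) t"
proof -
  define gr where "gr = (\<lambda>x. \<Sum>b\<in>Basis. frechet_derivative \<tau> (at x) b *\<^sub>R b)"
  have gr: "gr x \<bullet> t = frechet_derivative \<tau> (at x) t" if "x \<in> X" for x t
    unfolding gr_def inner_sum_left inner_scaleR_left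
    using linear_Basis_expansion[OF linear_frechet_derivative[OF Ck_on_differentiable[OF \<tau> that]], of t]
    by (simp add: inner_commute[of t] mult.commute)
  define S where "S = (fst -` X :: ((real^'n) \<times> ((real^'n) \<times> (real^'m))) set)"
  have S: "open S" unfolding S_def by (intro open_vimage X continuous_intros)
  have fS: "fst ` S \<subseteq> X" unfolding S_def by auto
  define F where "F = (\<lambda>z::(real^'n) \<times> ((real^'n) \<times> (real^'m)).
     (fst (snd z) + dgT (fst z) (snd (snd z)) - gr (fst z), dg (fst z) (fst (snd z))))"
  have grC: "Ck_on (Suc k) (\<lambda>z::(real^'n) \<times> ((real^'n) \<times> (real^'m)). gr (fst z)) S"
    unfolding gr_def
    by (intro Ck_on_sum Ck_on_scaleR Ck_on_const S Ck_on_compose[OF S X(1) fS Ck_on_frechet[OF \<tau>]] Ck_on_fst Ck_on_ident)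
  have FC: "Ck_on (Suc k) F S"
    unfolding F_def
    by (intro Ck_on_Pair Ck_on_diff Ck_on_add Ck_dgT Ck_dg Ck_on_fst Ck_on_snd Ck_on_ident Ck_on_const S grC)
  define M where "M = (\<lambda>w. (fst w + dgT x0 (snd w), dg x0 (fst w)))"
  have linM: "linear M"
    unfolding M_def by (rule linearI) (auto simp: linear_add[OF lin_dgT] linear_add[OF lin_dg] linear_scale[OF lin_dgT] linear_scale[OF lin_dg] scaleR_add_right)
  have M0: "w = 0" if "M w = 0" for w
  proof -
    have 1: "fst w + dgT x0 (snd w) = 0" "dg x0 (fst w) = 0" using that unfolding M_def by (auto simp: zero_prod_def)
    have "fst w \<bullet> (fst w + dgT x0 (snd w)) = 0" using 1(1) by simp
    then have "fst w = 0" using 1(2) by (simp add: inner_add_right inner_dgT)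
    then have "snd w = 0" using 1(1) dgT_inj[OF x0] by simp
    with \<open>fst w = 0\<close> show ?thesis by (simp add: prod_eq_iff)
  qed
  have "inj M" using M0 by (simp add: linear_injective_0[OF linM])
  then have "surj M" by (rule linear_injective_imp_surjective[OF linM]) (rule refl)
  then obtain w0 where w0: "(gr x0, 0) = M w0" by (rule surjE)
  have in0: "(x0, w0) \<in> S" unfolding S_def using X(2) by simp
  have F0: "F (x0, w0) = 0" using w0 unfolding F_def M_def by (auto simp: zero_prod_def)
  have inj: "w = 0" if "frechet_derivative F (at (x0, w0)) (0, w) = 0" for w
  proof (rule M0)
    have "(\<lambda>z. F (x0, z)) = (\<lambda>z. M z - (gr x0, 0))" unfolding F_def M_def by (auto simp: fun_eq_iff)
    moreover have "((\<lambda>z. M z - (gr x0, 0)) has_derivative (\<lambda>w. M w - 0)) (at w0)"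
      by (intro has_derivative_diff has_derivative_const bounded_linear_imp_has_derivative) (use linM in \<open>simp add: linear_conv_bounded_linear\<close>)
    ultimately have "((\<lambda>z. F (x0, z)) has_derivative M) (at w0)" by simp
    from frechet_derivative_snd[OF Ck_on_differentiable[OF FC in0] this] show "M w = 0" using that by simp
  qed
  obtain A s where A: "open A" "x0 \<in> A" "Ck_on (Suc k) s A" "s x0 = w0" "\<And>x. x \<in> A \<Longrightarrow> (x, s x) \<in> S \<and> F (x, s x) = 0"
    by (rule Ck_implicit_function[OF S in0 FC F0 inj]) (assumption | rule that)+
  define w where "w = (\<lambda>x. fst (s x))"
  have AX: "A \<subseteq> X" using A(5) unfolding S_def by auto
  have eq: "w x + dgT x (snd (s x)) = gr x" "dg x (w x) = 0" if "x \<in> A" for x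
    using A(5)[OF that] unfolding F_def w_def by (auto simp: zero_prod_def)
  show ?thesis
  proof
    show "open A" "x0 \<in> A" "A \<subseteq> X" by (rule A(1), rule A(2), rule AX)
    show "Ck_on (Suc k) w A" unfolding w_def by (intro Ck_on_fst A)
    fix x assume x: "x \<in> A"
    show "dg x (w x) = 0" by (rule eq(2)[OF x])
    fix t assume t: "dg x t = 0"
    have "(w x + dgT x (snd (s x))) \<bullet> t = frechet_derivative \<tau> (at x) t"
      unfolding eq(1)[OF x] using gr x AX by blast
    then show "w x \<bullet> t = frechet_derivative \<tau> (at x) t" by (simp add: inner_add_left inner_dgT' t)
  qed
qed

section \<open>The centre space and the linearisation at a point of T\<close>

text \<open>\<open>(v, 0)\<close> and \<open>(- w, 1)\<close> are normal to the tangent vectors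
  \<open>(t, w \<bullet> t)\<close> and are eigenvectors of \<open>D\<close> for -1 and 1. Having
  eigenvalues of modulus 1 they lie in \<open>Ec\<close>, and the gap leaves no room in
  \<open>Ec\<close> for a further direction.\<close>

lemma centre_space_eq:
  assumes split: "centre_stable_splitting (gd_step g y) S Ec Es" and q: "(x, \<eta>) \<in> S" "g x = y"
    and v: "norm v = 1" "G x v = \<mu> *\<^sub>R v" and \<mu>: "0 < \<mu>" "\<eta> = 2 / \<mu>"
    and r: "r < \<mu>" "\<And>u. u \<bullet> v = 0 \<Longrightarrow> u \<bullet> G x u \<le> r * (u \<bullet> u)"
    and w: "dg x w = 0" and T: "tangent_space S (x, \<eta>) = {(t, w \<bullet> t) | t. dg x t = 0}"
  shows "Ec (x, \<eta>) = span {(v, 0), (- w, 1)}"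
proof -
  define D where "D = (\<lambda>v::(real^'n) \<times> real. (fst v - \<eta> *\<^sub>R G x (fst v), snd v))"
  let ?E = "Ec (x, \<eta>)"
  let ?F = "Es (x, \<eta>)"
  let ?N = "normal_space S (x, \<eta>)"
  have D: "frechet_derivative (gd_step g y) (at (x, \<eta>)) = D" unfolding D_def by (rule gd_step_derivative[OF q(2)])
  have s: "is_direct_sum ?N ?E ?F" "D ` ?E \<subseteq> ?E" "D ` ?F \<subseteq> ?F" "restricted_eigenvalues D ?E = {1, -1}"
    "restricted_eigenvalues D ?F \<subseteq> {-1<..<1}"
    using split q(1) unfolding centre_stable_splitting_def Let_def D[symmetric] by auto
  have linD: "linear D"
    unfolding D_def by (rule linearI) (auto simp: linear_add[OF lin_G] linear_scale[OF lin_G] scaleR_add_right scaleR_diff_right)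
  have symD: "D a \<bullet> b = a \<bullet> D b" for a b
    unfolding D_def by (simp add: inner_prod_def inner_diff_left inner_diff_right sym_G)
  have \<eta>\<mu>: "\<eta> * \<mu> = 2" using \<mu> by simp
  have e1: "D (v, 0) = - (v, 0)"
  proof -
    have "\<eta> *\<^sub>R G x v = 2 *\<^sub>R v" using v(2) \<eta>\<mu> by simp
    then show ?thesis by (simp add: D_def scaleR_2)
  qed
  have e2: "D (- w, 1) = (- w, 1)"
    unfolding D_def using w by (simp add: linear_neg[OF lin_G] G_eq_0_iff[THEN iffD2])
  have ker: "v \<bullet> t = 0" if "dg x t = 0" for t
  proof -
    have "\<mu> * (v \<bullet> t) = 0" using sym_G[of x v t] v(2) that by (simp add: G_eq_0_iff[THEN iffD2])
    then show ?thesis using \<mu>(1) by simp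
  qed
  have N: "z \<in> ?N \<longleftrightarrow> (\<forall>t. dg x t = 0 \<longrightarrow> t \<bullet> fst z + (w \<bullet> t) * snd z = 0)" for z
    unfolding normal_space_def T orthogonal_comp_def orthogonal_def by (auto simp: inner_prod_def)
  have e1N: "(v, 0) \<in> ?N" unfolding N using ker by (simp add: inner_commute)
  have e2N: "(- w, 1) \<in> ?N" unfolding N by (simp add: inner_commute)
  have sE: "subspace ?E" using s(1) unfolding is_direct_sum_def by blast
  have EN: "z \<in> ?N" if "z \<in> ?E" for z
  proof -
    have "subspace ?F" "?N = {a + b | a b. a \<in> ?E \<and> b \<in> ?F}" using s(1) unfolding is_direct_sum_def by blast+
    then show ?thesis using that subspace_0 by (metis (mono_tags, lifting) add.right_neutral mem_Collect_eq)
  qed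
  have e1': "D (v, 0) = (-1) *\<^sub>R (v, 0)" and e2': "D (- w, 1) = 1 *\<^sub>R (- w, 1)" using e1 e2 by simp_all
  show ?thesis
  proof (rule symmetric_invariant_plane[OF linD symD sE s(2)])
    show "restricted_eigenvalues D ?E \<subseteq> {1, -1}" using s(4) by simp
    show "(v, 0) \<in> ?E" by (rule splitting_eigenvector_mem[OF linD s(1-3,5) e1N e1']) simp
    show "(- w, 1) \<in> ?E" by (rule splitting_eigenvector_mem[OF linD s(1-3,5) e2N e2']) simp
    show "D (v, 0) = - (v, 0)" "D (- w, 1) = (- w, 1)" by (rule e1, rule e2)
    fix z assume z: "z \<in> ?E" "D z = z \<or> D z = - z" "z \<bullet> (v, 0) = 0" "z \<bullet> (- w, 1) = 0"
    obtain a c where ac: "z = (a, c)" by (cases z)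
    have av: "a \<bullet> v = 0" using z(3) unfolding ac by (simp add: inner_prod_def)
    from z(2) show "z = 0"
    proof
      assume "D z = - z"
      then have 1: "a - \<eta> *\<^sub>R G x a = - a" and c: "c = 0" unfolding D_def ac by auto
      have "\<eta> *\<^sub>R G x a = a - (a - \<eta> *\<^sub>R G x a)" by simp
      also have "\<dots> = 2 *\<^sub>R a" unfolding 1 by (simp add: scaleR_2)
      finally have "\<eta> *\<^sub>R G x a = 2 *\<^sub>R a" .
      then have "(1 / \<eta>) *\<^sub>R (\<eta> *\<^sub>R G x a) = (1 / \<eta>) *\<^sub>R (2 *\<^sub>R a)" by simp
      moreover have "\<eta> \<noteq> 0" "1 / \<eta> * 2 = \<mu>" using \<mu> by simp_all
      ultimately have "G x a = \<mu> *\<^sub>R a" by simp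
      then have "\<mu> * (a \<bullet> a) \<le> r * (a \<bullet> a)" using r(2)[OF av] by simp
      then have "a \<bullet> a = 0" using r(1) mult_strict_right_mono[of r \<mu> "a \<bullet> a"] inner_ge_zero[of a] by fastforce
      then show "z = 0" using c unfolding ac by (simp add: zero_prod_def)
    next
      \<comment> \<open>Here \<open>a\<close> lies in the kernel of \<open>dg x\<close>, and
        normality of \<open>z\<close>, tested on \<open>a + c *\<^sub>R w\<close>, gives
        \<open>a = - (c *\<^sub>R w)\<close>. So \<open>z\<close> is a multiple of
        \<open>(- w, 1)\<close>, to which it is orthogonal.\<close>
      assume "D z = z"
      then have "\<eta> *\<^sub>R G x a = 0" unfolding D_def ac by simp
      then have "dg x a = 0" using \<eta>\<mu> G_eq_0_iff by auto
      then have k: "dg x (a + c *\<^sub>R w) = 0" using w by (simp add: linear_add[OF lin_dg] linear_scale[OF lin_dg])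
      have "z \<in> ?N" by (rule EN[OF z(1)])
      then have "(a + c *\<^sub>R w) \<bullet> a + (w \<bullet> (a + c *\<^sub>R w)) * c = 0" unfolding N ac using k by simp
      then have "(a + c *\<^sub>R w) \<bullet> (a + c *\<^sub>R w) = 0"
        by (simp add: inner_add_left inner_add_right inner_commute algebra_simps)
      then have a: "a = - (c *\<^sub>R w)" by (simp add: eq_neg_iff_add_eq_0)
      have "c * (w \<bullet> w) + c = 0" using z(4) unfolding ac a by (simp add: inner_prod_def)
      then have "c * (w \<bullet> w + 1) = 0" by (simp add: algebra_simps)
      then have "c = 0" using inner_ge_zero[of w] by (auto simp: add_nonneg_eq_0_iff)
      then show "z = 0" using a unfolding ac by (simp add: zero_prod_def)
    qed
  qed
qed

text \<open>As a quadratic form \<open>\<eta> G\<close> lies between 0 and 2, so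
  \<open>1 - \<eta> G\<close> has its spectrum in [-1, 1]. The value -1 is attained exactly along
  \<open>v\<close>, by the gap, and 1 exactly on the kernel of \<open>dg x\<close>, onto which
  \<open>Pk\<close> projects.\<close>

lemma linearisation:
  assumes x: "g x = y" and v: "norm v = 1" "G x v = \<mu> *\<^sub>R v" and \<mu>: "0 < \<mu>" "\<eta> = 2 / \<mu>"
    and r: "r < \<mu>" "\<And>u. u \<bullet> v = 0 \<Longrightarrow> u \<bullet> G x u \<le> r * (u \<bullet> u)"
    and D: "D = (\<lambda>v::(real^'n) \<times> real. (fst v - \<eta> *\<^sub>R G x (fst v), snd v))"
    and Pk: "linear Pk" "\<And>u. dg x (Pk u) = 0" "\<And>u. dg x u = 0 \<Longrightarrow> Pk u = u" "\<And>u t. dg x t = 0 \<Longrightarrow> (u - Pk u) \<bullet> t = 0"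
  shows "linear D" "D a \<bullet> b = a \<bullet> D b" "\<bar>z \<bullet> D z\<bar> \<le> z \<bullet> z"
    and "dg x t = 0 \<Longrightarrow> v \<bullet> t = 0" "Pk v = 0"
    and "D (D z) = z \<longleftrightarrow> fst z = Pk (fst z) + (fst z \<bullet> v) *\<^sub>R v"
proof -
  show linD: "linear D"
    unfolding D by (rule linearI) (auto simp: linear_add[OF lin_G] linear_scale[OF lin_G] scaleR_add_right scaleR_diff_right)
  show "D a \<bullet> b = a \<bullet> D b" unfolding D by (simp add: inner_prod_def inner_diff_left inner_diff_right sym_G)
  have vv: "v \<bullet> v = 1" using v(1) by (simp add: norm_eq_1)
  have \<eta>\<mu>: "\<eta> * \<mu> = 2" and \<eta>: "\<eta> > 0" using \<mu> by simp_all
  have G\<mu>: "u \<bullet> G x u \<le> \<mu> * (u \<bullet> u)" for u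
  proof -
    have "(u \<bullet> v)\<^sup>2 \<le> (norm u * norm v)\<^sup>2"
      using Cauchy_Schwarz_ineq2[of u v] by (metis abs_ge_zero power2_abs power_mono)
    then have "(u \<bullet> v)\<^sup>2 \<le> u \<bullet> u" using v(1) by (simp add: power2_norm_eq_inner)
    then have "(\<mu> - r) * (u \<bullet> v)\<^sup>2 \<le> (\<mu> - r) * (u \<bullet> u)" using r(1) by (intro mult_left_mono) auto
    then show ?thesis using quadratic_form_bound[OF lin_G sym_G v r(2), of u] by (simp add: algebra_simps)
  qed
  show "\<bar>z \<bullet> D z\<bar> \<le> z \<bullet> z"
  proof -
    let ?a = "fst z"
    have "\<eta> * (?a \<bullet> G x ?a) \<le> \<eta> * (\<mu> * (?a \<bullet> ?a))" using G\<mu> \<eta> by (intro mult_left_mono) auto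
    then have 1: "\<eta> * (?a \<bullet> G x ?a) \<le> 2 * (?a \<bullet> ?a)" using \<eta>\<mu> by (simp add: mult.assoc[symmetric])
    have 2: "0 \<le> \<eta> * (?a \<bullet> G x ?a)" unfolding inner_G using \<eta> by simp
    have "z \<bullet> D z = ?a \<bullet> ?a - \<eta> * (?a \<bullet> G x ?a) + snd z * snd z" "z \<bullet> z = ?a \<bullet> ?a + snd z * snd z"
      unfolding D by (simp_all add: inner_prod_def inner_diff_right)
    moreover have "0 \<le> snd z * snd z" by simp
    ultimately show ?thesis using 1 2 by linarith
  qed
  have Gt: "G x t = 0" if "dg x t = 0" for t using that G_eq_0_iff by blast
  show vt: "v \<bullet> t = 0" if "dg x t = 0" for t
  proof -
    have "\<mu> * (v \<bullet> t) = 0" using sym_G[of x v t] v(2) Gt[OF that] by simp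
    then show ?thesis using \<mu>(1) by simp
  qed
  show Pkv: "Pk v = 0"
  proof -
    have "(v - Pk v) \<bullet> Pk v = 0" "v \<bullet> Pk v = 0" using Pk(2,4) vt by auto
    then show ?thesis by (simp add: inner_diff_left)
  qed
  define S where "S = (\<lambda>a. a - \<eta> *\<^sub>R G x a)"
  have linS: "linear S"
    unfolding S_def by (rule linearI) (auto simp: linear_add[OF lin_G] linear_scale[OF lin_G] scaleR_add_right scaleR_diff_right)
  have SS: "S (S (t + c *\<^sub>R v)) = t + c *\<^sub>R v" if "dg x t = 0" for t c
  proof -
    have St: "S t = t" unfolding S_def using Gt[OF that] by simp
    have Sv: "S v = - v" unfolding S_def v(2) using \<eta>\<mu> by (simp add: scaleR_2)
    show ?thesis by (simp add: linear_add[OF linS] linear_scale[OF linS] linear_neg[OF linS] linear_diff[OF linS] St Sv)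
  qed
  have DD: "D (D z) = z \<longleftrightarrow> S (S (fst z)) = fst z" unfolding D S_def by (auto simp: prod_eq_iff)
  show "D (D z) = z \<longleftrightarrow> fst z = Pk (fst z) + (fst z \<bullet> v) *\<^sub>R v"
    unfolding DD
  proof
    assume "fst z = Pk (fst z) + (fst z \<bullet> v) *\<^sub>R v"
    then show "S (S (fst z)) = fst z" using SS[OF Pk(2), of "fst z" "fst z \<bullet> v"] by simp
  next
    assume a: "S (S (fst z)) = fst z"
    define c where "c = fst z \<bullet> v"
    define a' where "a' = fst z - (Pk (fst z) + c *\<^sub>R v)"
    have SSa': "S (S a') = a'" unfolding a'_def
      using a SS[OF Pk(2), of "fst z" c] by (simp add: linear_diff[OF linS])
    have a't: "a' \<bullet> t = 0" if "dg x t = 0" for t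
      using Pk(4)[OF that, of "fst z"] vt[OF that] unfolding a'_def by (simp add: inner_diff_left inner_add_left)
    have a'v: "a' \<bullet> v = 0"
    proof -
      have "Pk (fst z) \<bullet> v = 0" using vt[OF Pk(2), of "fst z"] by (simp add: inner_commute)
      then show ?thesis using vv unfolding a'_def c_def by (simp add: inner_diff_left inner_add_left)
    qed
    \<comment> \<open>\<open>S (S a') = a'\<close> says that \<open>G x b = 0\<close>. So
      \<open>b\<close> lies in the kernel of \<open>dg x\<close> and is orthogonal to itself,
      because \<open>a'\<close> is orthogonal to that kernel. Then \<open>b = 0\<close> gives
      \<open>G x a' = \<mu> *\<^sub>R a'\<close>, which the gap allows only for
      \<open>a' = 0\<close>.\<close>
    define b where "b = (a' + a') - \<eta> *\<^sub>R G x a'"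
    have alg: "p - q - (q - s) = p - (q + q - s)" for p q s :: "real^'n" by simp
    have "S (S a') = a' - \<eta> *\<^sub>R G x b"
      unfolding S_def b_def linear_diff[OF lin_G] linear_add[OF lin_G] linear_scale[OF lin_G] scaleR_diff_right scaleR_add_right
      by (rule alg)
    then have "\<eta> *\<^sub>R G x b = 0" using SSa' by simp
    then have gb: "dg x b = 0" using \<eta> G_eq_0_iff by auto
    have "b \<bullet> b = (a' + a' - \<eta> *\<^sub>R G x a') \<bullet> b" by (simp only: b_def)
    also have "\<dots> = a' \<bullet> b + a' \<bullet> b - \<eta> * (G x a' \<bullet> b)"
      by (simp only: inner_diff_left inner_add_left inner_scaleR_left)
    also have "\<dots> = 0" using a't[OF gb] sym_G[of x a' b] Gt[OF gb] by simp
    finally have "\<eta> *\<^sub>R G x a' = 2 *\<^sub>R a'" unfolding b_def scaleR_2 by simp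
    then have "(1 / \<eta>) *\<^sub>R (\<eta> *\<^sub>R G x a') = (1 / \<eta>) *\<^sub>R (2 *\<^sub>R a')" by simp
    moreover have "\<eta> \<noteq> 0" "1 / \<eta> * 2 = \<mu>" using \<mu> by simp_all
    ultimately have "G x a' = \<mu> *\<^sub>R a'" by simp
    then have "\<mu> * (a' \<bullet> a') \<le> r * (a' \<bullet> a')" using r(2)[OF a'v] by simp
    then have "a' \<bullet> a' = 0" using r(1) mult_strict_right_mono[of r \<mu> "a' \<bullet> a'"] inner_ge_zero[of a'] by fastforce
    then show "fst z = Pk (fst z) + (fst z \<bullet> v) *\<^sub>R v" unfolding a'_def c_def by simp
  qed
qed

section \<open>Construction of the foliated chart\<close>

theorem local_centre_foliation:
  assumes split: "centre_stable_splitting (gd_step g y) (T_set g y - T_tilde g y) Ec Es"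
    and pT: "p \<in> T_set g y - T_tilde g y"
  shows "\<exists>U W LL.
    openin (top_of_set (T_set g y - T_tilde g y)) U \<and> p \<in> U \<and>
    centre_manifold (Suc k) (CARD('n) - CARD('m) + 2) (gd_step g y) U W \<and>
    (\<forall>q\<in>U. is_direct_sum (tangent_space W q) (tangent_space U q) (Ec q)) \<and>
    Ck_foliation (Suc k) 2 (CARD('n) - CARD('m) + 2) W LL \<and>
    (\<forall>F\<in>LL. \<forall>q\<in>U \<inter> F. tangent_space F q = Ec q)"
proof -
  define T where "T = T_set g y - T_tilde g y"
  define f where "f = gd_step g y"
  obtain x0 where x0: "p = (x0, 2 / lam g y 1 x0)" "g x0 = y"
    using pT unfolding T_set_def by blast
  have ne: "lam g y 1 x0 \<noteq> lam g y 2 x0" using pT x0 unfolding T_tilde_def by blast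
  \<comment> \<open>Derivatives are kept in reserve, since \<open>w\<close> loses one against \<tau>
    and all data of the chart have to be of class \<open>Suc k\<close>.\<close>
  obtain X v \<mu> where X: "open X" "x0 \<in> X" and vC: "Ck_on (Suc (Suc (Suc k))) v X" and \<mu>C: "Ck_on (Suc (Suc (Suc k))) \<mu> X"
    and \<mu>0: "\<mu> x0 = lam g y 1 x0"
    and Gv: "\<And>x. x \<in> X \<Longrightarrow> G x (v x) = \<mu> x *\<^sub>R v x" and nv: "\<And>x. x \<in> X \<Longrightarrow> norm (v x) = 1"
    and \<mu>pos: "\<And>x. x \<in> X \<Longrightarrow> 0 < \<mu> x"
    and gap: "\<And>x. x \<in> X \<Longrightarrow> \<exists>r<\<mu> x. \<forall>u. u \<bullet> v x = 0 \<longrightarrow> u \<bullet> G x u \<le> r * (u \<bullet> u)"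
    by (rule top_eigenpair[OF x0(2) ne, where k = "Suc (Suc k)"]) (rule that; assumption)
  define \<tau> where "\<tau> = (\<lambda>x. 2 / \<mu> x)"
  have \<tau>C: "Ck_on (Suc (Suc (Suc k))) \<tau> X"
    unfolding \<tau>_def
    by (rule Ck_on_divide[OF X(1) _ Ck_on_const \<mu>C]) (use \<mu>pos in fastforce)
  obtain X' w where X': "open X'" "x0 \<in> X'" "X' \<subseteq> X" and wC: "Ck_on (Suc (Suc k)) w X'"
    and w0: "\<And>x. x \<in> X' \<Longrightarrow> dg x (w x) = 0"
    and w\<tau>: "\<And>x t. x \<in> X' \<Longrightarrow> dg x t = 0 \<Longrightarrow> w x \<bullet> t = frechet_derivative \<tau> (at x) t"
    by (rule tangential_gradient[OF X x0(2) \<tau>C]) (rule that; assumption)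
  have p: "p = (x0, \<tau> x0)" unfolding x0(1) \<tau>_def \<mu>0 ..
  have lamX: "lam g y 1 x = \<mu> x" "lam g y 2 x \<noteq> \<mu> x" if xX: "x \<in> X" "g x = y" for x
  proof -
    obtain r where r: "r < \<mu> x" "\<And>u. u \<bullet> v x = 0 \<Longrightarrow> u \<bullet> G x u \<le> r * (u \<bullet> u)" using gap[OF xX(1)] by blast
    have "v x \<noteq> 0" using nv[OF xX(1)] by auto
    from eigenvalue_nr_top[OF lin_G sym_G this Gv[OF xX(1)] r DIM_ge_2]
    show "lam g y 1 x = \<mu> x" "lam g y 2 x \<noteq> \<mu> x" unfolding lam_eq[OF xX(2)] by auto
  qed
  \<comment> \<open>On \<open>X\<close> the top eigenvalue is simple, so there \<open>T_set\<close>
    is the graph of \<tau> over the level set and misses \<open>T_tilde\<close>.\<close>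
  have TI: "(x, \<tau> x) \<in> T" if "x \<in> X" "g x = y" for x
    using lamX[OF that] that unfolding T_def T_set_def T_tilde_def \<tau>_def by auto
  have TD: "g (fst q) = y" "fst q \<in> X \<Longrightarrow> q = (fst q, \<tau> (fst q))" if "q \<in> T" for q
    using that lamX unfolding T_def T_set_def \<tau>_def by auto
  define K0 where "K0 = {t. dg x0 t = 0}"
  have K0: "subspace K0" unfolding K0_def
    by (auto simp: subspace_def linear_0[OF lin_dg] linear_add[OF lin_dg] linear_scale[OF lin_dg])
  obtain Pk where Pk: "linear Pk" "\<And>u. Pk u \<in> K0" "\<And>u. u \<in> K0 \<Longrightarrow> Pk u = u" "\<And>u t. t \<in> K0 \<Longrightarrow> (u - Pk u) \<bullet> t = 0"
    by (rule orthogonal_projection_exists[OF K0]) (rule that; assumption)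
  have blPk: "bounded_linear Pk" using Pk(1) by (simp add: linear_conv_bounded_linear)
  \<comment> \<open>Straightens the level set: \<open>Pk\<close> gives coordinates along the kernel
    \<open>K0\<close>, and \<open>dgT x0\<close> places the value of \<open>g\<close> injectively in
    the orthogonal complement of \<open>K0\<close>. Thus \<open>\<kappa> x\<close> lies in
    \<open>K0\<close> exactly on the level set.\<close>
  define \<kappa> where "\<kappa> = (\<lambda>x. Pk (x - x0) + dgT x0 (g x - y))"
  have bldgT: "bounded_linear (dgT x0)" using lin_dgT by (simp add: linear_conv_bounded_linear)
  have \<kappa>C: "Ck_on j \<kappa> UNIV" for j
    unfolding \<kappa>_def
    by (intro Ck_on_add Ck_on_linear_compose[OF blPk] Ck_on_linear_compose[OF bldgT] Ck_on_diff Ck_on_ident Ck_on_const gC open_UNIV)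
  have \<kappa>': "frechet_derivative \<kappa> (at x) = (\<lambda>t. Pk t + dgT x0 (dg x t))" for x
  proof (rule frechet_derivative_eqI)
    have "(\<kappa> has_derivative (\<lambda>t. Pk (t - 0) + dgT x0 (dg x t - 0))) (at x)"
      unfolding \<kappa>_def
      by (intro has_derivative_add bounded_linear.has_derivative[OF blPk] bounded_linear.has_derivative[OF bldgT]
          has_derivative_diff has_derivative_ident has_derivative_const hd_g)
    then show "(\<kappa> has_derivative (\<lambda>t. Pk t + dgT x0 (dg x t))) (at x)" by simp
  qed
  have key: "z = 0" if "Pk t + dgT x0 z \<in> K0" for t z
  proof -
    have "dg x0 (Pk t) = 0" using Pk(2) unfolding K0_def by blast
    then have "dg x0 (dgT x0 z) = 0" using that unfolding K0_def by (simp add: linear_add[OF lin_dg])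
    then have "dgT x0 z \<bullet> dgT x0 z = 0" unfolding inner_dgT by simp
    then show ?thesis using dgT_inj[OF x0(2)] by simp
  qed
  have \<kappa>K: "\<kappa> x \<in> K0 \<longleftrightarrow> g x = y" for x
    using key[of "x - x0" "g x - y"] Pk(2) unfolding \<kappa>_def by (auto simp: linear_0[OF lin_dgT])
  have \<kappa>x0: "\<kappa> x0 = 0" unfolding \<kappa>_def by (simp add: x0(2) linear_0[OF Pk(1)] linear_0[OF lin_dgT])
  have inj\<kappa>: "t = 0" if "frechet_derivative \<kappa> (at x0) t = 0" for t
  proof -
    have "dg x0 t = 0" using that key[of t "dg x0 t"] subspace_0[OF K0] unfolding \<kappa>' by simp
    then have "Pk t = t" "dgT x0 (dg x0 t) = 0" using Pk(3)[of t] unfolding K0_def by (simp_all add: linear_0[OF lin_dgT])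
    then show ?thesis using that unfolding \<kappa>' by simp
  qed
  obtain A0 B0 m where A0: "x0 \<in> A0" "A0 \<subseteq> UNIV" "Ck_diffeo (Suc k) A0 B0 \<kappa> m"
    by (rule Ck_inverse_function[OF open_UNIV UNIV_I \<kappa>C inj\<kappa>]) (assumption | rule that)+
  have d0: "open A0" "open B0" "homeomorphism A0 B0 \<kappa> m" "Ck_on (Suc k) m B0"
    using A0(3) unfolding Ck_diffeo_def by auto
  have m\<kappa>: "m (\<kappa> x) = x" "\<kappa> x \<in> B0" if "x \<in> A0" for x
    using that homeomorphism_apply1[OF d0(3)] homeomorphism_image1[OF d0(3)] by auto
  have \<kappa>m: "\<kappa> (m u) = u" "m u \<in> A0" if "u \<in> B0" for u
    using that homeomorphism_apply2[OF d0(3)] homeomorphism_image2[OF d0(3)] by auto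
  \<comment> \<open>On \<open>K0\<close> this parametrises \<open>T\<close> near \<open>p\<close>;
    off \<open>K0\<close> it merely extends the parametrisation to an open set.\<close>
  define \<sigma> where "\<sigma> = (\<lambda>u. (m u, \<tau> (m u)))"
  define U0 where "U0 = B0 \<inter> m -` X'"
  have U0: "open U0" unfolding U0_def
    by (rule continuous_open_preimage[OF Ck_on_continuous[OF d0(4)] d0(2) X'(1)])
  have mC: "Ck_on (Suc k) m U0" using Ck_on_subset[OF d0(4)] unfolding U0_def by blast
  have mU0: "m ` U0 \<subseteq> X'" unfolding U0_def by auto
  have \<tau>C': "Ck_on (Suc k) \<tau> X'" and vC': "Ck_on (Suc k) v X'" and wC': "Ck_on (Suc k) w X'"
    using Ck_on_subset[OF Ck_on_le[OF \<tau>C] X'(3)] Ck_on_subset[OF Ck_on_le[OF vC] X'(3)] Ck_on_le[OF wC] by (auto simp del: Ck_on.simps)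
  have \<sigma>C: "Ck_on (Suc k) \<sigma> U0" unfolding \<sigma>_def
    by (intro Ck_on_Pair U0 mC Ck_on_compose[OF U0 X'(1) mU0 \<tau>C' mC])
  define D where "D = (\<lambda>v::(real^'n) \<times> real. (fst v - \<tau> x0 *\<^sub>R G x0 (fst v), snd v))"
  have Df: "frechet_derivative f (at p) = D" unfolding f_def p D_def by (rule gd_step_derivative[OF x0(2)])
  obtain r where r: "r < \<mu> x0" "\<And>u. u \<bullet> v x0 = 0 \<Longrightarrow> u \<bullet> G x0 u \<le> r * (u \<bullet> u)" using gap[OF X(2)] by blast
  have PkK: "dg x0 (Pk u) = 0" "dg x0 u = 0 \<Longrightarrow> Pk u = u" "dg x0 t = 0 \<Longrightarrow> (u - Pk u) \<bullet> t = 0" for u t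
    using Pk(2-4) unfolding K0_def by auto
  have \<tau>0: "\<tau> x0 = 2 / \<mu> x0" unfolding \<tau>_def ..
  note lin = linearisation[OF x0(2) nv[OF X(2)] Gv[OF X(2)] \<mu>pos[OF X(2)] \<tau>0 r D_def Pk(1) PkK]
  have linD: "linear D" by (rule lin(1))
  have blD: "bounded_linear D" using linD by (simp add: linear_conv_bounded_linear)
  have vK: "v x0 \<bullet> t = 0" if "t \<in> K0" for t using lin(4) that unfolding K0_def by blast
  have Pkv: "Pk (v x0) = 0" by (rule lin(5))
  have vv: "v x0 \<bullet> v x0 = 1" using nv[OF X(2)] by (simp add: norm_eq_1)
  \<comment> \<open>The centre space at \<open>p\<close>: the kernel \<open>K0\<close>, the top
    eigenvector and the step size direction together.\<close>
  define C where "C = {z. D (D z) = z}"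
  have CI: "z \<in> C \<longleftrightarrow> fst z = Pk (fst z) + (fst z \<bullet> v x0) *\<^sub>R v x0" for z unfolding C_def using lin(6) by blast
  have C: "subspace C" unfolding C_def
    by (auto simp: subspace_def linear_0[OF linD] linear_add[OF linD] linear_scale[OF linD])
  have CI': "(t + c *\<^sub>R v x0, s) \<in> C" if "t \<in> K0" for t c s
  proof -
    have "t \<bullet> v x0 = 0" using vK[OF that] by (simp add: inner_commute)
    then show ?thesis unfolding CI by (simp add: linear_add[OF Pk(1)] linear_scale[OF Pk(1)] Pk(3)[OF that] Pkv inner_add_left vv)
  qed
  obtain P where P: "linear P" "\<And>z. P z \<in> C" "\<And>z. z \<in> C \<Longrightarrow> P z = z" "\<And>z c. c \<in> C \<Longrightarrow> (z - P z) \<bullet> c = 0"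
    by (rule orthogonal_projection_exists[OF C]) (rule that; assumption)
  have blP: "bounded_linear P" using P(1) by (simp add: linear_conv_bounded_linear)
  define R0 where "R0 = (\<lambda>z. f (p + z) - p - D z)"
  have fC: "Ck_on j f UNIV" for j unfolding f_def by (rule Ck_gd_step)
  have R0C: "Ck_on j R0 UNIV" for j
    unfolding R0_def
    by (intro Ck_on_diff Ck_on_const Ck_on_linear[OF blD] open_UNIV Ck_on_compose[OF open_UNIV open_UNIV subset_UNIV fC] Ck_on_add Ck_on_ident)
  have fp: "f p = p" unfolding f_def p by (rule gd_step_fixed[OF x0(2)])
  have R00: "R0 0 = 0" unfolding R0_def by (simp add: fp linear_0[OF linD])
  have R0': "frechet_derivative R0 (at z) e = frechet_derivative f (at (p + z)) e - D e" for z e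
  proof -
    have "((\<lambda>z. p + z) has_derivative (\<lambda>e. e)) (at z)" by (auto intro!: derivative_eq_intros)
    then have "((\<lambda>z. f (p + z)) has_derivative frechet_derivative f (at (p + z))) (at z)"
      by (rule has_derivative_compose) (rule Ck_on_has_derivative[OF fC UNIV_I])
    from has_derivative_diff[OF has_derivative_diff[OF this has_derivative_const] bounded_linear_imp_has_derivative[OF blD]]
    have "(R0 has_derivative (\<lambda>e. frechet_derivative f (at (p + z)) e - 0 - D e)) (at z)" unfolding R0_def .
    then show ?thesis using frechet_derivative_eqI by fastforce
  qed
  have F: "D z + R0 z = f (p + z) - p" for z unfolding R0_def by simp
  have P1: "D (D (P z)) = P z" for z using P(2)[of z] unfolding C_def by simp
  have P2: "P z = z" if "D (D z) = z" for z using P(3) that unfolding C_def by simp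
  have P3: "(z - P z) \<bullet> c = 0" if "D (D c) = c" for z c using P(4) that unfolding C_def by simp
  have R0'0: "frechet_derivative R0 (at 0) e = 0" for e unfolding R0' by (simp add: Df)
  obtain H \<delta> where \<delta>: "0 < \<delta>" and HC: "Ck_on (Suc k) H UNIV" and PH: "\<And>c. P (H c) = P c" and HP: "\<And>c. H (P c) = H c"
    and Hinv: "\<And>z. norm z < \<delta> \<Longrightarrow> H z = z \<Longrightarrow> H (D z + R0 z) = D z + R0 z"
    and Hfix: "\<And>z. norm z < \<delta> \<Longrightarrow> D z + R0 z = z \<Longrightarrow> H z = z"
    and Htan: "\<And>z s e. norm z < \<delta> \<Longrightarrow> D z + R0 z = z \<Longrightarrow> \<bar>s\<bar> = 1 \<Longrightarrow> D e + frechet_derivative R0 (at z) e = s *\<^sub>R e \<Longrightarrow>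
       frechet_derivative H (at z) e = e"
    by (rule local_centre_manifold_symmetric[OF linD lin(2,3) P(1) P1 P2 P3 R0C R00 R0'0, of "Suc k"])
      (assumption | simp | rule that)+
  define U1 where "U1 = U0 \<inter> \<sigma> -` ball p \<delta>"
  have U1: "open U1" unfolding U1_def
    by (rule continuous_open_preimage[OF Ck_on_continuous[OF \<sigma>C] U0 open_ball])
  define e1 where "e1 = (\<lambda>u. (v (m u), 0::real))"
  define e2 where "e2 = (\<lambda>u. (- w (m u), 1::real))"
  \<comment> \<open>The component of \<open>z\<close> in \<open>K0\<close> selects a point of
    \<open>T\<close>; the components along \<open>v x0\<close> and in the step size direction are
    the coefficients of \<open>e1\<close> and \<open>e2\<close> there.\<close>
  define cc where "cc = (\<lambda>z::(real^'n) \<times> real. \<sigma> (Pk (fst z)) - p + (fst z \<bullet> v x0) *\<^sub>R e1 (Pk (fst z)) + snd z *\<^sub>R e2 (Pk (fst z)))"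
  \<comment> \<open>Adding \<open>z - P z\<close> fills in the stable directions and turns the
    parametrisation of the manifold into a chart of the ambient space, in which the manifold is the
    slice \<open>C\<close>.\<close>
  define \<Psi> where "\<Psi> = (\<lambda>z. p + H (cc z) + (z - P z))"
  define \<Omega> where "\<Omega> = (\<lambda>z::(real^'n) \<times> real. Pk (fst z)) -` U1"
  have blPkf: "bounded_linear (\<lambda>z::(real^'n) \<times> real. Pk (fst z))"
    by (rule bounded_linear_compose[OF blPk bounded_linear_fst])
  have \<Omega>: "open \<Omega>" unfolding \<Omega>_def
    by (rule open_vimage[OF U1 linear_continuous_on[OF blPkf]])
  have \<Omega>U: "(\<lambda>z. Pk (fst z)) ` \<Omega> \<subseteq> U0" unfolding \<Omega>_def U1_def by auto
  have U1X: "m u \<in> A0" "\<kappa> (m u) = u" "m u \<in> X'" "m u \<in> X" "norm (\<sigma> u - p) < \<delta>" "u \<in> U0" if "u \<in> U1" for u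
    using that \<kappa>m X'(3) unfolding U1_def U0_def by (auto simp: dist_norm norm_minus_commute)
  have e1C: "Ck_on (Suc k) e1 U0" unfolding e1_def
    by (intro Ck_on_Pair Ck_on_const U0 Ck_on_compose[OF U0 X'(1) mU0 vC' mC])
  have e2C: "Ck_on (Suc k) e2 U0" unfolding e2_def
    by (intro Ck_on_Pair Ck_on_minus Ck_on_const U0 Ck_on_compose[OF U0 X'(1) mU0 wC' mC])
  have \<Omega>C: "Ck_on (Suc k) (\<lambda>z::(real^'n) \<times> real. Pk (fst z)) \<Omega>" by (rule Ck_on_linear[OF blPkf \<Omega>])
  have ccC: "Ck_on (Suc k) cc \<Omega>" unfolding cc_def
    by (intro Ck_on_add Ck_on_diff Ck_on_scaleR Ck_on_inner Ck_on_const Ck_on_fst Ck_on_snd Ck_on_ident \<Omega>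
      Ck_on_compose[OF \<Omega> U0 \<Omega>U \<sigma>C \<Omega>C] Ck_on_compose[OF \<Omega> U0 \<Omega>U e1C \<Omega>C] Ck_on_compose[OF \<Omega> U0 \<Omega>U e2C \<Omega>C])
  have \<Psi>C: "Ck_on (Suc k) \<Psi> \<Omega>" unfolding \<Psi>_def
    by (intro Ck_on_add Ck_on_diff Ck_on_const Ck_on_ident \<Omega> Ck_on_linear[OF blP \<Omega>]
      Ck_on_compose[OF \<Omega> open_UNIV subset_UNIV HC ccC])
  have \<Psi>d: "(\<Psi> has_derivative frechet_derivative \<Psi> (at z)) (at z)" if "z \<in> \<Omega>" for z
    by (rule Ck_on_has_derivative[OF \<Psi>C that])
  have Hd: "(H has_derivative frechet_derivative H (at z)) (at z)" for z
    by (rule Ck_on_has_derivative[OF HC UNIV_I])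
  \<comment> \<open>Points of \<open>T\<close> are fixed by \<open>f\<close>, so those near
    \<open>p\<close> lie on the manifold, and the derivative of \<open>H\<close> fixes
    \<open>e1\<close> and \<open>e2\<close>, which are eigenvectors for -1 and 1.\<close>
  have fib: "g (m u) = y" "H (\<sigma> u - p) = \<sigma> u - p" "\<sigma> u \<in> T"
    "frechet_derivative H (at (\<sigma> u - p)) (e1 u) = e1 u" "frechet_derivative H (at (\<sigma> u - p)) (e2 u) = e2 u"
    if u: "u \<in> U1" "u \<in> K0" for u
  proof -
    note ux = U1X[OF u(1)]
    show gm: "g (m u) = y" using \<kappa>K[of "m u"] ux(2) u(2) by simp
    have fixd: "D (\<sigma> u - p) + R0 (\<sigma> u - p) = \<sigma> u - p"
      unfolding F using gd_step_fixed[OF gm] by (simp add: f_def \<sigma>_def)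
    show "H (\<sigma> u - p) = \<sigma> u - p" by (rule Hfix[OF ux(5) fixd])
    show "\<sigma> u \<in> T" unfolding \<sigma>_def by (rule TI[OF ux(4) gm])
    have D': "frechet_derivative f (at (\<sigma> u)) e = (fst e - \<tau> (m u) *\<^sub>R G (m u) (fst e), snd e)" for e
      unfolding f_def \<sigma>_def by (simp add: gd_step_derivative[OF gm])
    have t2: "\<tau> (m u) *\<^sub>R G (m u) (v (m u)) = 2 *\<^sub>R v (m u)"
      unfolding \<tau>_def Gv[OF ux(4)] using \<mu>pos[OF ux(4)] by simp
    have "frechet_derivative f (at (\<sigma> u)) (e1 u) = (-1) *\<^sub>R e1 u"
      unfolding D' e1_def fst_conv t2 by (simp add: scaleR_2)
    then show "frechet_derivative H (at (\<sigma> u - p)) (e1 u) = e1 u"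
      by (intro Htan[OF ux(5) fixd, of "-1"]) (simp_all add: R0')
    have "frechet_derivative f (at (\<sigma> u)) (e2 u) = 1 *\<^sub>R e2 u"
      unfolding D' e2_def using w0[OF ux(3)] by (simp add: linear_neg[OF lin_G] G_eq_0_iff[THEN iffD2])
    then show "frechet_derivative H (at (\<sigma> u - p)) (e2 u) = e2 u"
      by (intro Htan[OF ux(5) fixd, of 1]) (simp_all add: R0')
  qed
  have ccu: "cc (u + c *\<^sub>R v x0, s) = \<sigma> u - p + (c *\<^sub>R e1 u + s *\<^sub>R e2 u)" if "u \<in> K0" for u c s
    unfolding cc_def using vK[OF that]
    by (simp add: linear_add[OF Pk(1)] linear_scale[OF Pk(1)] Pk(3)[OF that] Pkv inner_add_left vv inner_commute[of u])
  have \<Psi>u: "\<Psi> (u + c *\<^sub>R v x0, s) = p + H (\<sigma> u - p + (c *\<^sub>R e1 u + s *\<^sub>R e2 u))" if "u \<in> K0" for u c s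
    unfolding \<Psi>_def ccu[OF that] using P(3)[OF CI'[OF that]] by simp
  have \<Psi>\<sigma>: "\<Psi> (u, 0) = \<sigma> u" if "u \<in> U1" "u \<in> K0" for u
    using \<Psi>u[OF that(2), of 0 0] fib(2)[OF that] by simp
  have \<Omega>u: "(u, s) \<in> \<Omega>" if "u \<in> U1" "u \<in> K0" for u s unfolding \<Omega>_def using that Pk(3) by simp
  \<comment> \<open>Over a fixed \<open>u\<close>, \<open>\<Psi>\<close> is \<open>H\<close> applied
    to an affine map with directions \<open>e1 u\<close> and \<open>e2 u\<close>, both fixed by the
    derivative of \<open>H\<close>. This is the tangency of the leaves.\<close>
  have \<Psi>'v: "frechet_derivative \<Psi> (at (u, 0)) (c *\<^sub>R v x0, s) = c *\<^sub>R e1 u + s *\<^sub>R e2 u" if u: "u \<in> U1" "u \<in> K0" for u c s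
  proof -
    have lH: "linear (frechet_derivative H (at z))" for z using has_derivative_linear[OF Hd] .
    have "((\<lambda>z. p + H z) has_derivative (\<lambda>e. 0 + frechet_derivative H (at z) e)) (at z)" for z
      by (intro has_derivative_add has_derivative_const Hd)
    then have pH: "((\<lambda>z. p + H z) has_derivative frechet_derivative H (at z)) (at z)" for z by simp
    have "frechet_derivative \<Psi> (at (u, 0)) (c *\<^sub>R v x0, s) = frechet_derivative H (at (\<sigma> u - p)) (c *\<^sub>R e1 u + s *\<^sub>R e2 u)"
    proof (rule line_derivative_eq[OF \<Psi>d[OF \<Omega>u[OF u]] pH open_UNIV UNIV_I])
      fix r :: real
      show "\<Psi> ((u, 0) + r *\<^sub>R (c *\<^sub>R v x0, s)) = p + H (\<sigma> u - p + r *\<^sub>R (c *\<^sub>R e1 u + s *\<^sub>R e2 u))"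
        using \<Psi>u[OF u(2), of "r * c" "r * s"] by (simp add: scaleR_add_right)
    qed
    also have "\<dots> = c *\<^sub>R e1 u + s *\<^sub>R e2 u"
      by (simp add: linear_add[OF lH] linear_scale[OF lH] fib(4,5)[OF u])
    finally show ?thesis .
  qed
  have m': "(m has_derivative frechet_derivative m (at u)) (at u)" if "u \<in> U0" for u
    by (rule Ck_on_has_derivative[OF mC that])
  have \<sigma>': "(\<sigma> has_derivative (\<lambda>t. (frechet_derivative m (at u) t, frechet_derivative \<tau> (at (m u)) (frechet_derivative m (at u) t)))) (at u)"
    if "u \<in> U0" for u
    unfolding \<sigma>_def
    by (intro has_derivative_Pair m'[OF that] has_derivative_compose[OF m'[OF that]] Ck_on_has_derivative[OF \<tau>C'])
      (use mU0 that in auto)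
  have \<Psi>'t: "frechet_derivative \<Psi> (at (u, 0)) (t, 0) =
      (frechet_derivative m (at u) t, frechet_derivative \<tau> (at (m u)) (frechet_derivative m (at u) t))"
    if u: "u \<in> U1" "u \<in> K0" and t: "t \<in> K0" for u t
  proof (rule line_derivative_eq[OF \<Psi>d[OF \<Omega>u[OF u]] \<sigma>'[OF U1X(6)[OF u(1)]]])
    show "open ((\<lambda>r::real. u + r *\<^sub>R t) -` U1)" by (intro open_vimage U1 continuous_intros)
    show "0 \<in> (\<lambda>r::real. u + r *\<^sub>R t) -` U1" using u by simp
    fix r assume "r \<in> (\<lambda>r::real. u + r *\<^sub>R t) -` U1"
    moreover have "u + r *\<^sub>R t \<in> K0" using u(2) t K0 by (auto intro: subspace_add subspace_scale)
    ultimately show "\<Psi> ((u, 0) + r *\<^sub>R (t, 0)) = \<sigma> (u + r *\<^sub>R t)" using \<Psi>\<sigma>[of "u + r *\<^sub>R t"] by simp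
  qed
  have m\<kappa>': "frechet_derivative m (at u) (Pk t + dgT x0 (dg (m u) t)) = t"
     "Pk (frechet_derivative m (at u) t) + dgT x0 (dg (m u) (frechet_derivative m (at u) t)) = t" if "u \<in> U1" for u t
    using Ck_diffeo_derivatives[OF A0(3) U1X(1)[OF that]] unfolding \<kappa>' U1X(2)[OF that] by auto
  \<comment> \<open>The derivative of \<open>m\<close> maps \<open>K0\<close> onto the kernel of
    \<open>dg (m u)\<close>, on which the derivative of \<tau> is the inner product with
    \<open>w (m u)\<close>.\<close>
  have tan: "frechet_derivative \<Psi> (at (u, 0)) ` (K0 \<times> {0}) = {(t, w (m u) \<bullet> t) | t. dg (m u) t = 0}"
    if u: "u \<in> U1" "u \<in> K0" for u
  proof -
    note ux = U1X[OF u(1)]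
    have 1: "dg (m u) (frechet_derivative m (at u) t) = 0" if "t \<in> K0" for t
      using m\<kappa>'(2)[OF u(1), of t] key that by metis
    show ?thesis
    proof (intro set_eqI iffI)
      fix z assume "z \<in> frechet_derivative \<Psi> (at (u, 0)) ` (K0 \<times> {0})"
      then obtain t where t: "t \<in> K0" "z = frechet_derivative \<Psi> (at (u, 0)) (t, 0)" by auto
      show "z \<in> {(t, w (m u) \<bullet> t) | t. dg (m u) t = 0}"
        unfolding t(2) \<Psi>'t[OF u t(1)] using 1[OF t(1)] w\<tau>[OF ux(3) 1[OF t(1)]] by auto
    next
      fix z assume "z \<in> {(t, w (m u) \<bullet> t) | t. dg (m u) t = 0}"
      then obtain t where t: "z = (t, w (m u) \<bullet> t)" "dg (m u) t = 0" by blast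
      have mt: "frechet_derivative m (at u) (Pk t) = t" using m\<kappa>'(1)[OF u(1), of t] t(2) by (simp add: linear_0[OF lin_dgT])
      have "z = frechet_derivative \<Psi> (at (u, 0)) (Pk t, 0)"
        unfolding \<Psi>'t[OF u Pk(2)] mt t(1) w\<tau>[OF ux(3) t(2)] ..
      then show "z \<in> frechet_derivative \<Psi> (at (u, 0)) ` (K0 \<times> {0})" using Pk(2) by auto
    qed
  qed
  have U10: "0 \<in> U1" unfolding U1_def U0_def
    using m\<kappa>[OF A0(1)] \<kappa>x0 X'(2) \<delta> p by (simp add: \<sigma>_def)
  have m0: "m 0 = x0" using m\<kappa>(1)[OF A0(1)] \<kappa>x0 by simp
  have K00: "0 \<in> K0" by (rule subspace_0[OF K0])
  have \<Omega>0: "0 \<in> \<Omega>" using \<Omega>u[OF U10 K00, of 0] by (simp add: zero_prod_def)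
  have \<Psi>0: "\<Psi> 0 = p" using \<Psi>\<sigma>[OF U10 K00] m0 p by (simp add: \<sigma>_def zero_prod_def)
  \<comment> \<open>The derivative at 0 is known on \<open>K0\<close>, on the plane mapped to the
    span of \<open>e1\<close> and \<open>e2\<close>, and on the orthogonal complement of
    \<open>C\<close>, where it is the identity. Testing against \<open>q\<close> and
    \<open>v x0\<close> removes two parts; what remains is that a tangent vector of \<open>T\<close>
    and the normal \<open>(- w, 1)\<close> are independent.\<close>
  have inj\<Psi>: "z = 0" if z: "frechet_derivative \<Psi> (at 0) z = 0" for z
  proof -
    define t where "t = Pk (fst z)"
    define c where "c = fst z \<bullet> v x0"
    define q where "q = fst z - t - c *\<^sub>R v x0"
    have tK: "t \<in> K0" unfolding t_def by (rule Pk(2))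
    have zq: "z = (t, 0) + (c *\<^sub>R v x0, snd z) + (q, 0)" unfolding q_def by (simp add: prod_eq_iff)
    have qK: "q \<bullet> s = 0" if "s \<in> K0" for s
      unfolding q_def t_def using Pk(4)[OF that, of "fst z"] vK[OF that] by (simp add: inner_diff_left)
    have qv: "q \<bullet> v x0 = 0"
      unfolding q_def c_def using vK[OF tK] vv by (simp add: inner_diff_left inner_commute[of t])
    have Pkq: "Pk q = 0"
    proof -
      have "(q - Pk q) \<bullet> Pk q = 0" "q \<bullet> Pk q = 0" using Pk(2,4) qK by auto
      then show ?thesis by (simp add: inner_diff_left)
    qed
    have qC: "(q, 0) \<bullet> z = 0" if "z \<in> C" for z :: "(real^'n) \<times> real"
    proof -
      have "q \<bullet> fst z = q \<bullet> (Pk (fst z) + (fst z \<bullet> v x0) *\<^sub>R v x0)" using that unfolding CI by simp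
      also have "\<dots> = 0" using qK[OF Pk(2)] qv by (simp add: inner_add_right)
      finally show ?thesis by (simp add: inner_prod_def)
    qed
    have Pq: "P (q, 0) = 0"
    proof -
      have "((q, 0) - P (q, 0)) \<bullet> P (q, 0) = 0" "(q, 0) \<bullet> P (q, 0) = 0" using P(2,4) qC by auto
      then show ?thesis by (simp add: inner_diff_left)
    qed
    have H0: "H 0 = 0" using fib(2)[OF U10 K00] m0 p by (simp add: \<sigma>_def)
    have \<Psi>1: "frechet_derivative \<Psi> (at 0) (q, 0) = (q, 0)"
    proof (rule line_derivative_eq[OF \<Psi>d[OF \<Omega>0] has_derivative_ident open_UNIV UNIV_I])
      fix r :: real
      have "cc (0 + r *\<^sub>R (q, 0)) = 0"
        unfolding cc_def using qv m0 p by (simp add: linear_scale[OF Pk(1)] Pkq \<sigma>_def)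
      then show "\<Psi> (0 + r *\<^sub>R (q, 0)) = p + r *\<^sub>R (q, 0)"
        unfolding \<Psi>_def using H0 by (simp add: linear_scale[OF P(1)] Pq del: scaleR_Pair)
    qed
    have \<Psi>2: "frechet_derivative \<Psi> (at 0) (c *\<^sub>R v x0, snd z) = c *\<^sub>R (v x0, 0) + snd z *\<^sub>R (- w x0, 1)"
      using \<Psi>'v[OF U10 K00, of c "snd z"] unfolding e1_def e2_def m0 by (simp add: zero_prod_def)
    have mt: "frechet_derivative m (at 0) t = t"
      using m\<kappa>'(1)[OF U10, of t] tK Pk(3)[OF tK] unfolding m0 K0_def by (simp add: linear_0[OF lin_dgT])
    have \<Psi>3: "frechet_derivative \<Psi> (at 0) (t, 0) = (t, frechet_derivative \<tau> (at x0) t)"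
      using \<Psi>'t[OF U10 K00 tK] unfolding m0 mt by (simp add: zero_prod_def)
    have lin\<Psi>: "linear (frechet_derivative \<Psi> (at 0))" using has_derivative_linear[OF \<Psi>d[OF \<Omega>0]] .
    have "frechet_derivative \<Psi> (at 0) z = (t, frechet_derivative \<tau> (at x0) t) + (c *\<^sub>R (v x0, 0) + snd z *\<^sub>R (- w x0, 1)) + (q, 0)"
      by (subst zq) (simp only: linear_add[OF lin\<Psi>] \<Psi>1 \<Psi>2 \<Psi>3)
    then have "(t, frechet_derivative \<tau> (at x0) t) + (c *\<^sub>R (v x0, 0) + snd z *\<^sub>R (- w x0, 1)) + (q, 0) = 0"
      using z by simp
    then have eq1: "t + c *\<^sub>R v x0 - snd z *\<^sub>R w x0 + q = 0" and eq2: "frechet_derivative \<tau> (at x0) t + snd z = 0"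
      by (auto simp: zero_prod_def add_diff_eq)
    have wK: "w x0 \<in> K0" using w0[OF X'(2)] unfolding K0_def by simp
    have "q \<bullet> (t + c *\<^sub>R v x0 - snd z *\<^sub>R w x0 + q) = 0" using eq1 by simp
    then have q0: "q = 0" using qK[OF tK] qv qK[OF wK] by (simp add: inner_add_right inner_diff_right)
    have "v x0 \<bullet> (t + c *\<^sub>R v x0 - snd z *\<^sub>R w x0 + q) = 0" using eq1 by simp
    then have c0: "c = 0" using vK[OF tK] vK[OF wK] q0 vv by (simp add: inner_add_right inner_diff_right)
    have t: "t = snd z *\<^sub>R w x0" using eq1 q0 c0 by simp
    have "snd z * (w x0 \<bullet> w x0) + snd z = 0"
      using eq2 w\<tau>[OF X'(2), of t] tK unfolding K0_def by (simp add: t)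
    then have "snd z * (w x0 \<bullet> w x0 + 1) = 0" by (simp add: algebra_simps)
    then have "snd z = 0" using inner_ge_zero[of "w x0"] by (auto simp: add_nonneg_eq_0_iff)
    then show "z = 0" using zq q0 c0 t by (simp add: zero_prod_def)
  qed
  obtain A1 B1 \<Phi> where A1: "0 \<in> A1" "A1 \<subseteq> \<Omega>" "Ck_diffeo (Suc k) A1 B1 \<Psi> \<Phi>"
    by (rule Ck_inverse_function[OF \<Omega> \<Omega>0 \<Psi>C inj\<Psi>]) (assumption | rule that)+
  have d1: "open A1" "homeomorphism A1 B1 \<Psi> \<Phi>" using A1(3) unfolding Ck_diffeo_def by auto
  obtain r1 where r1: "r1 > 0" "ball 0 r1 \<subseteq> A1" using d1(1) A1(1) open_contains_ball by blast
  \<comment> \<open>A point of \<open>T\<close> in \<open>Nb\<close> has its coordinates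
    \<open>(\<kappa> (fst q), 0)\<close> in the domain \<open>A1\<close> where \<open>\<Psi>\<close>
    is injective, so no other preimage can compete. The ball around \<open>p\<close> is where
    \<open>H\<close> is tied to the original \<open>f\<close>.\<close>
  define Nb where "Nb = {q. fst q \<in> A0 \<inter> X} \<inter> {q. (\<kappa> (fst q), 0::real) \<in> ball 0 r1} \<inter> ball p \<delta>"
  have "open Nb"
  proof -
    have "continuous_on UNIV \<kappa>" using Ck_on_continuous[OF \<kappa>C] .
    then have "continuous_on UNIV (\<lambda>q::(real^'n) \<times> real. \<kappa> (fst q))"
      using continuous_on_compose2[OF _ continuous_on_fst[OF continuous_on_id]] by blast
    then have "continuous_on UNIV (\<lambda>q::(real^'n) \<times> real. (\<kappa> (fst q), 0::real))" by (intro continuous_intros)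
    then have "open ((\<lambda>q::(real^'n) \<times> real. (\<kappa> (fst q), 0::real)) -` ball 0 r1)" by (rule open_vimage[OF open_ball])
    moreover have "open (fst -` (A0 \<inter> X) :: ((real^'n) \<times> real) set)" by (intro open_vimage open_Int d0 X continuous_intros)
    ultimately show ?thesis unfolding Nb_def vimage_def by (intro open_Int open_ball)
  qed
  moreover have "\<Psi> 0 \<in> Nb" unfolding \<Psi>0 Nb_def using A0(1) X(2) \<kappa>x0 r1(1) \<delta> p by (simp add: zero_prod_def[symmetric])
  moreover have "continuous_on A1 \<Psi>" using d1(2) unfolding homeomorphism_def by blast
  ultimately have "open (A1 \<inter> \<Psi> -` Nb)" "0 \<in> A1 \<inter> \<Psi> -` Nb"
    using continuous_open_preimage[OF _ d1(1)] A1(1) by auto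
  then obtain r2 where r2: "r2 > 0" "ball 0 r2 \<subseteq> A1 \<inter> \<Psi> -` Nb" using open_contains_ball by blast
  \<comment> \<open>A ball, because \<open>centre_foliation_of_chart\<close> wants the range of the
    chart to be convex.\<close>
  define B where "B = (ball 0 r2 :: ((real^'n) \<times> real) set)"
  define A where "A = \<Psi> ` B"
  have B: "B \<subseteq> A1" "B \<subseteq> \<Omega>" "0 \<in> B" "convex B" using r2 A1(2) unfolding B_def by auto
  have dif: "Ck_diffeo (Suc k) A B \<Phi> \<Psi>"
    unfolding A_def by (rule Ck_diffeo_sym[OF Ck_diffeo_restrict[OF A1(3)]]) (use B in \<open>auto simp: B_def\<close>)
  have ANb: "A \<subseteq> Nb" unfolding A_def using r2(2) unfolding B_def by auto
  have pA: "p \<in> A" unfolding A_def using B(3) \<Psi>0 by (metis imageI)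
  define L1 where "L1 = K0 \<times> {0::real}"
  define P2' where "P2' = span {v x0} \<times> (UNIV :: real set)"
  have P2': "z \<in> P2' \<longleftrightarrow> (\<exists>c. z = (c *\<^sub>R v x0, snd z))" for z
    unfolding P2'_def by (cases z) (auto simp: span_singleton)
  define Wg where "Wg = {q. H (q - p) = q - p}"
  have BL1: "u \<in> U1 \<and> u \<in> K0 \<and> l = (u, 0)" if "l \<in> B \<inter> L1" "u = fst l" for l u
    using that B(2) Pk(3) unfolding L1_def \<Omega>_def by (auto simp: prod_eq_iff)
  have AW: "A \<inter> Wg = \<Psi> ` (B \<inter> C)"
  proof -
    \<comment> \<open>\<open>H\<close> sees only the centre component, which the summand
      \<open>z - P z\<close> does not change. Hence \<open>H\<close> sends
      \<open>\<Psi> z - p\<close> to \<open>H (cc z)\<close>, and the two agree exactly when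
      \<open>z = P z\<close>.\<close>
    have "\<Psi> z \<in> Wg \<longleftrightarrow> z \<in> C" for z
    proof -
      let ?h = "H (cc z) + (z - P z)"
      have "P ?h = P (cc z)"
        using PH P(3)[OF P(2)] by (simp add: linear_add[OF P(1)] linear_diff[OF P(1)])
      then have "H ?h = H (cc z)" using HP by metis
      moreover have "\<Psi> z - p = ?h" unfolding \<Psi>_def by simp
      ultimately have "\<Psi> z \<in> Wg \<longleftrightarrow> P z = z" unfolding Wg_def by auto
      then show ?thesis using P(2,3) by metis
    qed
    then show ?thesis unfolding A_def by blast
  qed
  have AT: "A \<inter> T = \<Psi> ` (B \<inter> L1)"
  proof
    show "\<Psi> ` (B \<inter> L1) \<subseteq> A \<inter> T"
    proof (rule image_subsetI)
      fix l assume l: "l \<in> B \<inter> L1"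
      have u: "fst l \<in> U1" "fst l \<in> K0" "l = (fst l, 0)" using BL1[OF l refl] by auto
      have "\<Psi> l = \<sigma> (fst l)" using \<Psi>\<sigma>[OF u(1,2)] u(3) by simp
      then have "\<Psi> l \<in> T" using fib(3)[OF u(1,2)] by simp
      moreover have "\<Psi> l \<in> A" unfolding A_def using l by blast
      ultimately show "\<Psi> l \<in> A \<inter> T" by blast
    qed
    show "A \<inter> T \<subseteq> \<Psi> ` (B \<inter> L1)"
    proof
      fix q assume q: "q \<in> A \<inter> T"
      then obtain b where b: "b \<in> B" "q = \<Psi> b" unfolding A_def by blast
      have qN: "fst q \<in> A0" "fst q \<in> X" "(\<kappa> (fst q), 0::real) \<in> ball 0 r1" using q ANb unfolding Nb_def by auto
      have qT: "g (fst q) = y" "q = (fst q, \<tau> (fst q))" using TD[of q] q qN(2) by auto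
      define l where "l = (\<kappa> (fst q), 0::real)"
      have lA: "l \<in> A1" unfolding l_def using qN(3) r1(2) by blast
      have uK: "\<kappa> (fst q) \<in> K0" using \<kappa>K qT(1) by blast
      have uU: "\<kappa> (fst q) \<in> U1" using lA A1(2) Pk(3)[OF uK] unfolding \<Omega>_def l_def by auto
      have "\<Psi> l = q" unfolding l_def \<Psi>\<sigma>[OF uU uK] \<sigma>_def m\<kappa>(1)[OF qN(1)] using qT(2) by simp
      then have "l = b" using b lA B(1) homeomorphism_apply1[OF d1(2)] by (metis subsetD)
      then have "l \<in> B \<inter> L1" using b(1) uK unfolding L1_def l_def by auto
      then show "q \<in> \<Psi> ` (B \<inter> L1)" using \<open>\<Psi> l = q\<close> by blast
    qed
  qed
  \<comment> \<open>Tangent spaces are local, so the chart computes that of \<open>T\<close> itself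
    and not only that of \<open>T \<inter> A\<close>; the splitting refers to the normal space of
    the former.\<close>
  have Teq: "tangent_space T (\<sigma> u) = {(t, w (m u) \<bullet> t) | t. dg (m u) t = 0}" if l: "(u, 0) \<in> B \<inter> L1" for u
  proof -
    have u: "u \<in> U1" "u \<in> K0" using BL1[OF l refl] by auto
    have L1s: "subspace L1" unfolding L1_def by (intro subspace_Times K0 subspace_single_0)
    have "z - (u, 0) \<in> L1 \<longleftrightarrow> z \<in> L1" for z
      using subspace_diff[OF L1s, of z "(u, 0)"] subspace_add[OF L1s, of "z - (u, 0)" "(u, 0)"] l by auto
    then have "{z \<in> B. z - (u, 0) \<in> L1} = B \<inter> L1" by blast
    then have "tangent_space (T \<inter> A) (\<Psi> (u, 0)) = frechet_derivative \<Psi> (at (u, 0)) ` L1"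
      using tangent_space_slice[OF dif L1s, of "(u, 0)"] l AT by (simp add: Int_commute)
    moreover have "\<Psi> (u, 0) \<in> A" using l unfolding A_def by blast
    moreover have "open A" using dif unfolding Ck_diffeo_def by blast
    ultimately have "tangent_space T (\<sigma> u) = frechet_derivative \<Psi> (at (u, 0)) ` L1"
      using tangent_space_Int_open[of A "\<Psi> (u, 0)" T] \<Psi>\<sigma>[OF u] by simp
    then show ?thesis unfolding L1_def tan[OF u] .
  qed
  have E: "frechet_derivative \<Psi> (at l) ` P2' = Ec (\<Psi> l)" if l: "l \<in> B \<inter> L1" for l
  proof -
    define u where "u = fst l"
    have u: "u \<in> U1" "u \<in> K0" "l = (u, 0)" using BL1[OF l u_def] by auto
    note ux = U1X[OF u(1)]
    obtain r where r: "r < \<mu> (m u)" "\<And>a. a \<bullet> v (m u) = 0 \<Longrightarrow> a \<bullet> G (m u) a \<le> r * (a \<bullet> a)" using gap[OF ux(4)] by blast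
    have Tq: "(m u, \<tau> (m u)) \<in> T_set g y - T_tilde g y" using fib(3)[OF u(1,2)] unfolding T_def \<sigma>_def .
    have \<tau>m: "\<tau> (m u) = 2 / \<mu> (m u)" unfolding \<tau>_def ..
    have ts: "tangent_space (T_set g y - T_tilde g y) (m u, \<tau> (m u)) = {(t, w (m u) \<bullet> t) | t. dg (m u) t = 0}"
      using Teq[of u] l u(3) unfolding T_def \<sigma>_def by blast
    have "Ec (m u, \<tau> (m u)) = span {(v (m u), 0), (- w (m u), 1)}"
      by (rule centre_space_eq[OF split Tq fib(1)[OF u(1,2)] nv[OF ux(4)] Gv[OF ux(4)] \<mu>pos[OF ux(4)] \<tau>m r w0[OF ux(3)] ts])
    moreover have "frechet_derivative \<Psi> (at l) ` P2' = span {e1 u, e2 u}"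
    proof (intro set_eqI iffI)
      fix z assume "z \<in> frechet_derivative \<Psi> (at l) ` P2'"
      then obtain c s where "z = frechet_derivative \<Psi> (at l) (c *\<^sub>R v x0, s)" using P2' by auto
      then have "z = c *\<^sub>R e1 u + s *\<^sub>R e2 u" using \<Psi>'v[OF u(1,2)] u(3) by simp
      then show "z \<in> span {e1 u, e2 u}"
        using span_add[OF span_scale[OF span_base] span_scale[OF span_base], of "e1 u" "{e1 u, e2 u}" "e2 u" c s] by simp
    next
      fix z assume "z \<in> span {e1 u, e2 u}"
      then obtain c s where "z = c *\<^sub>R e1 u + s *\<^sub>R e2 u"
        by (auto simp: span_insert span_singleton algebra_simps)
      then have "z = frechet_derivative \<Psi> (at l) (c *\<^sub>R v x0, s)" using \<Psi>'v[OF u(1,2)] u(3) by simp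
      moreover have "(c *\<^sub>R v x0, s) \<in> P2'" unfolding P2' by auto
      ultimately show "z \<in> frechet_derivative \<Psi> (at l) ` P2'" by blast
    qed
    moreover have "\<Psi> l = (m u, \<tau> (m u))" using \<Psi>\<sigma>[OF u(1,2)] u(3) unfolding \<sigma>_def by simp
    ultimately show ?thesis unfolding e1_def e2_def by simp
  qed
  have v0: "v x0 \<noteq> 0" using vv by auto
  have spK: "span K0 = K0" using K0 by (rule span_eq_iff[THEN iffD2])
  have dimC: "dim C = CARD('n) - CARD('m) + 2"
  proof -
    have "C = span (insert (v x0) K0) \<times> (UNIV :: real set)"
    proof (intro set_eqI iffI)
      fix z assume "z \<in> C"
      then have "fst z = Pk (fst z) + (fst z \<bullet> v x0) *\<^sub>R v x0" unfolding CI .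
      moreover have "Pk (fst z) + (fst z \<bullet> v x0) *\<^sub>R v x0 \<in> span (insert (v x0) K0)"
        using Pk(2) by (intro span_add span_scale span_base) auto
      ultimately show "z \<in> span (insert (v x0) K0) \<times> UNIV" by (simp add: mem_Times_iff)
    next
      fix z assume "z \<in> span (insert (v x0) K0) \<times> (UNIV :: real set)"
      then obtain c where "fst z - c *\<^sub>R v x0 \<in> span K0" by (auto simp: span_insert mem_Times_iff)
      then have "fst z - c *\<^sub>R v x0 \<in> K0" unfolding spK .
      from CI'[OF this, of c "snd z"] show "z \<in> C" by simp
    qed
    moreover have "v x0 \<notin> span K0" unfolding spK using vK[of "v x0"] vv by auto
    ultimately show ?thesis
      using dim_kernel[OF x0(2)] K0_def by (simp add: dim_Times dim_insert)
  qed
  have dimP2: "dim P2' = 2"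
    unfolding P2'_def using v0 by (simp add: dim_Times dim_insert)
  have sum: "is_direct_sum C L1 P2'"
    unfolding is_direct_sum_def
  proof (intro conjI)
    show "subspace L1" unfolding L1_def by (intro subspace_Times K0 subspace_single_0)
    show "subspace P2'" unfolding P2'_def by (intro subspace_Times subspace_span subspace_UNIV)
    show "L1 \<inter> P2' = {0}"
    proof (intro set_eqI iffI)
      fix z assume z: "z \<in> L1 \<inter> P2'"
      then obtain c where "z = (c *\<^sub>R v x0, snd z)" using P2' by blast
      then have c: "fst z = c *\<^sub>R v x0" by (metis fst_conv)
      have "v x0 \<bullet> fst z = 0" "snd z = 0" using z vK unfolding L1_def by auto
      then show "z \<in> {0}" using c vv by (simp add: prod_eq_iff)
    next
      fix z :: "(real^'n) \<times> real" assume "z \<in> {0}"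
      then show "z \<in> L1 \<inter> P2'" unfolding L1_def P2'_def using K00 by (auto simp: zero_prod_def span_zero)
    qed
    show "C = {a + b |a b. a \<in> L1 \<and> b \<in> P2'}"
    proof (intro set_eqI iffI)
      fix z assume "z \<in> C"
      then have "fst z = Pk (fst z) + (fst z \<bullet> v x0) *\<^sub>R v x0" unfolding CI .
      then have "z = (Pk (fst z), 0) + ((fst z \<bullet> v x0) *\<^sub>R v x0, snd z)" by (simp add: prod_eq_iff)
      moreover have "(Pk (fst z), 0) \<in> L1" "((fst z \<bullet> v x0) *\<^sub>R v x0, snd z) \<in> P2'"
        unfolding L1_def P2' using Pk(2) by auto
      ultimately show "z \<in> {a + b |a b. a \<in> L1 \<and> b \<in> P2'}" by blast
    next
      fix z assume "z \<in> {a + b |a b. a \<in> L1 \<and> b \<in> P2'}"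
      then obtain a b where ab: "a \<in> L1" "b \<in> P2'" "z = a + b" by blast
      obtain c where "b = (c *\<^sub>R v x0, snd b)" using ab(2) P2' by blast
      moreover have "a = (fst a, 0)" "fst a \<in> K0" using ab(1) unfolding L1_def by (auto simp: prod_eq_iff)
      ultimately have "z = (fst a + c *\<^sub>R v x0, snd b)" using ab(3) by (metis add_Pair add_0)
      then show "z \<in> C" using CI'[OF \<open>fst a \<in> K0\<close>] by simp
    qed
  qed
  have fcont: "continuous_on UNIV f" using Ck_on_continuous[OF fC] .
  have fT: "f x = x" if "x \<in> A \<inter> T" for x
  proof -
    have "g (fst x) = y" using TD(1) that by blast
    from gd_step_fixed[OF this, of "snd x"] show ?thesis unfolding f_def by simp
  qed
  have fW: "f x \<in> Wg" if "x \<in> A \<inter> Wg" for x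
  proof -
    have "norm (x - p) < \<delta>" using that ANb unfolding Nb_def by (auto simp: dist_norm norm_minus_commute)
    moreover have "H (x - p) = x - p" using that unfolding Wg_def by blast
    ultimately have "H (D (x - p) + R0 (x - p)) = D (x - p) + R0 (x - p)" by (rule Hinv)
    then show ?thesis unfolding F Wg_def by simp
  qed
  note final = centre_foliation_of_chart[OF dif B(4) sum C dimC dimP2 AW AT E fcont fT fW]
  obtain LL where LL: "Ck_foliation (Suc k) 2 (CARD('n) - CARD('m) + 2) (A \<inter> Wg) LL"
    "\<forall>F\<in>LL. \<forall>x\<in>(T \<inter> A) \<inter> F. tangent_space F x = Ec x" using final(4) by blast
  have "p \<in> T \<inter> A" using pA pT unfolding T_def by blast
  then show ?thesis
    using final(1,2,3) LL unfolding f_def T_def[symmetric]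
    by (intro exI[of _ "T \<inter> A"] exI[of _ "A \<inter> Wg"] exI[of _ LL] conjI) auto
qed

end

theorem theorem1p2:
  fixes g :: "real^'n \<Rightarrow> real^'m" and y :: "real^'m"
    and Ec Es :: "(real^'n) \<times> real \<Rightarrow> ((real^'n) \<times> real) set"
    and k :: nat and p :: "(real^'n) \<times> real"
  assumes "CARD('m) < CARD('n)"
    and "smooth_on g UNIV"
    and "y \<in> range g"
    and "regular_value g y"
    and "centre_stable_splitting (gd_step g y) (T_set g y - T_tilde g y) Ec Es"
    and "k \<ge> 2"
    and "p \<in> T_set g y - T_tilde g y"
  shows "\<exists>U W LL.
    openin (top_of_set (T_set g y - T_tilde g y)) U \<and> p \<in> U \<and>
    centre_manifold k (CARD('n) - CARD('m) + 2) (gd_step g y) U W \<and>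
    (\<forall>q\<in>U. is_direct_sum (tangent_space W q) (tangent_space U q) (Ec q)) \<and>
    Ck_foliation k 2 (CARD('n) - CARD('m) + 2) W LL \<and>
    (\<forall>F\<in>LL. \<forall>q\<in>U \<inter> F. tangent_space F q = Ec q)"
proof -
  interpret regular_level g y
    using assms(1,2,4) by unfold_locales
  obtain j where "k = Suc j" using assms(6) by (cases k) auto
  then show ?thesis using local_centre_foliation[OF assms(5,7), of j] by blast
qed

end
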